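(* Let $\mathbb{K}$ be an algebraically closed field with $\mathrm{char}(\mathbb{K}) = 3$. Then: (1) For all integers $n \geq 2$ and $d \geq 3$, $\text{rank-index}(\mathbb{P}^n, \mathcal{O}_{\mathbb{P}^n}(d)) = 3$. (2) Let $X$ be a projective variety over $\mathbb{K}$ and let $L$ be a very ample line bundle on $X$ defining the linearly normal embedding $X \subset \mathbb{P}^r$, $r = h^0(X,L)-1$. If $m \geq 3$ is an integer such that $X \subset \mathbb{P}^r$ is $j$-normal for all $j \geq m$ and the homogeneous ideal $I(X,L)$ of $X$ in $\mathbb{P}^r$ is generated by forms of degree $\leq m$, then $$\text{rank-index}(X, L^{d}) = 3 \quad \text{for all } d \geq m.$$
   Context: For a projective variety $X$ over an algebraically closed field $\mathbb{K}$ with $\mathrm{char}(\mathbb{K}) \neq 2$ and a very ample line bundle $L$ on $X$, consider the embedding $X \subset \mathbb{P}^r$, $r = h^0(X,L)-1$, given by the complete linear series $|L|$ (the linearly normal embedding), and let $I(X,L)$ denote the homogeneous ideal of $X$ in $\mathbb{P}^r$. The rank of a quadratic form is the rank of its associated symmetric matrix. The pair $(X,L)$ satisfies property $\mathsf{QR}(k)$ if $I(X,L)$ is generated by quadratic forms of rank at most $k$. When $I(X,L)$ is generated by quadrics, $\text{rank-index}(X,L)$ is the minimal integer $k$ such that $(X,L)$ satisfies property $\mathsf{QR}(k)$; in particular, the assertion $\text{rank-index}(X,L)=3$ includes that $I(X,L)$ is generated by quadrics. The variety $X \subset \mathbb{P}^r$ is $j$-normal if the restriction map $H^0(\mathbb{P}^r,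 \mathcal{O}_{\mathbb{P}^r}(j)) \to H^0(X, L^{j})$ is surjective. $L^d$ denotes $L^{\otimes d}$.
   Formalization: Part (2) additionally assumes that X is not a single point: for a point, I(X, L^d) = 0 satisfies QR(k) for every k, so its rank-index is not 3 although all the stated hypotheses hold. *)

theory Defs
  imports
    "HOL-Analysis.Abstract_Topology"
    "HOL-Algebra.Ideal"
    "HOL-Computational_Algebra.Polynomial"
    "HOL-Library.Poly_Mapping"
    "HOL-Library.Extended_Nat"
    "HOL-Library.Function_Algebras"
    "Jordan_Normal_Form.DL_Rank"
begin

section \<open>Polynomials and forms\<close>

text \<open>
  Polynomials have variables \<open>x\<^sub>0, x\<^sub>1, \<dots>\<close> indexed by \<^typ>\<open>nat\<close>; a monomial is its finitely supported
  exponent vector. The ring \<open>K[x\<^sub>0, \<dots>, x\<^sub>r]\<close> is the sub-ring \<open>poly_ring r\<close>, so that the number of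
  variables may depend on other data (below it is \<open>h\<^sup>0(X, L)\<close>).
\<close>

type_synonym 'k mpoly = "(nat \<Rightarrow>\<^sub>0 nat) \<Rightarrow>\<^sub>0 'k"

definition eval :: "(nat \<Rightarrow> 'k) \<Rightarrow> 'k::comm_ring_1 mpoly \<Rightarrow> 'k" where
  "eval v F = (\<Sum>m\<in>Poly_Mapping.keys F. Poly_Mapping.lookup F m *
     (\<Prod>i\<in>Poly_Mapping.keys m. v i ^ Poly_Mapping.lookup m i))"

definition total_deg :: "(nat \<Rightarrow>\<^sub>0 nat) \<Rightarrow> nat" where
  "total_deg m = (\<Sum>i\<in>Poly_Mapping.keys m. Poly_Mapping.lookup m i)"

definition homogeneous :: "nat \<Rightarrow> 'k::comm_ring_1 mpoly \<Rightarrow> bool" where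
  "homogeneous e F \<longleftrightarrow> (\<forall>m\<in>Poly_Mapping.keys F. total_deg m = e)"

definition poly_ring :: "nat \<Rightarrow> 'k::comm_ring_1 mpoly ring" where
  "poly_ring r = \<lparr>carrier = {F. \<forall>m\<in>Poly_Mapping.keys F. Poly_Mapping.keys m \<subseteq> {..r}},
     monoid.mult = (*), one = 1, ring.zero = 0, add = (+)\<rparr>"

definition forms :: "nat \<Rightarrow> nat \<Rightarrow> 'k::comm_ring_1 mpoly set" where
  "forms r e = {F \<in> carrier (poly_ring r). homogeneous e F}"

text \<open>
  The symmetric matrix of a quadratic form in \<open>x\<^sub>0, \<dots>, x\<^sub>r\<close>, in characteristic different from 2: the
  diagonal entries are the coefficients of \<open>x\<^sub>i\<^sup>2\<close>, the others half the coefficients of \<open>x\<^sub>i x\<^sub>j\<close>.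
\<close>

definition quad_matrix :: "nat \<Rightarrow> 'k::field mpoly \<Rightarrow> 'k mat" where
  "quad_matrix r Q = Matrix.mat (Suc r) (Suc r) (\<lambda>(i, j).
     let c = Poly_Mapping.lookup Q (Poly_Mapping.single i 1 + Poly_Mapping.single j 1)
     in if i = j then c else c / 2)"

definition quad_rank :: "nat \<Rightarrow> 'k::field mpoly \<Rightarrow> nat" where
  "quad_rank r Q = vec_space.rank (Suc r) (quad_matrix r Q)"


section \<open>Projective space, the Zariski topology and regular functions\<close>

text \<open>
  A point is a punctured line through the origin, that is, the set of all its homogeneous
  coordinate vectors. The points of \<open>P\<^sup>N\<close> are those whose coordinates beyond index \<open>N\<close> vanish, so all
  projective spaces are nested in one ambient set \<open>all_points\<close>. On \<open>P\<^sup>N\<close> a form in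
  arbitrarily many variables agrees with the form of the same degree obtained by deleting the
  monomials involving a variable beyond \<open>x\<^sub>N\<close>; hence the topology and the regular functions defined
  here induce the usual ones on subsets of \<open>P\<^sup>N\<close>.
\<close>

type_synonym 'k point = "(nat \<Rightarrow> 'k) set"

definition pline :: "(nat \<Rightarrow> 'k) \<Rightarrow> 'k::field point" where
  "pline v = {\<lambda>i. c * v i | c. c \<noteq> 0}"

definition all_points :: "'k::field point set" where
  "all_points = {pline v | v. v \<noteq> (\<lambda>_. 0)}"

definition proj_space :: "nat \<Rightarrow> 'k::field point set" where
  "proj_space N = {pline v | v. v \<noteq> (\<lambda>_. 0) \<and> (\<forall>i>N. v i = 0)}"

definition vanishes_at :: "'k::field mpoly \<Rightarrow> 'k point \<Rightarrow> bool" where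
  "vanishes_at F P \<longleftrightarrow> (\<forall>v\<in>P. eval v F = 0)"

definition zero_locus :: "'k::field mpoly set \<Rightarrow> 'k point set" where
  "zero_locus T = {P \<in> all_points. \<forall>F\<in>T. vanishes_at F P}"

definition zariski_open :: "'k::field point set \<Rightarrow> bool" where
  "zariski_open U \<longleftrightarrow> (\<exists>T. (\<forall>F\<in>T. \<exists>e. homogeneous e F) \<and> U = all_points - zero_locus T)"

definition zariski :: "'k::field point topology" where
  "zariski = topology zariski_open"

lemma eval_alt:
  assumes "finite A" "Poly_Mapping.keys F \<subseteq> A"
  shows "eval v F = (\<Sum>m\<in>A. Poly_Mapping.lookup F m *
     (\<Prod>i\<in>Poly_Mapping.keys m. v i ^ Poly_Mapping.lookup m i))"
  unfolding eval_def
  by (rule sum.mono_neutral_left) (use assms in \<open>auto simp: in_keys_iff\<close>)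

lemma monom_val_add:
  fixes v :: "nat \<Rightarrow> 'k::comm_ring_1" and m m' :: "nat \<Rightarrow>\<^sub>0 nat"
  shows "(\<Prod>i\<in>Poly_Mapping.keys (m + m'). v i ^ Poly_Mapping.lookup (m + m') i) =
    (\<Prod>i\<in>Poly_Mapping.keys m. v i ^ Poly_Mapping.lookup m i) *
    (\<Prod>i\<in>Poly_Mapping.keys m'. v i ^ Poly_Mapping.lookup m' i)"
proof -
  let ?A = "Poly_Mapping.keys m \<union> Poly_Mapping.keys m'"
  have *: "(\<Prod>i\<in>Poly_Mapping.keys p. v i ^ Poly_Mapping.lookup p i) = (\<Prod>i\<in>?A. v i ^ Poly_Mapping.lookup p i)"
    if "Poly_Mapping.keys p \<subseteq> ?A" for p :: "nat \<Rightarrow>\<^sub>0 nat"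
    by (rule prod.mono_neutral_left) (use that in \<open>auto simp: in_keys_iff\<close>)
  show ?thesis
    unfolding *[OF Poly_Mapping.keys_add] *[OF Un_upper1] *[OF Un_upper2]
    by (simp add: lookup_add power_add prod.distrib)
qed

lemma total_deg_add: "total_deg (m + m') = total_deg m + total_deg m'"
proof -
  let ?A = "Poly_Mapping.keys m \<union> Poly_Mapping.keys m'"
  have *: "total_deg p = (\<Sum>i\<in>?A. Poly_Mapping.lookup p i)" if "Poly_Mapping.keys p \<subseteq> ?A" for p
    unfolding total_deg_def
    by (rule sum.mono_neutral_left) (use that in \<open>auto simp: in_keys_iff\<close>)
  show ?thesis
    unfolding *[OF Poly_Mapping.keys_add] *[OF Un_upper1] *[OF Un_upper2]
    by (simp add: lookup_add sum.distrib)
qed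

lemma eval_add: "eval v (F + G) = eval v F + eval v G"
proof -
  let ?A = "Poly_Mapping.keys F \<union> Poly_Mapping.keys G"
  have "eval v H = (\<Sum>m\<in>?A. Poly_Mapping.lookup H m *
     (\<Prod>i\<in>Poly_Mapping.keys m. v i ^ Poly_Mapping.lookup m i))" if "Poly_Mapping.keys H \<subseteq> ?A" for H
    by (rule eval_alt) (use that in auto)
  then show ?thesis
    by (simp add: Poly_Mapping.keys_add lookup_add sum.distrib distrib_right)
qed

lemma eval_zero [simp]: "eval v 0 = 0"
  by (simp add: eval_def)

lemma eval_one [simp]: "eval v 1 = 1"
  unfolding eval_def by (simp flip: single_one)

lemma eval_single:
  "eval v (Poly_Mapping.single m c) = c * (\<Prod>i\<in>Poly_Mapping.keys m. v i ^ Poly_Mapping.lookup m i)"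
  by (simp add: eval_def)

lemma mpoly_induct [case_names single add]:
  fixes F :: "'k::comm_ring_1 mpoly"
  assumes "\<And>m c. P (Poly_Mapping.single m c)" and "\<And>F G. P F \<Longrightarrow> P G \<Longrightarrow> P (F + G)"
  shows "P F"
proof (induction F rule: update_induct)
  case const
  then show ?case using assms(1)[of 0 0] by simp
next
  case (update f a b)
  have "Poly_Mapping.update a b f = f + Poly_Mapping.single a b"
    using update(1) by (intro poly_mapping_eqI) (auto simp: lookup_update lookup_add lookup_single in_keys_iff)
  then show ?case using update assms by simp
qed

lemma eval_mult: "eval v (F * G) = eval v F * eval v G"
proof (induction F rule: mpoly_induct)
  case (single m c)
  show ?case
    by (induction G rule: mpoly_induct)
       (simp_all add: mult_single eval_single monom_val_add distrib_left eval_add)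
qed (simp add: distrib_right eval_add)

lemma homogeneous_mult:
  assumes "homogeneous d F" "homogeneous e G"
  shows "homogeneous (d + e) (F * G)"
  using assms keys_mult[of F G] unfolding homogeneous_def by (fastforce simp: total_deg_add)

lemma eval_homogeneous_scale:
  assumes "homogeneous e F"
  shows "eval (\<lambda>i. c * v i) F = c ^ e * eval v F"
proof -
  have "(\<Prod>i\<in>Poly_Mapping.keys m. (c * v i) ^ Poly_Mapping.lookup m i) =
      c ^ e * (\<Prod>i\<in>Poly_Mapping.keys m. v i ^ Poly_Mapping.lookup m i)"
    if "m \<in> Poly_Mapping.keys F" for m
    using that assms
    by (auto simp: homogeneous_def total_deg_def power_mult_distrib prod.distrib power_sum)
  then show ?thesis
    unfolding eval_def sum_distrib_left by (intro sum.cong) (auto simp: mult_ac)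
qed

lemma vanishes_at_pline:
  assumes "homogeneous e F"
  shows "vanishes_at F (pline v) \<longleftrightarrow> eval v F = 0"
proof
  assume "vanishes_at F (pline v)"
  moreover have "v \<in> pline v"
    unfolding pline_def by (force intro: exI[of _ 1])
  ultimately show "eval v F = 0"
    by (simp add: vanishes_at_def)
next
  assume "eval v F = 0"
  then show "vanishes_at F (pline v)"
    by (auto simp: vanishes_at_def pline_def eval_homogeneous_scale[OF assms])
qed

lemma istopology_zariski: "istopology zariski_open"
  unfolding istopology_def
proof (intro conjI allI impI)
  fix U V :: "'k::field point set"
  assume "zariski_open U" "zariski_open V"
  then obtain S T where S: "\<forall>F\<in>S. \<exists>e. homogeneous e F" "U = all_points - zero_locus S"
    and T: "\<forall>F\<in>T. \<exists>e. homogeneous e F" "V = all_points - zero_locus T"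
    unfolding zariski_open_def by auto
  let ?R = "{F * G | F G. F \<in> S \<and> G \<in> T}"
  have hom: "\<forall>F\<in>?R. \<exists>e. homogeneous e F"
    using S(1) T(1) homogeneous_mult by blast
  have prod: "vanishes_at (F * G) P \<longleftrightarrow> vanishes_at F P \<or> vanishes_at G P"
    if "F \<in> S" "G \<in> T" "P \<in> all_points" for F G P
  proof -
    from that obtain v where P: "P = pline v"
      unfolding all_points_def by auto
    from that S(1) T(1) obtain d e where h: "homogeneous d F" "homogeneous e G"
      by blast
    show ?thesis
      unfolding P vanishes_at_pline[OF h(1)] vanishes_at_pline[OF h(2)]
        vanishes_at_pline[OF homogeneous_mult[OF h]] by (simp add: eval_mult)
  qed
  have "P \<in> U \<inter> V \<longleftrightarrow> P \<in> all_points - zero_locus ?R" for P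
  proof (cases "P \<in> all_points")
    case True
    then have "P \<in> zero_locus ?R \<longleftrightarrow> (\<forall>F\<in>S. \<forall>G\<in>T. vanishes_at F P \<or> vanishes_at G P)"
      unfolding zero_locus_def using prod by blast
    with True show ?thesis
      unfolding S(2) T(2) zero_locus_def by blast
  qed (simp add: S(2))
  then show "zariski_open (U \<inter> V)"
    unfolding zariski_open_def using hom by blast
next
  fix K :: "'k::field point set set"
  assume "\<forall>U\<in>K. zariski_open U"
  then obtain T where T: "\<forall>U\<in>K. (\<forall>F\<in>T U. \<exists>e. homogeneous e F) \<and> U = all_points - zero_locus (T U)"
    unfolding zariski_open_def by metis
  have "\<Union>K = all_points - zero_locus (\<Union>U\<in>K. T U)"
  proof -
    have mem: "P \<in> U \<longleftrightarrow> P \<in> all_points \<and> (\<exists>F\<in>T U. \<not> vanishes_at F P)" if "U \<in> K" for U P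
    proof -
      have "U = all_points - zero_locus (T U)"
        using bspec[OF T that] by (rule conjunct2)
      then have "P \<in> U \<longleftrightarrow> P \<in> all_points - zero_locus (T U)"
        by (rule eqset_imp_iff)
      also have "\<dots> \<longleftrightarrow> P \<in> all_points \<and> (\<exists>F\<in>T U. \<not> vanishes_at F P)"
        unfolding zero_locus_def by blast
      finally show ?thesis .
    qed
    show ?thesis
    proof (rule Set.set_eqI)
      fix P
      have "P \<in> \<Union>K \<longleftrightarrow> (\<exists>U\<in>K. P \<in> all_points \<and> (\<exists>F\<in>T U. \<not> vanishes_at F P))"
        unfolding Union_iff by (rule bex_cong[OF refl mem])
      also have "\<dots> \<longleftrightarrow> P \<in> all_points - zero_locus (\<Union>U\<in>K. T U)"
        unfolding zero_locus_def by auto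
      finally show "P \<in> \<Union>K \<longleftrightarrow> P \<in> all_points - zero_locus (\<Union>U\<in>K. T U)" .
    qed
  qed
  then show "zariski_open (\<Union>K)"
    unfolding zariski_open_def using T by (intro exI[of _ "\<Union>U\<in>K. T U"] conjI) auto
qed

abbreviation zariski_on :: "'k::field point set \<Rightarrow> 'k point topology" where
  "zariski_on X \<equiv> subtopology zariski X"

definition irreducible_set :: "'k::field point set \<Rightarrow> bool" where
  "irreducible_set X \<longleftrightarrow> X \<noteq> {} \<and>
     (\<forall>A B. closedin (zariski_on X) A \<longrightarrow> closedin (zariski_on X) B \<longrightarrow> X = A \<union> B \<longrightarrow> X = A \<or> X = B)"

definition projective_variety :: "'k::field point set \<Rightarrow> bool" where
  "projective_variety X \<longleftrightarrow> (\<exists>N. X \<subseteq> proj_space N) \<and> closedin zariski X \<and> irreducible_set X"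

definition regular_on :: "'k::field point set \<Rightarrow> 'k point set \<Rightarrow> ('k point \<Rightarrow> 'k) \<Rightarrow> bool" where
  "regular_on X U f \<longleftrightarrow> (\<forall>P\<in>U. \<exists>V e F G. openin (zariski_on X) V \<and> P \<in> V \<and> V \<subseteq> U \<and>
     homogeneous e F \<and> homogeneous e G \<and>
     (\<forall>Q\<in>V. \<forall>v\<in>Q. eval v G \<noteq> 0 \<and> f Q = eval v F / eval v G))"

text \<open>
  An isomorphism onto a closed subvariety of \<open>P\<^sup>r\<close>; since \<open>X\<close> is reduced this is the same as a closed
  immersion.
\<close>

definition closed_embedding :: "'k::field point set \<Rightarrow> nat \<Rightarrow> ('k point \<Rightarrow> 'k point) \<Rightarrow> bool" where
  "closed_embedding X r \<phi> \<longleftrightarrow> \<phi> ` X \<subseteq> proj_space r \<and> closedin zariski (\<phi> ` X) \<and>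
     homeomorphic_map (zariski_on X) (zariski_on (\<phi> ` X)) \<phi> \<and>
     (\<forall>V f. openin (zariski_on (\<phi> ` X)) V \<longrightarrow>
        (regular_on (\<phi> ` X) V f \<longleftrightarrow> regular_on X {P \<in> X. \<phi> P \<in> V} (f \<circ> \<phi>)))"


section \<open>Line bundles\<close>

text \<open>
  A line bundle is given by a finite trivialising open cover \<open>U\<^sub>0, U\<^sub>1, \<dots>\<close> and a cocycle of nowhere
  vanishing transition functions \<open>g\<^sub>i\<^sub>j\<close> on \<open>U\<^sub>i \<inter> U\<^sub>j\<close>. A section is a family of regular functions
  \<open>s\<^sub>i\<close> on \<open>U\<^sub>i\<close> with \<open>s\<^sub>i = g\<^sub>i\<^sub>j s\<^sub>j\<close>, extended by zero outside the \<open>U\<^sub>i\<close>.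
\<close>

record 'k line_bundle =
  charts :: nat
  chart :: "nat \<Rightarrow> 'k point set"
  trans_fun :: "nat \<Rightarrow> nat \<Rightarrow> 'k point \<Rightarrow> 'k"

definition line_bundle_on :: "'k::field point set \<Rightarrow> 'k line_bundle \<Rightarrow> bool" where
  "line_bundle_on X L \<longleftrightarrow>
     (\<forall>i<charts L. openin (zariski_on X) (chart L i)) \<and> (\<Union>i<charts L. chart L i) = X \<and>
     (\<forall>i<charts L. \<forall>j<charts L. regular_on X (chart L i \<inter> chart L j) (trans_fun L i j) \<and>
        (\<forall>P\<in>chart L i \<inter> chart L j. trans_fun L i j P \<noteq> 0)) \<and>
     (\<forall>i<charts L. \<forall>j<charts L. \<forall>k<charts L. \<forall>P\<in>chart L i \<inter> chart L j \<inter> chart L k.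
        trans_fun L i k P = trans_fun L i j P * trans_fun L j k P)"

definition tensor_power :: "'k::field line_bundle \<Rightarrow> nat \<Rightarrow> 'k line_bundle" where
  "tensor_power L d = L\<lparr>trans_fun := \<lambda>i j P. trans_fun L i j P ^ d\<rparr>"

text \<open>
  The bundle \<open>O(1)\<close> on \<open>P\<^sup>n\<close>: on the chart \<open>x\<^sub>i \<noteq> 0\<close> a linear form \<open>F\<close> is represented by \<open>F / x\<^sub>i\<close>, so the
  transition functions are \<open>x\<^sub>j / x\<^sub>i\<close> (independent of the coordinate vector chosen).
\<close>

definition hyperplane_bundle :: "nat \<Rightarrow> 'k::field line_bundle" where
  "hyperplane_bundle n = \<lparr>charts = Suc n,
     chart = \<lambda>i. {P \<in> proj_space n. \<forall>v\<in>P. v i \<noteq> 0},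
     trans_fun = \<lambda>i j P. let v = (SOME v. v \<in> P) in v j / v i\<rparr>"

definition twisting_bundle :: "nat \<Rightarrow> nat \<Rightarrow> 'k::field line_bundle" where
  "twisting_bundle n d = tensor_power (hyperplane_bundle n) d"

type_synonym 'k sect = "nat \<Rightarrow> 'k point \<Rightarrow> 'k"

definition H0 :: "'k::field point set \<Rightarrow> 'k line_bundle \<Rightarrow> 'k sect set" where
  "H0 X L = {s. (\<forall>i<charts L. regular_on X (chart L i) (s i)) \<and>
     (\<forall>i<charts L. \<forall>j<charts L. \<forall>P\<in>chart L i \<inter> chart L j. s i P = trans_fun L i j P * s j P) \<and>
     (\<forall>i P. \<not> (i < charts L \<and> P \<in> chart L i) \<longrightarrow> s i P = 0)}"

global_interpretation sections: vector_space "\<lambda>(c::'k::field) (s::'k sect) i P. c * s i P"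
  by unfold_locales (auto simp: fun_eq_iff algebra_simps)

text \<open>An ordered basis \<open>s\<^sub>0, \<dots>, s\<^sub>r\<close> of \<open>H\<^sup>0(X, L)\<close>; in particular \<open>r = h\<^sup>0(X, L) - 1\<close>.\<close>

definition H0_basis :: "'k::field point set \<Rightarrow> 'k line_bundle \<Rightarrow> nat \<Rightarrow> (nat \<Rightarrow> 'k sect) \<Rightarrow> bool" where
  "H0_basis X L r s \<longleftrightarrow> inj_on s {..r} \<and> sections.independent (s ` {..r}) \<and>
     sections.span (s ` {..r}) = H0 X L"

text \<open>
  The map \<open>P \<mapsto> [s\<^sub>0(P) : \<dots> : s\<^sub>r(P)]\<close>. All charts around \<open>P\<close> give the same line. If all \<open>s\<^sub>a\<close> vanish
  at \<open>P\<close>, the value is \<open>{0}\<close>, which is not a point.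
\<close>

definition section_map :: "'k::field line_bundle \<Rightarrow> nat \<Rightarrow> (nat \<Rightarrow> 'k sect) \<Rightarrow> 'k point \<Rightarrow> 'k point" where
  "section_map L r s P =
     (\<Union>i\<in>{i. i < charts L \<and> P \<in> chart L i}. pline (\<lambda>a. if a \<le> r then s a i P else 0))"

definition very_ample :: "'k::field point set \<Rightarrow> 'k line_bundle \<Rightarrow> bool" where
  "very_ample X L \<longleftrightarrow> (\<exists>r s. s ` {..r} \<subseteq> H0 X L \<and> closed_embedding X r (section_map L r s))"

text \<open>
  The pullback to \<open>X\<close> of a form on \<open>P\<^sup>r\<close> under \<open>section_map L r s\<close>: a form of degree \<open>j\<close> yields a section of
  the \<open>j\<close>-th tensor power of \<open>L\<close>.
\<close>

definition restrict_form :: "'k::field line_bundle \<Rightarrow> (nat \<Rightarrow> 'k sect) \<Rightarrow> 'k mpoly \<Rightarrow> 'k sect" where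
  "restrict_form L s F =
     (\<lambda>i P. if i < charts L \<and> P \<in> chart L i then eval (\<lambda>a. s a i P) F else 0)"

definition j_normal ::
  "'k::field point set \<Rightarrow> 'k line_bundle \<Rightarrow> nat \<Rightarrow> (nat \<Rightarrow> 'k sect) \<Rightarrow> nat \<Rightarrow> bool" where
  "j_normal X L r s j \<longleftrightarrow> H0 X (tensor_power L j) \<subseteq> restrict_form L s ` forms r j"


section \<open>Homogeneous ideals and the rank index\<close>

definition homog_ideal :: "nat \<Rightarrow> 'k::field point set \<Rightarrow> 'k mpoly set" where
  "homog_ideal r Y =
     genideal (poly_ring r) {F. (\<exists>e. F \<in> forms r e) \<and> (\<forall>P\<in>Y. vanishes_at F P)}"

text \<open>The ideal \<open>I(X, L)\<close> in the coordinates given by the basis \<open>s\<close>.\<close>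

definition embedding_ideal ::
  "'k::field point set \<Rightarrow> 'k line_bundle \<Rightarrow> nat \<Rightarrow> (nat \<Rightarrow> 'k sect) \<Rightarrow> 'k mpoly set" where
  "embedding_ideal X L r s = homog_ideal r (section_map L r s ` X)"

definition generated_in_degree_le :: "nat \<Rightarrow> 'k::field mpoly set \<Rightarrow> nat \<Rightarrow> bool" where
  "generated_in_degree_le r I m \<longleftrightarrow> I = genideal (poly_ring r) {F \<in> I. \<exists>e\<le>m. F \<in> forms r e}"

text \<open>
  The choice of basis is immaterial: a change of basis acts on the ideal by a linear change of
  coordinates, which preserves ranks.
\<close>

definition QR :: "'k::field point set \<Rightarrow> 'k line_bundle \<Rightarrow> nat \<Rightarrow> bool" where
  "QR X L k \<longleftrightarrow> (\<exists>r s. H0_basis X L r s \<and>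
     embedding_ideal X L r s =
       genideal (poly_ring r) {Q \<in> embedding_ideal X L r s. Q \<in> forms r 2 \<and> quad_rank r Q \<le> k})"

text \<open>
  The infimum of the empty set is \<open>\<infinity>\<close>, so a finite rank index entails that the ideal is generated by
  quadrics.
\<close>

definition rank_index :: "'k::field point set \<Rightarrow> 'k line_bundle \<Rightarrow> enat" where
  "rank_index X L = (INF k\<in>{k. QR X L k}. enat k)"

end

theory Submission
  imports Defs
begin

text \<open>
  For a form \<open>F\<close> of degree \<open>d\<close> write \<open>[F]\<close> for the corresponding linear form on the space of the \<open>d\<close>-th
  Veronese embedding. The ideal of the Veronese variety contains the quadrics
  \<open>[f\<^sup>2 h][g\<^sup>2 h] - [f g h]\<^sup>2\<close> of rank at most 3, with \<open>f, g\<close> linear. Polarising them in \<open>f, g, h\<close> gives for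
  \<open>d = 3\<close> and linear forms \<open>x\<^sub>1, \<dots>, x\<^sub>6\<close> one relation for every pair \<open>i, j\<close>: the sum of all splittings
  \<open>[x\<^sub>a x\<^sub>b x\<^sub>c][x\<^sub>p x\<^sub>q x\<^sub>r]\<close> that separate \<open>x\<^sub>i\<close> from \<open>x\<^sub>j\<close>. In characteristic 3 these relations span all
  differences of two splittings, and induction on \<open>d\<close> extends this to all \<open>d \<ge> 3\<close>. Hence, modulo
  quadrics of rank at most 3, a product of linear forms \<open>[m\<^sub>1] \<cdots> [m\<^sub>e]\<close> only depends on the monomial
  \<open>m\<^sub>1 \<cdots> m\<^sub>e\<close>. If the ideal of \<open>X\<close> is generated in degree at most \<open>d\<close>, then a form vanishing on the
  re-embedded \<open>X\<close> is congruent to a combination of products \<open>[m\<^sub>2] \<cdots> [m\<^sub>e][F]\<close> with \<open>F\<close> of degree \<open>d\<close>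
  vanishing on \<open>X\<close>, and such an \<open>[F]\<close> restricts to 0 on the span of the re-embedded \<open>X\<close>.

  Rank at most 2 is impossible: such a quadric is a product of two linear forms, so it does not vanish
  on an irreducible nondegenerate set unless it is zero.
\<close>

section \<open>Swapping linear factors modulo rank 3 quadrics\<close>

text \<open>Why degree 3 is the base case: with h constant, polarising
  \<open>[f^2][g^2] - [f g]^2\<close> gives \<open>2 A - B - C\<close>, where A, B, C are the three
  splittings of four linear forms into pairs. In characteristic 3 this is
  \<open>-(A + B + C)\<close> whichever splitting is singled out, so these relations never yield
  \<open>A - B\<close>. A third factor h supplies enough further relations. The same congruence 2 =
  -1 gives all six terms of the cubic relation equal coefficients, and makes 2 invertible. Products
  \<open>[m_1] ... [m_e]\<close> are determined by their monomial only modulo the ideal, so a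
  representative is chosen for every monomial and extended linearly; up to congruence this recovers
  a form from its substitution. Normality enters by identifying the coordinates of the re-embedding
  with forms of degree d. For projective space the hypotheses of the general statement have to be
  derived from the definition of regular functions. The substantial point is that every section of
  O(d) is a form: a locally rational homogeneous function on the affine cone is a
  polynomial.\<close>

locale additive_subset =
  fixes J :: "'b::comm_ring_1 set"
  assumes zero_J: "0 \<in> J"
    and add_J: "x \<in> J \<Longrightarrow> y \<in> J \<Longrightarrow> x + y \<in> J"
    and uminus_J: "x \<in> J \<Longrightarrow> - x \<in> J"
begin

lemma diff_J: "x \<in> J \<Longrightarrow> y \<in> J \<Longrightarrow> x - y \<in> J"
  using add_J[of x "- y"] uminus_J[of y] by simp

lemma cong_sym: "x - y \<in> J \<Longrightarrow> y - x \<in> J"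
  using uminus_J[of "x - y"] by simp

lemma cong_trans: "x - y \<in> J \<Longrightarrow> y - z \<in> J \<Longrightarrow> x - z \<in> J"
  using add_J[of "x - y" "y - z"] by simp

end

text \<open>\<open>J\<close> will be an ideal of the target ring and \<open>V\<close> the linear
  forms of the source. Polarisation only adds elements of \<open>V\<close> and subtracts members of
  \<open>J\<close>, so additive closure is all that is recorded.\<close>

locale char3_relations = additive_subset J for J :: "'b::comm_ring_1 set" +
  fixes V :: "'a::comm_ring_1 set"
  assumes three: "(3::'b) = 0"
    and V_add: "x \<in> V \<Longrightarrow> y \<in> V \<Longrightarrow> x + y \<in> V"
begin

text \<open>Serves as division by 2: membership of \<open>2 * x\<close> in \<open>J\<close> passes
  to \<open>x\<close> by negation.\<close>

lemma eq_minus_double: "x = - (2 * x)" for x :: 'b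
proof -
  have "x + 2 * x = 3 * x"
    using distrib_right[of 1 2 x] by simp
  then show ?thesis
    by (simp add: three eq_neg_iff_add_eq_0)
qed

text \<open>The quadric in \<open>rel\<close> is polarised in \<open>f\<close>, then
  \<open>g\<close>, then \<open>h\<close>: each time its values at the two summands are subtracted
  from its value at the sum. The result has coefficient 2 on the splittings that keep
  \<open>f\<close> and \<open>f'\<close> together and -1 on the others, and these agree modulo 3.
  Exactly the six splittings separating \<open>h\<close> from \<open>h'\<close> occur.\<close>

lemma polarised_relation:
  fixes \<l> :: "'a \<Rightarrow> 'b"
  assumes \<l>_add: "\<And>x y. \<l> (x + y) = \<l> x + \<l> y"
    and rel: "\<And>f g h. f \<in> V \<Longrightarrow> g \<in> V \<Longrightarrow> h \<in> V \<Longrightarrow>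
      \<l> (f * f * h) * \<l> (g * g * h) - \<l> (f * g * h) ^ 2 \<in> J"
    and V: "f \<in> V" "f' \<in> V" "g \<in> V" "g' \<in> V" "h \<in> V" "h' \<in> V"
  shows "\<l> (f * f' * h) * \<l> (g * g' * h') + \<l> (f * f' * h') * \<l> (g * g' * h)
       + \<l> (f * g * h) * \<l> (f' * g' * h') + \<l> (f * g * h') * \<l> (f' * g' * h)
       + \<l> (f * g' * h) * \<l> (f' * g * h') + \<l> (f * g' * h') * \<l> (f' * g * h) \<in> J"
proof -
  define S where "S a b c = \<l> (a * b * c)" for a b c
  have comm: "S a b c = S b a c" "S a b c = S a c b" for a b c
    by (simp_all add: S_def mult_ac)
  have lin: "S (a + a') b c = S a b c + S a' b c" "S a (b + b') c = S a b c + S a b' c"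
      "S a b (c + c') = S a b c + S a b c'" for a a' b b' c c'
    by (simp_all add: S_def ring_distribs \<l>_add)
  have r: "S f f h * S g g h - S f g h * S f g h \<in> J" if "f \<in> V" "g \<in> V" "h \<in> V" for f g h
    using rel[OF that] by (simp add: S_def power2_eq_square)
  have A: "S f f' h * S g g h - S f g h * S f' g h \<in> J"
    if "f \<in> V" "f' \<in> V" "g \<in> V" "h \<in> V" for f f' g h
  proof -
    have "(S (f + f') (f + f') h * S g g h - S (f + f') g h * S (f + f') g h)
        - (S f f h * S g g h - S f g h * S f g h) - (S f' f' h * S g g h - S f' g h * S f' g h) \<in> J"
      (is "?x \<in> J") using that by (intro diff_J r V_add)
    \<comment> \<open>The second difference \<open>?x\<close> is twice the wanted expression, and 3
      - 2 = 1.\<close>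
    moreover have "S f f' h * S g g h - S f g h * S f' g h = (3 * (S f f' h * S g g h - S f g h * S f' g h)) - ?x"
      unfolding lin comm(1)[of f' f] by (simp add: algebra_simps)
    ultimately show ?thesis using uminus_J[of ?x] by (simp add: three)
  qed
  have B: "2 * (S f f' h * S g g' h) - S f g h * S f' g' h - S f g' h * S f' g h \<in> J"
    if "f \<in> V" "f' \<in> V" "g \<in> V" "g' \<in> V" "h \<in> V" for f f' g g' h
  proof -
    have "(S f f' h * S (g + g') (g + g') h - S f (g + g') h * S f' (g + g') h)
        - (S f f' h * S g g h - S f g h * S f' g h) - (S f f' h * S g' g' h - S f g' h * S f' g' h) \<in> J"
      (is "?x \<in> J") using that by (intro diff_J A V_add)
    moreover have "?x = 2 * (S f f' h * S g g' h) - S f g h * S f' g' h - S f g' h * S f' g h"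
      unfolding lin comm(1)[of g' g] by (simp add: algebra_simps)
    ultimately show ?thesis by simp
  qed
  have "(2 * (S f f' (h + h') * S g g' (h + h')) - S f g (h + h') * S f' g' (h + h')
          - S f g' (h + h') * S f' g (h + h'))
      - (2 * (S f f' h * S g g' h) - S f g h * S f' g' h - S f g' h * S f' g h)
      - (2 * (S f f' h' * S g g' h') - S f g h' * S f' g' h' - S f g' h' * S f' g h') \<in> J"
    (is "?x \<in> J") using V by (intro diff_J B V_add)
  \<comment> \<open>Subtracting \<open>?x\<close> from three times the terms with coefficient 2
    turns the coefficients 2 and -1 into 1 throughout.\<close>
  moreover have "S f f' h * S g g' h' + S f f' h' * S g g' h + S f g h * S f' g' h' + S f g h' * S f' g' h
      + S f g' h * S f' g h' + S f g' h' * S f' g h =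
      3 * (S f f' h * S g g' h' + S f f' h' * S g g' h) - ?x"
    unfolding lin by (simp add: algebra_simps)
  ultimately show ?thesis using uminus_J[of ?x] by (simp add: three S_def)
qed

text \<open>
  Write \<open>R\<^sub>i\<^sub>j\<close> for the sum of the six splittings of \<open>x\<^sub>1, \<dots>, x\<^sub>6\<close> into two triples that separate \<open>x\<^sub>i\<close> from
  \<open>x\<^sub>j\<close>. The combination \<open>R\<^sub>1\<^sub>4 + R\<^sub>2\<^sub>4 + R\<^sub>3\<^sub>5 + R\<^sub>3\<^sub>6 - R\<^sub>1\<^sub>3 - R\<^sub>2\<^sub>3 - R\<^sub>4\<^sub>5 - R\<^sub>4\<^sub>6\<close> is four times the difference of
  \<open>123|456\<close> and \<open>124|356\<close>, and \<open>4 = 1\<close>.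
\<close>

lemma swap_cubic:
  fixes \<l> :: "'a \<Rightarrow> 'b"
  assumes \<l>_add: "\<And>x y. \<l> (x + y) = \<l> x + \<l> y"
    and rel: "\<And>f g h. f \<in> V \<Longrightarrow> g \<in> V \<Longrightarrow> h \<in> V \<Longrightarrow>
      \<l> (f * f * h) * \<l> (g * g * h) - \<l> (f * g * h) ^ 2 \<in> J"
    and V: "a \<in> V" "b \<in> V" "c \<in> V" "d \<in> V" "e \<in> V" "f \<in> V"
  shows "\<l> (a * b * c) * \<l> (d * e * f) - \<l> (a * b * d) * \<l> (c * e * f) \<in> J"
proof -
  define S where "S a b c = \<l> (a * b * c)" for a b c
  define R where "R x y p q r s = S p q x * S r s y + S p q y * S r s x + S p r x * S q s y
      + S p r y * S q s x + S p s x * S q r y + S p s y * S q r x" for x y p q r s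
  have R: "R x y p q r s \<in> J" if "x \<in> V" "y \<in> V" "p \<in> V" "q \<in> V" "r \<in> V" "s \<in> V" for x y p q r s
    using polarised_relation[of \<l>, OF \<l>_add rel that(3-6) that(1,2)]
    unfolding R_def S_def by (simp add: algebra_simps)
  \<comment> \<open>The weight of a splitting is the number of added pairs it separates minus the
    number of subtracted ones. The combination is antisymmetric in \<open>c\<close> and
    \<open>d\<close>, so splittings with both on one side cancel. If they are separated,
    \<open>a\<close>, \<open>b\<close> count +1 each on the side of \<open>c\<close> and -1 on that
    of \<open>d\<close>, and \<open>e\<close>, \<open>f\<close> the other way round: the mixed cases
    sum to 0, and only the two wanted splittings survive, with weights 4 and -4.\<close>
  have "R a d b c e f + R b d a c e f + R c e a b d f + R c f a b d e
      - R a c b d e f - R b c a d e f - R d e a b c f - R d f a b c e \<in> J" (is "?x \<in> J")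
    using V by (intro diff_J add_J R)
  moreover have "?x = 3 * (S a b c * S d e f - S a b d * S c e f) + (S a b c * S d e f - S a b d * S c e f)"
    unfolding R_def S_def by (simp add: algebra_simps)
  ultimately show ?thesis by (simp add: three S_def)
qed

text \<open>
  The polarised relations in degree \<open>d\<close> only use linear factors: multiplying by a fixed \<open>u \<in> V\<close> and
  then polarising in \<open>u\<close> passes from degree \<open>d\<close> to degree \<open>d + 1\<close>.
\<close>

lemma swap_linear_factors:
  fixes \<l> :: "'a \<Rightarrow> 'b"
  assumes \<l>_add: "\<And>x y. \<l> (x + y) = \<l> x + \<l> y"
    and rel: "\<And>f g hs. f \<in> V \<Longrightarrow> g \<in> V \<Longrightarrow> set hs \<subseteq> V \<Longrightarrow> length hs = Suc n \<Longrightarrow>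
      \<l> (f * f * prod_list hs) * \<l> (g * g * prod_list hs) - \<l> (f * g * prod_list hs) ^ 2 \<in> J"
    and V: "x \<in> V" "y \<in> V" "set ps \<subseteq> V" "set qs \<subseteq> V" "length ps = n + 2" "length qs = n + 2"
  shows "\<l> (x * prod_list ps) * \<l> (y * prod_list qs) - \<l> (y * prod_list ps) * \<l> (x * prod_list qs) \<in> J"
  using assms
proof (induction n arbitrary: \<l> x y ps qs)
  case 0
  from 0 obtain a b c d where ps: "ps = [a, b]" and qs: "qs = [c, d]"
    by (auto simp: length_Suc_conv numeral_2_eq_2)
  have *: "\<l> (f * f * h) * \<l> (g * g * h) - \<l> (f * g * h) ^ 2 \<in> J" if "f \<in> V" "g \<in> V" "h \<in> V" for f g h
    using 0(2)[of f g "[h]"] that by simp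
  show ?case
    using swap_cubic[of \<l> a b x y c d, OF 0(1) *] 0(3-6) unfolding ps qs by (simp add: mult_ac)
next
  case (Suc n)
  note \<l>_add = Suc.prems(1)
  define T where "T as bs = \<l> (prod_list as) * \<l> (prod_list bs)" for as bs
  have shift: "T (u # x # ps) (u # y # qs) - T (u # y # ps) (u # x # qs) \<in> J"
    if "u \<in> V" "x \<in> V" "y \<in> V" "set ps \<subseteq> V" "set qs \<subseteq> V" "length ps = n + 2" "length qs = n + 2" for u x y ps qs
  proof -
    define \<l>' where "\<l>' z = \<l> (u * z)" for z
    have "\<l>' (x * prod_list ps) * \<l>' (y * prod_list qs) - \<l>' (y * prod_list ps) * \<l>' (x * prod_list qs) \<in> J"
    proof (rule Suc.IH[OF _ _ that(2-7)])
      show "\<l>' (x + y) = \<l>' x + \<l>' y" for x y by (simp add: \<l>'_def distrib_left \<l>_add)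
      show "\<l>' (f * f * prod_list hs) * \<l>' (g * g * prod_list hs) - (\<l>' (f * g * prod_list hs))\<^sup>2 \<in> J"
        if "f \<in> V" "g \<in> V" "set hs \<subseteq> V" "length hs = Suc n" for f g hs
        using Suc.prems(2)[of f g "u # hs"] that \<open>u \<in> V\<close> by (simp add: \<l>'_def mult_ac)
    qed
    then show ?thesis by (simp add: \<l>'_def T_def)
  qed
  have pol: "(T (u # x # ps) (v # y # qs) + T (v # x # ps) (u # y # qs))
      - (T (u # y # ps) (v # x # qs) + T (v # y # ps) (u # x # qs)) \<in> J"
    if "u \<in> V" "v \<in> V" "x \<in> V" "y \<in> V" "set ps \<subseteq> V" "set qs \<subseteq> V" "length ps = n + 2" "length qs = n + 2"
    for u v x y ps qs
  proof -
    have "(T ((u + v) # x # ps) ((u + v) # y # qs) - T ((u + v) # y # ps) ((u + v) # x # qs))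
       - (T (u # x # ps) (u # y # qs) - T (u # y # ps) (u # x # qs))
       - (T (v # x # ps) (v # y # qs) - T (v # y # ps) (v # x # qs)) \<in> J"
      using that by (intro diff_J shift V_add)
    then show ?thesis by (simp add: T_def ring_distribs \<l>_add algebra_simps)
  qed
  \<comment> \<open>Exchanging one factor alone is not yet available, but exchanging two at once is:
    \<open>pol\<close> is applied to the pairs \<open>i, j\<close> and \<open>k, l\<close> in both
    roles. In the sum of the two relations the terms with only one factor exchanged cancel, leaving
    twice the claim.\<close>
  have double: "T (i # k # P) (j # l # Q) - T (j # l # P) (i # k # Q) \<in> J"
    if V: "i \<in> V" "k \<in> V" "j \<in> V" "l \<in> V" "set P \<subseteq> V" "set Q \<subseteq> V" "length P = n + 2" "length Q = n + 2"
    for i j k l P Q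
  proof -
    have e1: "(T (i # k # P) (j # l # Q) + T (j # k # P) (i # l # Q))
        - (T (i # l # P) (j # k # Q) + T (j # l # P) (i # k # Q)) \<in> J"
      by (intro pol V)
    have "(T (k # i # P) (l # j # Q) + T (l # i # P) (k # j # Q))
        - (T (k # j # P) (l # i # Q) + T (l # j # P) (k # i # Q)) \<in> J"
      by (intro pol V)
    then have e2: "(T (i # k # P) (j # l # Q) + T (i # l # P) (j # k # Q))
        - (T (j # k # P) (i # l # Q) + T (j # l # P) (i # k # Q)) \<in> J"
      by (simp add: T_def mult_ac)
    have "2 * (T (i # k # P) (j # l # Q) - T (j # l # P) (i # k # Q)) \<in> J" (is "2 * ?x \<in> J")
      using add_J[OF e1 e2] by (simp add: algebra_simps)
    then show ?thesis
      using uminus_J[of "2 * ?x"] by (simp only: flip: eq_minus_double)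
  qed
  obtain k P where ps: "ps = k # P" using Suc.prems by (cases ps) auto
  obtain l m Q where qs: "qs = l # m # Q" using Suc.prems by (auto simp: length_Suc_conv)
  \<comment> \<open>A single swap is a composition of two double ones: the pair \<open>x, k\<close>
    is traded for \<open>l, m\<close>, and then \<open>l, m\<close> for \<open>y, k\<close>. This
    borrows two further factors of \<open>qs\<close>, which has at least three.\<close>
  have "T (x # k # P) (l # m # y # Q) - T (l # m # P) (x # k # y # Q) \<in> J"
    using Suc.prems by (intro double) (auto simp: ps qs)
  moreover have "T (l # m # P) (y # k # x # Q) - T (y # k # P) (l # m # x # Q) \<in> J"
    using Suc.prems by (intro double) (auto simp: ps qs)
  moreover have "T (l # m # P) (x # k # y # Q) = T (l # m # P) (y # k # x # Q)"
    by (simp add: T_def mult_ac)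
  ultimately have "T (x # k # P) (l # m # y # Q) - T (y # k # P) (l # m # x # Q) \<in> J"
    by (metis cong_trans)
  then show ?case by (simp add: T_def ps qs mult_ac)
qed

end

section \<open>Monomials, forms and ideals\<close>

abbreviation scalar :: "'k::comm_ring_1 \<Rightarrow> 'k mpoly" where
  "scalar c \<equiv> Poly_Mapping.single 0 c"

definition var :: "nat \<Rightarrow> 'k::comm_ring_1 mpoly" where
  "var i = Poly_Mapping.single (Poly_Mapping.single i 1) 1"

definition monomials :: "nat \<Rightarrow> nat \<Rightarrow> (nat \<Rightarrow>\<^sub>0 nat) set" where
  "monomials r e = {m. Poly_Mapping.keys m \<subseteq> {..r} \<and> total_deg m = e}"

lemma keys_add_nat: "Poly_Mapping.keys (m + m') = Poly_Mapping.keys m \<union> Poly_Mapping.keys m'"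
  for m m' :: "nat \<Rightarrow>\<^sub>0 nat"
  by (auto simp: in_keys_iff lookup_add)

lemma total_deg_zero [simp]: "total_deg 0 = 0"
  by (simp add: total_deg_def)

lemma total_deg_single [simp]: "total_deg (Poly_Mapping.single i k) = k"
  by (simp add: total_deg_def)

lemma total_deg_eq_sum:
  assumes "finite A" "Poly_Mapping.keys m \<subseteq> A"
  shows "total_deg m = (\<Sum>i\<in>A. Poly_Mapping.lookup m i)"
  unfolding total_deg_def
  by (rule sum.mono_neutral_left) (use assms in \<open>auto simp: in_keys_iff\<close>)

lemma total_deg_eq_0_iff: "total_deg m = 0 \<longleftrightarrow> m = 0"
  by (auto simp: total_deg_def in_keys_iff poly_mapping_eq_iff fun_eq_iff)

lemma zero_in_monomials: "m \<in> monomials r 0 \<longleftrightarrow> m = 0"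
  by (auto simp: monomials_def total_deg_eq_0_iff)

lemma single_in_monomials: "i \<le> r \<Longrightarrow> Poly_Mapping.single i 1 \<in> monomials r 1"
  by (simp add: monomials_def)

lemma monomials_add:
  "m \<in> monomials r e \<Longrightarrow> m' \<in> monomials r e' \<Longrightarrow> m + m' \<in> monomials r (e + e')"
  by (simp add: monomials_def total_deg_add keys_add_nat)

lemma monomials_add_single:
  "m \<in> monomials r e \<Longrightarrow> i \<le> r \<Longrightarrow> Poly_Mapping.single i 1 + m \<in> monomials r (Suc e)"
  using monomials_add[OF single_in_monomials] by fastforce

lemma monomials_remove_var:
  assumes "m \<in> monomials r e" "Poly_Mapping.lookup m i > 0"
  obtains m' where "m = Poly_Mapping.single i 1 + m'" "i \<le> r" "e > 0" "m' \<in> monomials r (e - 1)"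
proof
  let ?m' = "m - Poly_Mapping.single i 1"
  show m: "m = Poly_Mapping.single i 1 + ?m'"
    using assms(2) by (intro poly_mapping_eqI) (auto simp: lookup_add lookup_minus lookup_single when_def)
  have "Poly_Mapping.keys m = {i} \<union> Poly_Mapping.keys ?m'" "total_deg m = Suc (total_deg ?m')"
    by (subst m, simp add: keys_add_nat total_deg_add)+
  with assms show "?m' \<in> monomials r (e - 1)" "i \<le> r" "e > 0"
    by (auto simp: monomials_def)
qed

lemma monomials_Suc:
  assumes "m \<in> monomials r (Suc e)"
  obtains i m' where "m = Poly_Mapping.single i 1 + m'" "i \<le> r" "m' \<in> monomials r e"
proof -
  have "m \<noteq> 0" using assms by (auto simp: monomials_def)
  then obtain i where "Poly_Mapping.lookup m i > 0"
    by (auto simp: poly_mapping_eq_iff fun_eq_iff)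
  from monomials_remove_var[OF assms this] that show ?thesis by auto
qed

lemma monomials_split:
  assumes "m \<in> monomials r (e + e')"
  obtains a b where "m = a + b" "a \<in> monomials r e" "b \<in> monomials r e'"
  using assms
proof (induction e arbitrary: m thesis)
  case 0
  then show ?case by (metis add_0 zero_in_monomials)
next
  case (Suc e)
  from Suc.prems(2) obtain i m' where m: "m = Poly_Mapping.single i 1 + m'" "i \<le> r"
    "m' \<in> monomials r (e + e')" by (auto elim: monomials_Suc)
  obtain a b where "m' = a + b" "a \<in> monomials r e" "b \<in> monomials r e'"
    using Suc.IH[OF _ m(3)] by blast
  then show ?case
    using Suc.prems(1)[of "Poly_Mapping.single i 1 + a" b] m monomials_add_single[of a r e i]
    by (simp add: add.assoc)
qed

text \<open>Turns an exponent vector into the list of linear factors on which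
  \<open>swap_linear_factors\<close> operates.\<close>

lemma monomials_var_list:
  assumes "m \<in> monomials r e"
  obtains xs where "length xs = e" "set xs \<subseteq> {..r}"
    "\<And>c. Poly_Mapping.single m (c::'k::comm_ring_1) = scalar c * prod_list (map var xs)"
  using assms
proof (induction e arbitrary: m thesis)
  case 0
  then show ?case by (simp add: zero_in_monomials)
next
  case (Suc e)
  from Suc.prems(2) obtain i m' where m: "m = Poly_Mapping.single i 1 + m'" "i \<le> r"
    "m' \<in> monomials r e" by (auto elim: monomials_Suc)
  obtain xs where xs: "length xs = e" "set xs \<subseteq> {..r}"
    "\<And>c. Poly_Mapping.single m' (c::'k::comm_ring_1) = scalar c * prod_list (map var xs)"
    using Suc.IH[OF _ m(3)] by blast
  have "Poly_Mapping.single m c = var i * Poly_Mapping.single m' c" for c :: 'k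
    by (simp add: m var_def mult_single)
  then show ?case
    using xs m by (intro Suc.prems(1)[of "i # xs"]) (auto simp: mult_ac)
qed

lemma finite_monomials: "finite (monomials r e)"
proof (induction e)
  case 0
  have "monomials r 0 = {0}" by (auto simp: zero_in_monomials)
  then show ?case by simp
next
  case (Suc e)
  have "monomials r (Suc e) \<subseteq> (\<lambda>(i, m). Poly_Mapping.single i 1 + m) ` ({..r} \<times> monomials r e)"
    by (force elim!: monomials_Suc)
  then show ?case by (rule finite_subset) (use Suc in auto)
qed

section \<open>Forms of fixed degree and their closure properties\<close>

lemma forms_iff: "F \<in> forms r e \<longleftrightarrow> Poly_Mapping.keys F \<subseteq> monomials r e"
  by (auto simp: forms_def poly_ring_def homogeneous_def monomials_def)

lemma carrier_iff: "F \<in> carrier (poly_ring r) \<longleftrightarrow> (\<forall>m\<in>Poly_Mapping.keys F. Poly_Mapping.keys m \<subseteq> {..r})"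
  by (simp add: poly_ring_def)

lemma forms_homogeneous: "F \<in> forms r e \<Longrightarrow> homogeneous e F"
  and forms_carrier: "F \<in> forms r e \<Longrightarrow> F \<in> carrier (poly_ring r)"
  by (simp_all add: forms_def)

lemma forms_zero [simp]: "0 \<in> forms r e"
  by (simp add: forms_iff)

lemma forms_single: "m \<in> monomials r e \<Longrightarrow> Poly_Mapping.single m c \<in> forms r e"
  by (simp add: forms_iff)

lemma forms_add: "F \<in> forms r e \<Longrightarrow> G \<in> forms r e \<Longrightarrow> F + G \<in> forms r e"
  using Poly_Mapping.keys_add[of F G] by (auto simp: forms_iff)

lemma forms_uminus: "F \<in> forms r e \<Longrightarrow> - F \<in> forms r e"
  by (auto simp: forms_iff in_keys_iff subset_iff)

lemma forms_diff: "F \<in> forms r e \<Longrightarrow> G \<in> forms r e \<Longrightarrow> F - G \<in> forms r e"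
  using forms_add[of F r e "- G"] by (simp add: forms_uminus)

lemma forms_mult: "F \<in> forms r e \<Longrightarrow> G \<in> forms r e' \<Longrightarrow> F * G \<in> forms r (e + e')"
  using keys_mult[of F G] monomials_add by (fastforce simp: forms_iff)

lemma forms_sum: "(\<And>i. i \<in> A \<Longrightarrow> f i \<in> forms r e) \<Longrightarrow> sum f A \<in> forms r e"
  by (induction A rule: infinite_finite_induct) (auto simp: forms_add)

lemma forms_scalar: "scalar c \<in> forms r 0"
  by (simp add: forms_single zero_in_monomials)

lemma forms_smult: "F \<in> forms r e \<Longrightarrow> scalar c * F \<in> forms r e"
  using forms_mult[OF forms_scalar] by fastforce

lemma forms_one: "1 \<in> forms r 0"
  using forms_scalar[of 1] by simp

lemma forms_var: "i \<le> r \<Longrightarrow> var i \<in> forms r 1"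
  unfolding var_def by (intro forms_single single_in_monomials)

lemma forms_prod_list:
  "set Fs \<subseteq> forms r e \<Longrightarrow> prod_list Fs \<in> forms r (length Fs * e)"
  by (induction Fs) (auto simp: forms_one intro: forms_mult)

lemma poly_mapping_sum_singles: "F = (\<Sum>m\<in>Poly_Mapping.keys F. Poly_Mapping.single m (Poly_Mapping.lookup F m))"
  by (intro poly_mapping_eqI) (auto simp: lookup_sum lookup_single when_def in_keys_iff)

lemma sum_induct_closed:
  assumes "P 0" "\<And>x y. P x \<Longrightarrow> P y \<Longrightarrow> P (x + y)" "\<And>i. i \<in> A \<Longrightarrow> P (f i)"
  shows "P (sum f A)"
  using assms(3) by (induction A rule: infinite_finite_induct) (auto intro: assms)

lemma forms_induct [consumes 1, case_names zero single add]:
  assumes "F \<in> forms r e"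
    and "P 0" and "\<And>m c. m \<in> monomials r e \<Longrightarrow> P (Poly_Mapping.single m c)"
    and "\<And>F G. P F \<Longrightarrow> P G \<Longrightarrow> P (F + G)"
  shows "P F"
proof (subst poly_mapping_sum_singles, rule sum_induct_closed)
qed (use assms in \<open>auto simp: forms_iff\<close>)

lemma carrier_induct [consumes 1, case_names zero single add]:
  assumes "F \<in> carrier (poly_ring r)"
    and "P 0" and "\<And>m c. Poly_Mapping.keys m \<subseteq> {..r} \<Longrightarrow> P (Poly_Mapping.single m c)"
    and "\<And>F G. P F \<Longrightarrow> P G \<Longrightarrow> P (F + G)"
  shows "P F"
proof (subst poly_mapping_sum_singles, rule sum_induct_closed)
qed (use assms in \<open>auto simp: carrier_iff\<close>)

section \<open>Ideals of \<open>poly_ring r\<close> as plain sets of polynomials\<close>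

lemma carrier_add: "F \<in> carrier (poly_ring r) \<Longrightarrow> G \<in> carrier (poly_ring r) \<Longrightarrow> F + G \<in> carrier (poly_ring r)"
  using Poly_Mapping.keys_add[of F G] by (auto simp: carrier_iff)

lemma carrier_uminus: "F \<in> carrier (poly_ring r) \<Longrightarrow> - F \<in> carrier (poly_ring r)"
  by (auto simp: carrier_iff in_keys_iff)

lemma carrier_mult: "F \<in> carrier (poly_ring r) \<Longrightarrow> G \<in> carrier (poly_ring r) \<Longrightarrow> F * G \<in> carrier (poly_ring r)"
  using keys_mult[of F G] by (fastforce simp: carrier_iff keys_add_nat)

lemma poly_ring_ops [simp]:
  "x \<oplus>\<^bsub>poly_ring r\<^esub> y = x + y" "x \<otimes>\<^bsub>poly_ring r\<^esub> y = x * y"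
  "\<zero>\<^bsub>poly_ring r\<^esub> = 0" "\<one>\<^bsub>poly_ring r\<^esub> = 1"
  by (simp_all add: poly_ring_def)

lemma cring_poly_ring: "cring (poly_ring r :: 'k::comm_ring_1 mpoly ring)"
proof (rule cringI)
  show "abelian_group (poly_ring r :: 'k mpoly ring)"
  proof (rule abelian_groupI)
    fix x :: "'k mpoly" assume "x \<in> carrier (poly_ring r)"
    then show "\<exists>y\<in>carrier (poly_ring r). y \<oplus>\<^bsub>poly_ring r\<^esub> x = \<zero>\<^bsub>poly_ring r\<^esub>"
      by (intro bexI[of _ "- x"] carrier_uminus) auto
  qed (simp_all add: carrier_add forms_carrier[OF forms_zero] algebra_simps)
  show "Group.comm_monoid (poly_ring r :: 'k mpoly ring)"
    by (rule comm_monoidI) (simp_all add: carrier_mult forms_carrier[OF forms_one] algebra_simps)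
qed (simp add: algebra_simps)

text \<open>Closure under negation is missing from the list because it is absorption of the constant
  -1.\<close>

lemma ideal_poly_ring_iff:
  fixes I :: "'k::comm_ring_1 mpoly set"
  shows "ideal I (poly_ring r) \<longleftrightarrow>
    I \<subseteq> carrier (poly_ring r) \<and> 0 \<in> I \<and> (\<forall>x\<in>I. \<forall>y\<in>I. x + y \<in> I) \<and>
    (\<forall>x\<in>I. \<forall>y\<in>carrier (poly_ring r). y * x \<in> I)" (is "_ \<longleftrightarrow> ?rhs")
proof
  interpret cring "poly_ring r :: 'k mpoly ring" by (rule cring_poly_ring)
  assume "ideal I (poly_ring r :: 'k mpoly ring)"
  then interpret I: ideal I "poly_ring r" .
  show ?rhs
    using I.a_subset I.zero_closed I.a_closed I.I_l_closed by auto
next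
  interpret cring "poly_ring r :: 'k mpoly ring" by (rule cring_poly_ring)
  assume I: ?rhs
  have neg: "- x \<in> I" if "x \<in> I" for x
  proof -
    have "- 1 \<in> carrier (poly_ring r :: 'k mpoly ring)"
      by (intro carrier_uminus forms_carrier[OF forms_one])
    with I that have "- 1 * x \<in> I" by blast
    then show ?thesis by simp
  qed
  have ainv: "\<ominus>\<^bsub>poly_ring r\<^esub> x = - x" if "x \<in> carrier (poly_ring r)" for x :: "'k mpoly"
  proof (rule minus_equality)
    show "- x \<oplus>\<^bsub>poly_ring r\<^esub> x = \<zero>\<^bsub>poly_ring r\<^esub>" by simp
  qed (use that carrier_uminus in auto)
  show "ideal I (poly_ring r)"
  proof (rule idealI)
    show "ring (poly_ring r :: 'k mpoly ring)" by (rule ring_axioms)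
    show "subgroup I (add_monoid (poly_ring r))"
    proof (rule subgroup.intro)
      fix x assume x: "x \<in> I"
      then have "inv\<^bsub>add_monoid (poly_ring r)\<^esub> x = - x"
        using ainv[of x] I by (auto simp: a_inv_def)
      then show "inv\<^bsub>add_monoid (poly_ring r)\<^esub> x \<in> I" using neg[OF x] by simp
    qed (use I in auto)
    fix a x :: "'k mpoly" assume "a \<in> I" "x \<in> carrier (poly_ring r)"
    then have "x * a \<in> I" using I by blast
    then show "x \<otimes>\<^bsub>poly_ring r\<^esub> a \<in> I" "a \<otimes>\<^bsub>poly_ring r\<^esub> x \<in> I"
      by (simp_all add: mult.commute)
  qed
qed

lemma ideal_uminus:
  fixes I :: "'k::comm_ring_1 mpoly set"
  assumes "ideal I (poly_ring r)" "x \<in> I"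
  shows "- x \<in> I"
proof -
  have "- 1 \<in> carrier (poly_ring r :: 'k mpoly ring)"
    by (intro carrier_uminus forms_carrier[OF forms_one])
  with assms have "- 1 * x \<in> I" unfolding ideal_poly_ring_iff by blast
  then show ?thesis by simp
qed

text \<open>The argument of \<open>\<phi>\<close> is a monomial in one set of variables, its value a
  polynomial in another; both live in the single type \<open>mpoly\<close>.\<close>

definition linext :: "((nat \<Rightarrow>\<^sub>0 nat) \<Rightarrow> 'k mpoly) \<Rightarrow> 'k::comm_ring_1 mpoly \<Rightarrow> 'k mpoly" where
  "linext \<phi> F = (\<Sum>m\<in>Poly_Mapping.keys F. scalar (Poly_Mapping.lookup F m) * \<phi> m)"

lemma linext_zero [simp]: "linext \<phi> 0 = 0"
  by (simp add: linext_def)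

lemma linext_single [simp]: "linext \<phi> (Poly_Mapping.single m c) = scalar c * \<phi> m"
  by (simp add: linext_def)

lemma linext_add: "linext \<phi> (F + G) = linext \<phi> F + linext \<phi> G"
proof -
  let ?A = "Poly_Mapping.keys F \<union> Poly_Mapping.keys G"
  have "linext \<phi> H = (\<Sum>m\<in>?A. scalar (Poly_Mapping.lookup H m) * \<phi> m)" if "Poly_Mapping.keys H \<subseteq> ?A" for H
    unfolding linext_def
    by (rule sum.mono_neutral_left) (use that in \<open>auto simp: in_keys_iff\<close>)
  then show ?thesis
    by (simp add: Poly_Mapping.keys_add lookup_add single_add sum.distrib distrib_right)
qed

lemma linext_forms:
  assumes "\<And>m. m \<in> Poly_Mapping.keys F \<Longrightarrow> \<phi> m \<in> forms r e"
  shows "linext \<phi> F \<in> forms r e"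
  unfolding linext_def using assms by (intro forms_sum forms_smult)

lemma scalar_in_carrier: "scalar c \<in> carrier (poly_ring r)"
  by (rule forms_carrier[OF forms_scalar])

lemma eval_scalar [simp]: "eval v (scalar c) = c"
  by (simp add: eval_single)

lemma eval_var [simp]: "eval v (var i) = v i"
  by (simp add: var_def eval_single)

lemma eval_uminus: "eval v (- F) = - eval v F"
  using eval_add[of v F "- F"] by (simp add: eq_neg_iff_add_eq_0 add.commute)

lemma eval_diff: "eval v (F - G) = eval v F - eval v G"
  using eval_add[of v F "- G"] by (simp add: eval_uminus)

lemma eval_sum: "eval v (sum f A) = (\<Sum>i\<in>A. eval v (f i))"
  by (induction A rule: infinite_finite_induct) (auto simp: eval_add)

lemma eval_prod: "eval v (prod f A) = (\<Prod>i\<in>A. eval v (f i))"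
  by (induction A rule: infinite_finite_induct) (auto simp: eval_mult)

lemma eval_power: "eval v (F ^ n) = eval v F ^ n"
  by (induction n) (auto simp: eval_mult)

lemma eval_cong_keys:
  assumes "\<And>m i. m \<in> Poly_Mapping.keys F \<Longrightarrow> i \<in> Poly_Mapping.keys m \<Longrightarrow> v i = w i"
  shows "eval v F = eval w F"
  unfolding eval_def
  by (intro sum.cong refl arg_cong2[where f = "(*)"] prod.cong) (use assms in auto)

lemma eval_cong:
  assumes "F \<in> carrier (poly_ring r)" "\<And>i. i \<le> r \<Longrightarrow> v i = w i"
  shows "eval v F = eval w F"
  by (rule eval_cong_keys) (use assms in \<open>auto simp: carrier_iff\<close>)

lemma single_one_eq_iff: "Poly_Mapping.single i (1::nat) = Poly_Mapping.single j 1 \<longleftrightarrow> i = j"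
  by (metis keys_single singleton_inject zero_neq_one)

lemma linear_form_eq:
  assumes "F \<in> forms r 1"
  shows "F = (\<Sum>i\<le>r. scalar (Poly_Mapping.lookup F (Poly_Mapping.single i 1)) * var i)"
  using assms
proof (induction F rule: forms_induct)
  case (single m c)
  then obtain j where "m = Poly_Mapping.single j 1" "j \<le> r"
    by (metis One_nat_def add.right_neutral monomials_Suc zero_in_monomials)
  moreover have "scalar (Poly_Mapping.lookup (Poly_Mapping.single (Poly_Mapping.single j (1::nat)) c) (Poly_Mapping.single i 1)) * var i
      = (if i = j then scalar c * var j else 0)" for i
    by (auto simp: lookup_single when_def single_one_eq_iff simp del: One_nat_def)
  ultimately show ?case
    by (simp add: var_def mult_single)
next
  case (add F G)
  show ?case
    by (subst add.IH(1), subst add.IH(2)) (simp add: lookup_add single_add distrib_right sum.distrib)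
qed simp

lemma eval_linear_form:
  assumes "F \<in> forms r 1"
  shows "eval v F = (\<Sum>i\<le>r. Poly_Mapping.lookup F (Poly_Mapping.single i 1) * v i)"
  by (subst linear_form_eq[OF assms]) (simp only: eval_sum eval_mult eval_scalar eval_var)

section \<open>Products of monomials of degree \<open>d\<close>\<close>

text \<open>If \<open>m'\<close> were pointwise at most \<open>m\<close>, equality of the total
  degrees would force \<open>m = m'\<close>.\<close>

lemma monomials_deficit:
  assumes "m \<in> monomials r d" "m' \<in> monomials r d" "m \<noteq> m'"
  obtains i where "Poly_Mapping.lookup m i < Poly_Mapping.lookup m' i"
proof -
  have "\<exists>i. Poly_Mapping.lookup m i < Poly_Mapping.lookup m' i"
  proof (rule ccontr)
    assume "\<not> ?thesis"
    then have le: "Poly_Mapping.lookup m' i \<le> Poly_Mapping.lookup m i" for i by (meson not_less)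
    from assms have "(\<Sum>i\<le>r. Poly_Mapping.lookup m' i) = (\<Sum>i\<le>r. Poly_Mapping.lookup m i)"
      by (simp add: monomials_def flip: total_deg_eq_sum[of "{..r}"])
    then have "Poly_Mapping.lookup m' i = Poly_Mapping.lookup m i" if "i \<le> r" for i
      using sum_mono_inv[of "Poly_Mapping.lookup m'" "{..r}" "Poly_Mapping.lookup m" i] le that by auto
    moreover have "Poly_Mapping.lookup m' i = Poly_Mapping.lookup m i" if "\<not> i \<le> r" for i
      using assms that by (simp add: monomials_def subset_iff in_keys_iff) (metis gr0I)
    ultimately show False
      using assms(3) by (metis poly_mapping_eqI)
  qed
  with that show ?thesis by blast
qed

lemma monomials_mult_split:
  assumes "M \<in> monomials r (e * d)"
  obtains ms where "length ms = e" "set ms \<subseteq> monomials r d" "sum_list ms = M"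
  using assms
proof (induction e arbitrary: M thesis)
  case 0
  then show ?case by (simp add: zero_in_monomials)
next
  case (Suc e)
  from Suc.prems(2) obtain a b where ab: "M = a + b" "a \<in> monomials r d" "b \<in> monomials r (e * d)"
    by (auto elim: monomials_split)
  obtain ms where "length ms = e" "set ms \<subseteq> monomials r d" "sum_list ms = b"
    using Suc.IH[OF _ ab(3)] by blast
  then show ?case
    using Suc.prems(1)[of "a # ms"] ab by simp
qed

text \<open>The combinatorics of rewriting products, detached from geometry: \<open>\<mu> m\<close>
  stands for the linear form \<open>[m]\<close>, \<open>C\<close> for the ring of multipliers
  absorbed by \<open>J\<close>, and \<open>swap\<close> exchanges one variable between two factors,
  as \<open>swap_linear_factors\<close> will provide.\<close>

locale monomial_swaps = additive_subset J for J :: "'b::comm_ring_1 set" +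
  fixes C :: "'b set" and r d :: nat and \<mu> :: "(nat \<Rightarrow>\<^sub>0 nat) \<Rightarrow> 'b"
  assumes one_C: "1 \<in> C" and mult_C: "x \<in> C \<Longrightarrow> y \<in> C \<Longrightarrow> x * y \<in> C"
    and absorb: "c \<in> C \<Longrightarrow> x \<in> J \<Longrightarrow> c * x \<in> J"
    and image_C: "m \<in> monomials r d \<Longrightarrow> \<mu> m \<in> C"
    and swap: "i \<le> r \<Longrightarrow> j \<le> r \<Longrightarrow> p \<in> monomials r (d - 1) \<Longrightarrow> q \<in> monomials r (d - 1) \<Longrightarrow>
      \<mu> (Poly_Mapping.single i 1 + p) * \<mu> (Poly_Mapping.single j 1 + q) -
      \<mu> (Poly_Mapping.single j 1 + p) * \<mu> (Poly_Mapping.single i 1 + q) \<in> J"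
begin

lemma prod_list_C: "set ms \<subseteq> monomials r d \<Longrightarrow> prod_list (map \<mu> ms) \<in> C"
  by (induction ms) (auto simp: one_C intro: mult_C image_C)

lemma cong_mult: "c \<in> C \<Longrightarrow> x - y \<in> J \<Longrightarrow> c * x - c * y \<in> J"
  using absorb[of c "x - y"] by (simp add: right_diff_distrib)

text \<open>Induction on the number of variables, with multiplicity, that \<open>m\<close> still
  lacks to become \<open>m'\<close>. While the two differ, equality of degrees gives a missing
  \<open>x\<close> and a surplus \<open>y\<close>; swapping this \<open>y\<close> against an
  \<open>x\<close> in another factor lowers the count by one.\<close>

lemma replace_head:
  assumes "m \<in> monomials r d" "set ms \<subseteq> monomials r d" "m' \<in> monomials r d"
    and "\<And>i. Poly_Mapping.lookup m' i \<le> Poly_Mapping.lookup (m + sum_list ms) i"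
  shows "\<exists>ms'. length ms' = length ms \<and> set ms' \<subseteq> monomials r d \<and> m' + sum_list ms' = m + sum_list ms \<and>
    prod_list (map \<mu> (m # ms)) - prod_list (map \<mu> (m' # ms')) \<in> J"
  using assms
proof (induction "\<Sum>i\<le>r. Poly_Mapping.lookup m' i - Poly_Mapping.lookup m i" arbitrary: m ms rule: less_induct)
  case less
  show ?case
  proof (cases "m = m'")
    case True
    then show ?thesis using less.prems zero_J by (intro exI[of _ ms]) auto
  next
    case False
    obtain x where x: "Poly_Mapping.lookup m x < Poly_Mapping.lookup m' x"
      using monomials_deficit[OF less.prems(1,3) False] .
    obtain y where y: "Poly_Mapping.lookup m' y < Poly_Mapping.lookup m y"
      using monomials_deficit[OF less.prems(3,1)] False by metis
    have "x \<noteq> y" using x y by auto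
    obtain p where p: "m = Poly_Mapping.single y 1 + p" "y \<le> r" "d > 0" "p \<in> monomials r (d - 1)"
      using monomials_remove_var[OF less.prems(1), of y] y by auto
    \<comment> \<open>The whole product contains at least as many \<open>x\<close> as
      \<open>m'\<close>, but the head alone has fewer, so another factor must contain one.\<close>
    have "\<exists>q\<in>set ms. Poly_Mapping.lookup q x > 0"
    proof (rule ccontr)
      assume "\<not> ?thesis"
      then have "Poly_Mapping.lookup (sum_list ms) x = 0"
        by (induction ms) (auto simp: lookup_add)
      with less.prems(4)[of x] x show False by (simp add: lookup_add)
    qed
    then obtain as q bs where ms: "ms = as @ q # bs" and qx: "Poly_Mapping.lookup q x > 0"
      by (meson split_list)
    have q: "q \<in> monomials r d" using less.prems(2) ms by auto
    obtain q' where q': "q = Poly_Mapping.single x 1 + q'" "x \<le> r" "q' \<in> monomials r (d - 1)"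
      using monomials_remove_var[OF q qx] by blast
    let ?m = "Poly_Mapping.single x 1 + p" and ?q = "Poly_Mapping.single y 1 + q'"
    let ?ms = "as @ ?q # bs"
    have in_mon: "?m \<in> monomials r d" "?q \<in> monomials r d"
      using monomials_add_single[OF p(4) q'(2)] monomials_add_single[OF q'(3) p(2)] p(3) by simp_all
    have sum_eq: "?m + sum_list ?ms = m + sum_list ms"
      by (simp add: ms p(1) q'(1) add_ac)
    have decr: "(\<Sum>i\<le>r. Poly_Mapping.lookup m' i - Poly_Mapping.lookup ?m i)
        < (\<Sum>i\<le>r. Poly_Mapping.lookup m' i - Poly_Mapping.lookup m i)"
    proof (rule sum_strict_mono_ex1)
      show "\<forall>i\<in>{..r}. Poly_Mapping.lookup m' i - Poly_Mapping.lookup ?m i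
          \<le> Poly_Mapping.lookup m' i - Poly_Mapping.lookup m i"
        using y by (auto simp: p(1) lookup_add lookup_single when_def)
      show "\<exists>i\<in>{..r}. Poly_Mapping.lookup m' i - Poly_Mapping.lookup ?m i
          < Poly_Mapping.lookup m' i - Poly_Mapping.lookup m i"
        using x q'(2) \<open>x \<noteq> y\<close>
        by (intro bexI[of _ x]) (auto simp: p(1) lookup_add lookup_single when_def)
    qed simp
    have ms_mon: "set ?ms \<subseteq> monomials r d"
      using less.prems(2) in_mon(2) ms by auto
    have le: "Poly_Mapping.lookup m' i \<le> Poly_Mapping.lookup (?m + sum_list ?ms) i" for i
      using less.prems(4)[of i] unfolding sum_eq .
    obtain ms' where ms': "length ms' = length ?ms" "set ms' \<subseteq> monomials r d"
        "m' + sum_list ms' = ?m + sum_list ?ms"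
        "prod_list (map \<mu> (?m # ?ms)) - prod_list (map \<mu> (m' # ms')) \<in> J"
      using less.hyps[OF decr in_mon(1) ms_mon less.prems(3) le] by blast
    have "set (as @ bs) \<subseteq> monomials r d" using less.prems(2) ms by auto
    from cong_mult[OF prod_list_C[OF this] swap[OF p(2) q'(2) p(4) q'(3)]]
    have "prod_list (map \<mu> (m # ms)) - prod_list (map \<mu> (?m # ?ms)) \<in> J"
      by (simp add: ms p(1) q'(1) mult_ac)
    from cong_trans[OF this ms'(4)] ms' sum_eq show ?thesis
      by (intro exI[of _ ms']) (auto simp: ms)
  qed
qed

text \<open>Once \<open>replace_head\<close> has made the heads equal, the tails again have equal
  sums and equal length.\<close>

lemma prod_list_cong:
  assumes "set ms \<subseteq> monomials r d" "set ms' \<subseteq> monomials r d" "length ms = length ms'"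
    and "sum_list ms = sum_list ms'"
  shows "prod_list (map \<mu> ms) - prod_list (map \<mu> ms') \<in> J"
  using assms
proof (induction ms' arbitrary: ms)
  case Nil
  then show ?case by (simp add: zero_J)
next
  case (Cons m' ms')
  then obtain m ns where ms: "ms = m # ns" by (cases ms) auto
  have "Poly_Mapping.lookup m' i \<le> Poly_Mapping.lookup (m + sum_list ns) i" for i
    using Cons.prems(4) by (simp add: ms lookup_add)
  then obtain ns' where ns': "length ns' = length ns" "set ns' \<subseteq> monomials r d"
      "m' + sum_list ns' = m + sum_list ns"
      "prod_list (map \<mu> (m # ns)) - prod_list (map \<mu> (m' # ns')) \<in> J"
    using replace_head[of m ns m'] Cons.prems by (auto simp: ms)
  have "sum_list ns' = sum_list ms'"
    using ns'(3) Cons.prems(4) by (simp add: ms)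
  then have "prod_list (map \<mu> ns') - prod_list (map \<mu> ms') \<in> J"
    using Cons ns' ms by (intro Cons.IH) auto
  then have "prod_list (map \<mu> (m' # ns')) - prod_list (map \<mu> (m' # ms')) \<in> J"
    using cong_mult[of "\<mu> m'"] image_C Cons.prems(2) by simp
  from cong_trans[OF ns'(4) this] show ?case by (simp add: ms)
qed

text \<open>An arbitrary factorisation into \<open>e\<close> monomials of degree \<open>d\<close> is
  chosen; another choice changes the value only by an element of \<open>J\<close>. The choice is
  meaningful only for \<open>M\<close> of degree \<open>e * d\<close>.\<close>

definition factor_prod :: "nat \<Rightarrow> (nat \<Rightarrow>\<^sub>0 nat) \<Rightarrow> 'b" where
  "factor_prod e M =
     prod_list (map \<mu> (SOME ms. length ms = e \<and> set ms \<subseteq> monomials r d \<and> sum_list ms = M))"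

lemma factor_prod_cong:
  assumes "set ms \<subseteq> monomials r d"
  shows "factor_prod (length ms) (sum_list ms) - prod_list (map \<mu> ms) \<in> J"
proof -
  let ?ms = "SOME ms'. length ms' = length ms \<and> set ms' \<subseteq> monomials r d \<and> sum_list ms' = sum_list ms"
  have "length ?ms = length ms \<and> set ?ms \<subseteq> monomials r d \<and> sum_list ?ms = sum_list ms"
    by (rule someI[where x = ms]) (use assms in auto)
  then show ?thesis
    unfolding factor_prod_def using assms by (intro prod_list_cong) auto
qed

lemma factor_prod_Suc:
  assumes "m \<in> monomials r d" "M \<in> monomials r (e * d)"
  shows "factor_prod (Suc e) (m + M) - \<mu> m * factor_prod e M \<in> J"
proof -
  obtain ms where ms: "length ms = e" "set ms \<subseteq> monomials r d" "sum_list ms = M"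
    using monomials_mult_split[OF assms(2)] .
  have "factor_prod (Suc e) (m + M) - \<mu> m * prod_list (map \<mu> ms) \<in> J"
    using factor_prod_cong[of "m # ms"] ms assms by simp
  moreover have "\<mu> m * factor_prod e M - \<mu> m * prod_list (map \<mu> ms) \<in> J"
    using cong_mult[OF image_C[OF assms(1)] factor_prod_cong[OF ms(2)]] ms by simp
  ultimately show ?thesis
    using cong_sym cong_trans by blast
qed

end

section \<open>Quadratic forms and rank\<close>

lemma single_add_eq_iff:
  fixes i j k l :: nat
  shows "Poly_Mapping.single k (1::nat) + Poly_Mapping.single l 1 = Poly_Mapping.single i 1 + Poly_Mapping.single j 1
    \<longleftrightarrow> k = i \<and> l = j \<or> k = j \<and> l = i"
proof
  assume *: "Poly_Mapping.single k (1::nat) + Poly_Mapping.single l 1 = Poly_Mapping.single i 1 + Poly_Mapping.single j 1"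
  then have "Poly_Mapping.keys (Poly_Mapping.single k (1::nat) + Poly_Mapping.single l 1)
     = Poly_Mapping.keys (Poly_Mapping.single i (1::nat) + Poly_Mapping.single j 1)" by simp
  then have "{k, l} = {i, j}" by (simp add: keys_add_nat insert_commute)
  then show "k = i \<and> l = j \<or> k = j \<and> l = i" by (auto simp: doubleton_eq_iff)
qed (auto simp: add.commute)

lemma lookup_mult_linear_forms:
  assumes "A \<in> forms r 1" "C \<in> forms r 1" "i \<le> r" "j \<le> r"
  defines "a k \<equiv> Poly_Mapping.lookup A (Poly_Mapping.single k 1)"
    and "c k \<equiv> Poly_Mapping.lookup C (Poly_Mapping.single k 1)"
  shows "Poly_Mapping.lookup (A * C) (Poly_Mapping.single i 1 + Poly_Mapping.single j 1)
    = (if i = j then a i * c i else a i * c j + a j * c i)"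
proof -
  have "A * C = (\<Sum>k\<le>r. \<Sum>l\<le>r. Poly_Mapping.single (Poly_Mapping.single k 1 + Poly_Mapping.single l 1) (a k * c l))"
    by (subst linear_form_eq[OF assms(1)], subst linear_form_eq[OF assms(2)])
       (simp only: sum_product var_def mult_single a_def c_def mult_1_right add_0_left)
  then have "Poly_Mapping.lookup (A * C) (Poly_Mapping.single i 1 + Poly_Mapping.single j 1) =
     (\<Sum>k\<le>r. \<Sum>l\<le>r. if k = i \<and> l = j \<or> k = j \<and> l = i then a k * c l else 0)"
    by (simp only: lookup_sum lookup_single when_def single_add_eq_iff)
  also have "\<dots> = (\<Sum>p\<in>{..r} \<times> {..r}. if p \<in> {(i, j), (j, i)} then a (fst p) * c (snd p) else 0)"
    by (auto simp: sum.cartesian_product intro!: sum.cong)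
  also have "\<dots> = (\<Sum>p\<in>{(i, j), (j, i)}. a (fst p) * c (snd p))"
    using assms(3,4) by (subst sum.inter_restrict[symmetric]) (auto intro!: sum.cong)
  also have "\<dots> = (if i = j then a i * c i else a i * c j + a j * c i)"
    by auto
  finally show ?thesis .
qed

text \<open>The symmetric matrix is the sum of three matrices of rank at most 1, with entries
  \<open>a i * c j / 2\<close>, \<open>c i * a j / 2\<close> and \<open>- b i * b j\<close>.\<close>

lemma quad_rank_mult_diff_square:
  fixes A B C :: "'k::field mpoly"
  assumes "A \<in> forms r 1" "B \<in> forms r 1" "C \<in> forms r 1" "(2::'k) \<noteq> 0"
  shows "quad_rank r (A * C - B * B) \<le> 3"
proof -
  define a b c where "a k = Poly_Mapping.lookup A (Poly_Mapping.single k 1)"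
    and "b k = Poly_Mapping.lookup B (Poly_Mapping.single k 1)"
    and "c k = Poly_Mapping.lookup C (Poly_Mapping.single k 1)" for k
  define M where "M f g = Matrix.mat (Suc r) (Suc r) (\<lambda>(i, j). f i * g j :: 'k)" for f g
  have "quad_matrix r (A * C - B * B) = M (\<lambda>i. a i / 2) c + (M (\<lambda>i. c i / 2) a + M (\<lambda>i. - b i) b)"
    (is "_ = ?M1 + (?M2 + ?M3)")
  proof (rule eq_matI)
    fix i j assume "i < dim_row (?M1 + (?M2 + ?M3))" "j < dim_col (?M1 + (?M2 + ?M3))"
    then have ij: "i \<le> r" "j \<le> r" by (auto simp: M_def)
    have half: "x * y / 2 + x * y / 2 = x * y" for x y :: 'k
      using assms(4) by (simp flip: add_divide_distrib mult_2)
    show "quad_matrix r (A * C - B * B) $$ (i, j) = (?M1 + (?M2 + ?M3)) $$ (i, j)"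
    proof (cases "i = j")
      case True
      then have "quad_matrix r (A * C - B * B) $$ (i, j) = a i * c i - b i * b i"
        using ij by (simp add: quad_matrix_def lookup_minus lookup_mult_linear_forms[OF assms(1,3) ij(2,2)]
            lookup_mult_linear_forms[OF assms(2,2) ij(2,2)] a_def b_def c_def del: One_nat_def)
      then show ?thesis
        using True ij half[of "a i" "c i"] by (simp add: M_def mult.commute flip: add.assoc)
    next
      case False
      then have "quad_matrix r (A * C - B * B) $$ (i, j)
          = (a i * c j + a j * c i - (b i * b j + b j * b i)) / 2"
        using ij by (simp add: quad_matrix_def lookup_minus lookup_mult_linear_forms[OF assms(1,3) ij]
            lookup_mult_linear_forms[OF assms(2,2) ij] a_def b_def c_def del: One_nat_def)
      also have "\<dots> = a i * c j / 2 + a j * c i / 2 - (b i * b j / 2 + b i * b j / 2)"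
        by (simp add: add_divide_distrib diff_divide_distrib mult.commute)
      finally show ?thesis
        unfolding half using ij by (simp add: M_def mult.commute)
    qed
  qed (auto simp: quad_matrix_def M_def)
  moreover have "vec_space.rank (Suc r) (M f g) \<le> 1" for f g
    by (rule vec_space.rank_le_1_product_entries[where f = f and g = g]) (auto simp: M_def)
  then have "vec_space.rank (Suc r) ?M1 + (vec_space.rank (Suc r) ?M2 + vec_space.rank (Suc r) ?M3) \<le> 3"
    by (smt (verit, best) add_mono numeral_Bit1 numeral_One one_add_one add.assoc)
  moreover have M: "M f g \<in> carrier_mat (Suc r) (Suc r)" for f g by (simp add: M_def)
  have "vec_space.rank (Suc r) (?M1 + (?M2 + ?M3))
      \<le> vec_space.rank (Suc r) ?M1 + (vec_space.rank (Suc r) ?M2 + vec_space.rank (Suc r) ?M3)"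
    by (intro order.trans[OF vec_space.rank_subadditive[where nc = "Suc r"]] add_left_mono
        vec_space.rank_subadditive[where nc = "Suc r"] M add_carrier_mat)
  ultimately show ?thesis unfolding quad_rank_def by simp
qed

lemma eval_quadratic_form:
  fixes Q :: "'k::field mpoly"
  assumes "Q \<in> forms r 2" "(2::'k) \<noteq> 0"
  shows "eval v Q = (\<Sum>i\<le>r. \<Sum>j\<le>r. quad_matrix r Q $$ (i, j) * v i * v j)"
  using assms(1)
proof (induction Q rule: forms_induct)
  case zero
  then show ?case by (simp add: quad_matrix_def)
next
  case (add F G)
  have "quad_matrix r (F + G) $$ (i, j) = quad_matrix r F $$ (i, j) + quad_matrix r G $$ (i, j)"
    if "i \<le> r" "j \<le> r" for i j
    using that by (simp add: quad_matrix_def lookup_add Let_def add_divide_distrib)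
  then show ?case
    by (simp add: eval_add add distrib_right sum.distrib)
next
  case (single m c)
  have "m \<in> monomials r (Suc (Suc 0))" using single by (simp add: numeral_2_eq_2)
  then obtain k l where m: "m = Poly_Mapping.single k 1 + Poly_Mapping.single l 1" "k \<le> r" "l \<le> r"
    by (metis add.right_neutral monomials_Suc zero_in_monomials)
  define c' where "c' = (if k = l then c else c / 2)"
  have "quad_matrix r (Poly_Mapping.single m c) $$ (i, j) = (if (i, j) \<in> {(k, l), (l, k)} then c' else 0)"
    if "i \<le> r" "j \<le> r" for i j
  proof -
    have "m = Poly_Mapping.single i 1 + Poly_Mapping.single j 1 \<longleftrightarrow> (i, j) \<in> {(k, l), (l, k)}"
      unfolding m(1) single_add_eq_iff by auto
    then have "Poly_Mapping.lookup (Poly_Mapping.single m c) (Poly_Mapping.single i 1 + Poly_Mapping.single j 1)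
        = (if (i, j) \<in> {(k, l), (l, k)} then c else 0)"
      by (simp only: lookup_single when_def)
    then show ?thesis
      using that by (auto simp: quad_matrix_def c'_def)
  qed
  then have "quad_matrix r (Poly_Mapping.single m c) $$ (i, j) * v i * v j =
      (if (i, j) \<in> {(k, l), (l, k)} then c' * v k * v l else 0)" if "i \<le> r" "j \<le> r" for i j
    using that by auto
  then have "(\<Sum>i\<le>r. \<Sum>j\<le>r. quad_matrix r (Poly_Mapping.single m c) $$ (i, j) * v i * v j) =
      (\<Sum>i\<le>r. \<Sum>j\<le>r. if (i, j) \<in> {(k, l), (l, k)} then c' * v k * v l else 0)"
    by (intro sum.cong refl) blast
  also have "\<dots> = (\<Sum>p\<in>{..r} \<times> {..r}. if p \<in> {(k, l), (l, k)} then c' * v k * v l else 0)"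
    by (simp only: sum.cartesian_product case_prod_unfold prod.collapse)
  also have "\<dots> = (\<Sum>p\<in>{(k, l), (l, k)}. c' * v k * v l)"
    by (rule sum.mono_neutral_cong_right) (use m(2,3) in simp_all)
  also have "\<dots> = c * v k * v l"
  proof (cases "k = l")
    case False
    then have "(\<Sum>p\<in>{(k, l), (l, k)}. c' * v k * v l) = 2 * (c / 2 * v k * v l)"
      by (simp add: c'_def)
    then show ?thesis using assms(2) by simp
  qed (simp add: c'_def)
  also have "\<dots> = eval v (scalar c * (var k * var l))"
    by (simp only: eval_mult eval_scalar eval_var mult.assoc)
  also have "scalar c * (var k * var l) = Poly_Mapping.single m c"
    by (simp add: var_def mult_single m(1))
  finally show ?case by simp
qed

section \<open>The ideal of a Veronese re-embedding\<close>

lemma two_neq_zero_char3: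
  assumes "(3::'a::comm_ring_1) = 0"
  shows "(2::'a) \<noteq> 0"
proof
  assume "(2::'a) = 0"
  then have "(3::'a) - 2 = 0" using assms by simp
  then show False by simp
qed

lemma scalar_mult_linext: "linext \<phi> (scalar c * F) = scalar c * linext \<phi> F"
proof (induction F rule: mpoly_induct)
  case (single m a)
  have "scalar c * Poly_Mapping.single m a = Poly_Mapping.single m (c * a)"
    by (simp add: mult_single)
  then show ?case
    by (simp add: mult_single flip: mult.assoc)
qed (simp add: distrib_left linext_add)

lemma ideal_genideal:
  assumes "\<And>x. x \<in> S \<Longrightarrow> x \<in> carrier (poly_ring r)"
  shows "ideal (genideal (poly_ring r) S) (poly_ring r :: 'k::comm_ring_1 mpoly ring)"
  using assms by (intro ring.genideal_ideal cring.axioms(1)[OF cring_poly_ring]) auto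

lemma genideal_subset:
  "ideal I (poly_ring r) \<Longrightarrow> S \<subseteq> I \<Longrightarrow> genideal (poly_ring r) S \<subseteq> I"
  by (auto simp: genideal_def)

lemma subset_genideal: "S \<subseteq> genideal (poly_ring r) S"
  by (auto simp: genideal_def)

text \<open>
  The homogeneous ideal of a set of coordinate vectors \<open>\<sigma> z\<close>, \<open>z \<in> Z\<close>. Working with parametrised
  coordinate vectors avoids all choices of representatives of points.
\<close>

definition vanishing_forms :: "nat \<Rightarrow> 'z set \<Rightarrow> ('z \<Rightarrow> nat \<Rightarrow> 'k) \<Rightarrow> 'k::comm_ring_1 mpoly set" where
  "vanishing_forms r Z \<sigma> = {F. (\<exists>e. F \<in> forms r e) \<and> (\<forall>z\<in>Z. eval (\<sigma> z) F = 0)}"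

definition vanishing_ideal :: "nat \<Rightarrow> 'z set \<Rightarrow> ('z \<Rightarrow> nat \<Rightarrow> 'k) \<Rightarrow> 'k::comm_ring_1 mpoly set" where
  "vanishing_ideal r Z \<sigma> = genideal (poly_ring r) (vanishing_forms r Z \<sigma>)"

lemma ideal_vanishing_ideal: "ideal (vanishing_ideal r Z \<sigma>) (poly_ring r)"
  unfolding vanishing_ideal_def
  by (rule ideal_genideal) (auto simp: vanishing_forms_def forms_carrier)

lemma eval_vanishing_ideal:
  assumes "F \<in> vanishing_ideal r Z \<sigma>" "z \<in> Z"
  shows "eval (\<sigma> z) F = 0"
proof -
  let ?I = "{F \<in> carrier (poly_ring r). eval (\<sigma> z) F = 0}"
  have "ideal ?I (poly_ring r)"
    unfolding ideal_poly_ring_iff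
    by (auto simp: eval_add eval_mult carrier_add carrier_mult forms_carrier[OF forms_zero])
  moreover have "vanishing_forms r Z \<sigma> \<subseteq> ?I"
    using assms(2) by (auto simp: vanishing_forms_def forms_carrier)
  ultimately show ?thesis
    using genideal_subset assms(1) unfolding vanishing_ideal_def by blast
qed

lemma vanishing_forms_in_ideal:
  "F \<in> forms r e \<Longrightarrow> (\<And>z. z \<in> Z \<Longrightarrow> eval (\<sigma> z) F = 0) \<Longrightarrow> F \<in> vanishing_ideal r Z \<sigma>"
  using subset_genideal[of "vanishing_forms r Z \<sigma>" r]
  unfolding vanishing_ideal_def vanishing_forms_def by blast

text \<open>
  The vectors \<open>\<tau> z\<close> are the coordinates of the re-embedding of \<open>\<sigma> z\<close> by all forms of degree \<open>d\<close>.
\<close>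

locale veronese_reembedding =
  fixes Z :: "'z set" and \<sigma> \<tau> :: "'z \<Rightarrow> nat \<Rightarrow> 'k::field" and r R d n :: nat
  assumes nonempty: "Z \<noteq> {}"
    and nondegenerate: "A \<in> forms R 1 \<Longrightarrow> (\<And>z. z \<in> Z \<Longrightarrow> eval (\<tau> z) A = 0) \<Longrightarrow> A = 0"
    and lift_ex: "F \<in> forms r d \<Longrightarrow> \<exists>A\<in>forms R 1. \<forall>z\<in>Z. eval (\<tau> z) A = eval (\<sigma> z) F"
    and coordinate_ex: "a \<le> R \<Longrightarrow> \<exists>F\<in>forms r d. \<forall>z\<in>Z. eval (\<sigma> z) F = \<tau> z a"
    and generated: "vanishing_ideal r Z \<sigma> =
      genideal (poly_ring r) {F \<in> vanishing_ideal r Z \<sigma>. \<exists>e\<le>n. F \<in> forms r e}"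
    and n_le_d: "n \<le> d" and d_ge: "3 \<le> d" and char3: "(3::'k) = 0"
begin

definition lift_monomial :: "(nat \<Rightarrow>\<^sub>0 nat) \<Rightarrow> 'k mpoly" where
  "lift_monomial m = (SOME A. A \<in> forms R 1 \<and>
     (\<forall>z\<in>Z. eval (\<tau> z) A = eval (\<sigma> z) (Poly_Mapping.single m 1)))"

text \<open>The linear form \<open>[F]\<close> of the overview. Monomials of any degree other than
  \<open>d\<close> are sent to 0, so that every value is a linear form.\<close>

definition lift :: "'k mpoly \<Rightarrow> 'k mpoly" where
  "lift = linext (\<lambda>m. if m \<in> monomials r d then lift_monomial m else 0)"

lemma lift_monomial:
  assumes "m \<in> monomials r d"
  shows "lift_monomial m \<in> forms R 1" "z \<in> Z \<Longrightarrow> eval (\<tau> z) (lift_monomial m) = eval (\<sigma> z) (Poly_Mapping.single m 1)"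
proof -
  have "\<exists>A. A \<in> forms R 1 \<and> (\<forall>z\<in>Z. eval (\<tau> z) A = eval (\<sigma> z) (Poly_Mapping.single m 1))"
    using lift_ex[OF forms_single[OF assms]] by blast
  from someI_ex[OF this] show "lift_monomial m \<in> forms R 1"
    "z \<in> Z \<Longrightarrow> eval (\<tau> z) (lift_monomial m) = eval (\<sigma> z) (Poly_Mapping.single m 1)"
    unfolding lift_monomial_def by blast+
qed

lemma lift_add: "lift (F + G) = lift F + lift G"
  by (simp add: lift_def linext_add)

lemma lift_single: "m \<in> monomials r d \<Longrightarrow> lift (Poly_Mapping.single m c) = scalar c * lift_monomial m"
  by (simp add: lift_def)

lemma lift_forms: "lift F \<in> forms R 1"
  unfolding lift_def by (rule linext_forms) (simp add: lift_monomial del: One_nat_def)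

lemma eval_lift: "F \<in> forms r d \<Longrightarrow> z \<in> Z \<Longrightarrow> eval (\<tau> z) (lift F) = eval (\<sigma> z) F"
proof (induction F rule: forms_induct)
  case zero
  then show ?case by (simp add: lift_def)
next
  case (single m c)
  then have "eval (\<tau> z) (lift (Poly_Mapping.single m c)) = c * eval (\<sigma> z) (Poly_Mapping.single m 1)"
    by (simp add: lift_single eval_mult lift_monomial)
  then show ?case by (simp add: eval_single)
qed (simp add: lift_add eval_add)

text \<open>Nondegeneracy makes a linear form on the target unique given its values at the points.
  This identifies the lift of a coordinate with a variable, and the lift of a form vanishing on the
  variety with 0.\<close>

lemma lift_eqI:
  assumes "F \<in> forms r d" "A \<in> forms R 1" "\<And>z. z \<in> Z \<Longrightarrow> eval (\<tau> z) A = eval (\<sigma> z) F"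
  shows "lift F = A"
  using nondegenerate[of "lift F - A"] assms by (simp add: forms_diff lift_forms eval_diff eval_lift del: One_nat_def)

definition quadrics_rank_le_3 :: "'k mpoly set" where
  "quadrics_rank_le_3 = {Q \<in> vanishing_ideal R Z \<tau>. Q \<in> forms R 2 \<and> quad_rank R Q \<le> 3}"

lemma rank3_quadric:
  assumes "f \<in> forms r 1" "g \<in> forms r 1" "h \<in> forms r (d - 2)"
  shows "lift (f * f * h) * lift (g * g * h) - lift (f * g * h) ^ 2 \<in> quadrics_rank_le_3"
proof -
  have forms: "f' * g' * h \<in> forms r d" if "f' \<in> forms r 1" "g' \<in> forms r 1" for f' g'
  proof -
    have "1 + 1 + (d - 2) = d" using d_ge by simp
    then show ?thesis using forms_mult[OF forms_mult[OF that] assms(3)] by (simp only:)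
  qed
  let ?Q = "lift (f * f * h) * lift (g * g * h) - lift (f * g * h) * lift (f * g * h)"
  have Q: "?Q \<in> forms R 2"
    using forms_mult[OF lift_forms lift_forms] by (intro forms_diff) (auto simp: numeral_2_eq_2)
  have "eval (\<tau> z) ?Q = 0" if "z \<in> Z" for z
    using that assms by (simp add: eval_diff eval_mult eval_lift forms)
  with Q have "?Q \<in> vanishing_ideal R Z \<tau>" by (rule vanishing_forms_in_ideal)
  moreover have "quad_rank R ?Q \<le> 3"
    by (rule quad_rank_mult_diff_square[OF lift_forms lift_forms lift_forms two_neq_zero_char3[OF char3]])
  ultimately show ?thesis using Q by (simp add: quadrics_rank_le_3_def power2_eq_square)
qed

section \<open>Congruences modulo an ideal containing the rank 3 quadrics\<close>

context
  fixes I assumes I: "ideal I (poly_ring R)" and quadrics: "quadrics_rank_le_3 \<subseteq> I"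
begin

lemma monomial_swaps: "monomial_swaps I (carrier (poly_ring R)) r d lift_monomial"
proof -
  interpret char3_relations I "forms r 1 :: 'k mpoly set"
    using I ideal_uminus[OF I] unfolding ideal_poly_ring_iff
    by unfold_locales (auto simp: forms_add char3 simp flip: single_numeral)
  show ?thesis
  proof unfold_locales
    fix i j p q assume ij: "i \<le> r" "j \<le> r" and pq: "p \<in> monomials r (d - 1)" "q \<in> monomials r (d - 1)"
    obtain ps where ps: "length ps = d - 1" "set ps \<subseteq> {..r}"
      "\<And>c::'k. Poly_Mapping.single p c = scalar c * prod_list (map var ps)"
      using monomials_var_list[OF pq(1)] by blast
    obtain qs where qs: "length qs = d - 1" "set qs \<subseteq> {..r}"
      "\<And>c::'k. Poly_Mapping.single q c = scalar c * prod_list (map var qs)"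
      using monomials_var_list[OF pq(2)] by blast
    have *: "lift_monomial (Poly_Mapping.single k 1 + s) = lift (var k * prod_list (map var ss))"
      if "k \<le> r" "s \<in> monomials r (d - 1)" "\<And>c::'k. Poly_Mapping.single s c = scalar c * prod_list (map var ss)" for k s ss
    proof -
      have "Poly_Mapping.single k 1 + s \<in> monomials r d"
        using monomials_add_single[OF that(2,1)] d_ge by simp
      then have "lift_monomial (Poly_Mapping.single k 1 + s) = lift (Poly_Mapping.single (Poly_Mapping.single k 1 + s) 1)"
        by (simp add: lift_single)
      also have "Poly_Mapping.single (Poly_Mapping.single k 1 + s) 1 = var k * Poly_Mapping.single s (1::'k)"
        by (simp add: var_def mult_single)
      finally show ?thesis by (simp add: that(3))
    qed
    have lin: "set (map var ss) \<subseteq> forms r 1" if "set ss \<subseteq> {..r}" for ss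
      using that forms_var by (auto simp del: One_nat_def)
    have "lift (var i * prod_list (map var ps)) * lift (var j * prod_list (map var qs)) -
        lift (var j * prod_list (map var ps)) * lift (var i * prod_list (map var qs)) \<in> I"
    \<comment> \<open>The lists \<open>ps\<close> and \<open>qs\<close> have
      \<open>d - 1 = n + 2\<close> entries, and the common factor of a quadric is a product of
      \<open>d - 2 = n + 1\<close> linear forms.\<close>
    proof (rule swap_linear_factors[where n = "d - 3"])
      fix f g :: "'k mpoly" and hs :: "'k mpoly list"
      assume fg: "f \<in> forms r 1" "g \<in> forms r 1" and hs: "set hs \<subseteq> forms r 1" "length hs = Suc (d - 3)"
      then have "prod_list hs \<in> forms r (d - 2)"
        using forms_prod_list[OF hs(1)] d_ge by (simp add: numeral_3_eq_3 Suc_diff_Suc numeral_2_eq_2)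
      from rank3_quadric[OF fg this] quadrics
      show "lift (f * f * prod_list hs) * lift (g * g * prod_list hs) - (lift (f * g * prod_list hs))\<^sup>2 \<in> I"
        by blast
    qed (use ij lin[OF ps(2)] lin[OF qs(2)] ps(1) qs(1) d_ge in \<open>simp_all add: lift_add forms_var del: One_nat_def\<close>)
    then show "lift_monomial (Poly_Mapping.single i 1 + p) * lift_monomial (Poly_Mapping.single j 1 + q) -
        lift_monomial (Poly_Mapping.single j 1 + p) * lift_monomial (Poly_Mapping.single i 1 + q) \<in> I"
      using *[OF _ pq(1) ps(3)] *[OF _ pq(2) qs(3)] ij by simp
  qed (use I in \<open>auto simp: ideal_poly_ring_iff carrier_mult forms_carrier[OF forms_one]
      intro: forms_carrier[OF lift_monomial(1)]\<close>)
qed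

interpretation monomial_swaps I "carrier (poly_ring R)" r d lift_monomial
  by (rule monomial_swaps)

text \<open>Sends a form of degree \<open>e * d\<close> to a combination of products of
  \<open>e\<close> linear forms in the target variables. The other degrees are set to 0, where
  \<open>factor_prod\<close> carries no information.\<close>

definition canonical :: "nat \<Rightarrow> 'k mpoly \<Rightarrow> 'k mpoly" where
  "canonical e = linext (\<lambda>M. if M \<in> monomials r (e * d) then factor_prod e M else 0)"

lemma smult_I: "x \<in> I \<Longrightarrow> scalar c * x \<in> I"
  by (rule absorb[OF scalar_in_carrier])

lemma canonical_mult:
  assumes "F \<in> forms r d" "H \<in> forms r (e * d)"
  shows "canonical (Suc e) (F * H) - lift F * canonical e H \<in> I"
  using assms(1)
proof (induction F rule: forms_induct)
  case zero
  then show ?case by (simp add: canonical_def lift_def zero_J)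
next
  case (add F G)
  from add_J[OF this] show ?case
    by (simp add: canonical_def linext_add lift_add algebra_simps)
next
  case (single m c)
  from assms(2) show ?case
  proof (induction H rule: forms_induct)
    case zero
    then show ?case by (simp add: canonical_def zero_J)
  next
    case (add F G)
    from add_J[OF this] show ?case
      by (simp add: canonical_def linext_add algebra_simps)
  next
    case (single M b)
    then have "m + M \<in> monomials r (Suc e * d)"
      using monomials_add[OF \<open>m \<in> monomials r d\<close>] by simp
    then have "canonical (Suc e) (Poly_Mapping.single m c * Poly_Mapping.single M b)
        = scalar (c * b) * factor_prod (Suc e) (m + M)"
      by (simp add: canonical_def mult_single)
    moreover have "scalar (c * b) = scalar c * scalar b"
      by (simp add: mult_single)
    then have "lift (Poly_Mapping.single m c) * canonical e (Poly_Mapping.single M b)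
        = scalar (c * b) * (lift_monomial m * factor_prod e M)"
      using single \<open>m \<in> monomials r d\<close> by (simp add: canonical_def lift_single mult_ac)
    ultimately have "canonical (Suc e) (Poly_Mapping.single m c * Poly_Mapping.single M b) -
        lift (Poly_Mapping.single m c) * canonical e (Poly_Mapping.single M b)
      = scalar (c * b) * (factor_prod (Suc e) (m + M) - lift_monomial m * factor_prod e M)"
      by (simp only: right_diff_distrib)
    then show ?case
      using factor_prod_Suc[OF \<open>m \<in> monomials r d\<close> single] smult_I by simp
  qed
qed

text \<open>\<open>H\<close> arises from \<open>G\<close> by substituting for each variable the
  degree \<open>d\<close> form it represents. Since the lift of that form is the variable itself,
  \<open>canonical_mult\<close> rebuilds each monomial of \<open>G\<close> factor by factor, up to
  congruence.\<close>

lemma form_cong_canonical: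
  assumes "G \<in> forms R e"
  shows "\<exists>H\<in>forms r (e * d). (\<forall>z\<in>Z. eval (\<sigma> z) H = eval (\<tau> z) G) \<and> G - canonical e H \<in> I"
  using assms
proof (induction G rule: forms_induct)
  case zero
  show ?case by (rule bexI[of _ 0]) (auto simp: canonical_def zero_J)
next
  case (add G G')
  then obtain H H' where "H \<in> forms r (e * d)" "\<forall>z\<in>Z. eval (\<sigma> z) H = eval (\<tau> z) G" "G - canonical e H \<in> I"
    "H' \<in> forms r (e * d)" "\<forall>z\<in>Z. eval (\<sigma> z) H' = eval (\<tau> z) G'" "G' - canonical e H' \<in> I" by blast
  moreover from this have "(G + G') - canonical e (H + H') \<in> I"
    using add_J[of "G - canonical e H" "G' - canonical e H'"] by (simp add: canonical_def linext_add algebra_simps)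
  ultimately show ?case
    by (intro bexI[of _ "H + H'"]) (auto simp: eval_add forms_add)
next
  case (single M c)
  obtain as where as: "length as = e" "set as \<subseteq> {..R}"
      "\<And>c::'k. Poly_Mapping.single M c = scalar c * prod_list (map var as)"
    using monomials_var_list[OF single] by blast
  have "\<exists>H\<in>forms r (length as * d). (\<forall>z\<in>Z. eval (\<sigma> z) H = eval (\<tau> z) (prod_list (map var as))) \<and>
      prod_list (map var as) - canonical (length as) H \<in> I"
    using as(2)
  proof (induction as)
    case Nil
    have "1 - factor_prod 0 0 \<in> I"
      using cong_sym factor_prod_cong[of "[]"] by simp
    moreover have "canonical 0 (scalar 1) = factor_prod 0 0"
      unfolding canonical_def linext_single by (simp add: zero_in_monomials)
    ultimately have "1 - canonical 0 1 \<in> I" by simp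
    then show ?case
      by (intro bexI[of _ 1]) (auto simp: forms_one)
  next
    case (Cons a as)
    then obtain H where H: "H \<in> forms r (length as * d)"
      "\<forall>z\<in>Z. eval (\<sigma> z) H = eval (\<tau> z) (prod_list (map var as))"
      "prod_list (map var as) - canonical (length as) H \<in> I" by auto
    obtain F where F: "F \<in> forms r d" "\<forall>z\<in>Z. eval (\<sigma> z) F = \<tau> z a"
      using coordinate_ex[of a] Cons.prems by auto
    have "lift F = var a"
      using Cons.prems F by (intro lift_eqI forms_var) auto
    with canonical_mult[OF F(1) H(1)] have "canonical (Suc (length as)) (F * H) - var a * canonical (length as) H \<in> I"
      by simp
    moreover have "var a * prod_list (map var as) - var a * canonical (length as) H \<in> I"
      using Cons.prems by (intro cong_mult H(3) forms_carrier[OF forms_var]) auto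
    ultimately have "var a * prod_list (map var as) - canonical (Suc (length as)) (F * H) \<in> I"
      using cong_sym cong_trans by blast
    then show ?case
      using F H forms_mult[OF F(1) H(1)] by (intro bexI[of _ "F * H"]) (auto simp: eval_mult)
  qed
  then obtain H where "H \<in> forms r (e * d)" "\<forall>z\<in>Z. eval (\<sigma> z) H = eval (\<tau> z) (prod_list (map var as))"
      "prod_list (map var as) - canonical e H \<in> I" using as(1) by auto
  moreover from this have "scalar c * prod_list (map var as) - canonical e (scalar c * H) \<in> I"
    using smult_I[of "prod_list (map var as) - canonical e H" c]
    by (simp add: canonical_def scalar_mult_linext right_diff_distrib)
  ultimately show ?case
    by (intro bexI[of _ "scalar c * H"]) (auto simp: as(3) eval_mult forms_smult)
qed

text \<open>On a monomial multiple of a generator of degree at most \<open>d\<close>, part of the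
  monomial raises the generator to degree exactly \<open>d\<close>. The resulting form still
  vanishes on the variety, so its lift is 0, and \<open>canonical_mult\<close> finishes.\<close>

lemma canonical_vanishing_ideal:
  assumes "F \<in> vanishing_ideal r Z \<sigma>" "e > 0"
  shows "canonical e F \<in> I"
proof -
  \<comment> \<open>\<open>canonical e\<close> is linear but not multiplicative. Requiring the
    condition for all monomial multiples makes \<open>K\<close> an ideal, so that only generators
    need checking.\<close>
  define K where "K = {F \<in> carrier (poly_ring r). \<forall>\<mu>. Poly_Mapping.keys \<mu> \<subseteq> {..r} \<longrightarrow>
     canonical e (Poly_Mapping.single \<mu> 1 * F) \<in> I}"
  have "ideal K (poly_ring r)"
    unfolding ideal_poly_ring_iff
  proof (intro conjI ballI)
    show "K \<subseteq> carrier (poly_ring r)" by (auto simp: K_def)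
    show "0 \<in> K" by (simp add: K_def forms_carrier[OF forms_zero] canonical_def zero_J)
    show add_K: "x + y \<in> K" if "x \<in> K" "y \<in> K" for x y
      using that add_J unfolding K_def canonical_def
      by (simp add: carrier_add distrib_left linext_add)
    show "y * x \<in> K" if x: "x \<in> K" and y: "y \<in> carrier (poly_ring r)" for x y
      using y
    proof (induction y rule: carrier_induct)
      case zero
      show ?case by (simp add: K_def forms_carrier[OF forms_zero] canonical_def zero_J)
    next
      case (add F G)
      then show ?case by (simp add: distrib_right add_K)
    next
      case (single \<nu> c)
      have "canonical e (Poly_Mapping.single \<mu> 1 * (Poly_Mapping.single \<nu> c * x)) =
          scalar c * canonical e (Poly_Mapping.single (\<mu> + \<nu>) 1 * x)" for \<mu>
        by (simp add: canonical_def mult_single flip: scalar_mult_linext mult.assoc)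
      moreover have "canonical e (Poly_Mapping.single (\<mu> + \<nu>) 1 * x) \<in> I"
        if "Poly_Mapping.keys \<mu> \<subseteq> {..r}" for \<mu>
        using x single that by (simp add: K_def keys_add_nat)
      moreover have "Poly_Mapping.single \<nu> c * x \<in> carrier (poly_ring r)"
        using x single by (intro carrier_mult) (auto simp: K_def carrier_iff)
      ultimately show ?case by (simp add: K_def smult_I)
    qed
  qed
  moreover have "F \<in> K" if F: "F \<in> vanishing_ideal r Z \<sigma>" "F \<in> forms r e'" "e' \<le> n" for F e'
    unfolding K_def
  proof (intro CollectI conjI allI impI)
    show "F \<in> carrier (poly_ring r)" using F by (simp add: forms_carrier)
    fix \<mu> :: "nat \<Rightarrow>\<^sub>0 nat" assume "Poly_Mapping.keys \<mu> \<subseteq> {..r}"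
    then obtain k where \<mu>: "\<mu> \<in> monomials r k" by (simp add: monomials_def)
    show "canonical e (Poly_Mapping.single \<mu> 1 * F) \<in> I"
    proof (cases "k + e' = e * d")
      case False
      have "Poly_Mapping.single \<mu> 1 * F \<in> forms r (k + e')"
        using \<mu> F(2) by (intro forms_mult forms_single)
      with False have "M \<notin> monomials r (e * d)" if "M \<in> Poly_Mapping.keys (Poly_Mapping.single \<mu> 1 * F)" for M
        using that by (auto simp: forms_iff monomials_def)
      then have "canonical e (Poly_Mapping.single \<mu> 1 * F) = 0"
        by (simp add: canonical_def linext_def)
      then show ?thesis by (simp add: zero_J)
    next
      case True
      obtain e1 where e: "e = Suc e1" using assms(2) by (cases e) auto
      \<comment> \<open>As \<open>e' \<le> n \<le> d\<close>, the monomial has room for a factor of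
        degree \<open>d - e'\<close>; what remains has degree a multiple of
        \<open>d\<close>.\<close>
      have "k = (d - e') + e1 * d" using True F(3) n_le_d by (simp add: e)
      with \<mu> obtain \<mu>1 \<mu>2 where \<mu>12: "\<mu> = \<mu>1 + \<mu>2" "\<mu>1 \<in> monomials r (d - e')" "\<mu>2 \<in> monomials r (e1 * d)"
        by (auto elim: monomials_split)
      let ?F = "Poly_Mapping.single \<mu>1 1 * F"
      have F': "?F \<in> forms r d"
        using forms_mult[OF forms_single[OF \<mu>12(2)] F(2)] F(3) n_le_d by simp
      have "lift ?F = 0"
        by (rule lift_eqI[OF F']) (simp_all add: eval_mult eval_vanishing_ideal[OF F(1)])
      with canonical_mult[OF F' forms_single[OF \<mu>12(3), of 1]]
      have "canonical e (?F * Poly_Mapping.single \<mu>2 1) \<in> I" by (simp add: e)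
      moreover have "?F * Poly_Mapping.single \<mu>2 1 = (Poly_Mapping.single \<mu>1 1 * Poly_Mapping.single \<mu>2 1) * F"
        by (simp only: mult_ac)
      ultimately show ?thesis by (simp add: mult_single \<mu>12(1))
    qed
  qed
  ultimately have "vanishing_ideal r Z \<sigma> \<subseteq> K"
    by (subst generated) (rule genideal_subset, auto)
  with assms(1) have "F \<in> K" by blast
  then have "canonical e (Poly_Mapping.single 0 1 * F) \<in> I"
    unfolding K_def by (metis (lifting) mem_Collect_eq empty_subsetI keys_zero)
  then show ?thesis by simp
qed

lemma vanishing_form_in_ideal:
  assumes "G \<in> vanishing_forms R Z \<tau>"
  shows "G \<in> I"
proof -
  from assms obtain e where G: "G \<in> forms R e" and zero: "\<forall>z\<in>Z. eval (\<tau> z) G = 0"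
    by (auto simp: vanishing_forms_def)
  show ?thesis
  proof (cases "e = 0")
    \<comment> \<open>A constant has no linear factor for the lift to annihilate, so degree 0 is
      settled separately: a constant vanishing at some point is 0.\<close>
    case True
    with G have "Poly_Mapping.keys G \<subseteq> {0}" by (auto simp: forms_iff zero_in_monomials)
    then have "G = scalar (Poly_Mapping.lookup G 0)"
      by (intro poly_mapping_eqI) (auto simp: lookup_single when_def in_keys_iff)
    with zero nonempty show ?thesis
      by (metis eval_scalar all_not_in_conv single_zero zero_J)
  next
    case False
    obtain H where H: "H \<in> forms r (e * d)" "\<forall>z\<in>Z. eval (\<sigma> z) H = eval (\<tau> z) G" "G - canonical e H \<in> I"
      using form_cong_canonical[OF G] by blast
    then have "H \<in> vanishing_ideal r Z \<sigma>"
      using zero by (intro vanishing_forms_in_ideal) auto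
    with False have "canonical e H \<in> I" by (simp add: canonical_vanishing_ideal)
    from add_J[OF H(3) this] show ?thesis by simp
  qed
qed

end

theorem vanishing_ideal_generated_by_quadrics_rank_le_3:
  "vanishing_ideal R Z \<tau> = genideal (poly_ring R) quadrics_rank_le_3"
proof
  have "ideal (genideal (poly_ring R) quadrics_rank_le_3) (poly_ring R)"
    by (rule ideal_genideal) (auto simp: quadrics_rank_le_3_def forms_carrier)
  moreover from this have "vanishing_forms R Z \<tau> \<subseteq> genideal (poly_ring R) quadrics_rank_le_3"
    using vanishing_form_in_ideal subset_genideal by blast
  ultimately show "vanishing_ideal R Z \<tau> \<subseteq> genideal (poly_ring R) quadrics_rank_le_3"
    unfolding vanishing_ideal_def by (rule genideal_subset)
  show "genideal (poly_ring R) quadrics_rank_le_3 \<subseteq> vanishing_ideal R Z \<tau>"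
    by (rule genideal_subset[OF ideal_vanishing_ideal]) (auto simp: quadrics_rank_le_3_def)
qed

end

section \<open>Quadrics of rank at most 2\<close>

text \<open>A maximal independent set of columns has at most two members and spans all columns.
  These are \<open>g\<close> and \<open>h\<close>, padded by zero if fewer, and \<alpha>, \<beta>
  are the coefficients of the columns.\<close>

lemma rank_le_2_entries:
  fixes A :: "'k::field mat"
  assumes A: "A \<in> carrier_mat n nc" and rank: "vec_space.rank n A \<le> 2"
  obtains g h \<alpha> \<beta> where "\<And>i j. i < n \<Longrightarrow> j < nc \<Longrightarrow> A $$ (i, j) = g i * \<alpha> j + h i * \<beta> j"
proof -
  interpret vec_space "TYPE('k)" n .
  have cols: "set (cols A) \<subseteq> carrier_vec n" using A cols_dim by blast
  obtain S where S: "maximal S (\<lambda>T. T \<subseteq> set (cols A) \<and> lin_indpt T)" "finite S"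
    using maximal_exists_superset[of "set (cols A)" "\<lambda>T. T \<subseteq> set (cols A) \<and> lin_indpt T" "{}"]
      finite_lin_indpt2[of "{}"] by auto
  have SA: "S \<subseteq> set (cols A)" and indpt: "lin_indpt S" using S(1) by (auto simp: maximal_def)
  have SC: "S \<subseteq> carrier_vec n" using SA cols by blast
  have card: "card S \<le> 2" using rank rank_card_indpt[OF A S(1)] by simp
  have col_span: "col A j \<in> span S" if "j < nc" for j
  proof (rule ccontr)
    assume notin: "col A j \<notin> span S"
    have mem: "col A j \<in> set (cols A)" using that A by (auto simp: cols_def)
    then have "lin_indpt (S \<union> {col A j})"
      using lin_dep_iff_in_span[OF SC indpt] notin cols span_mem[OF SC] by blast
    then have "S \<union> {col A j} = S"
      using S(1) SA mem unfolding maximal_def by (metis Un_upper1 Un_subset_iff empty_subsetI insert_subset)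
    then show False using notin span_mem[OF SC] by blast
  qed
  have "\<exists>a. \<forall>i<n. A $$ (i, j) = (\<Sum>x\<in>S. a x * x $ i)" if j: "j < nc" for j
  proof -
    obtain a where "lincomb a S = col A j"
      using col_span[OF j] finite_span[OF S(2) SC] by auto
    then show ?thesis
      using lincomb_index[OF _ SC, of _ a] A j by (intro exI[of _ a]) (metis carrier_matD index_col)
  qed
  then obtain a where a: "\<And>i j. j < nc \<Longrightarrow> i < n \<Longrightarrow> A $$ (i, j) = (\<Sum>x\<in>S. a j x * x $ i)" by metis
  obtain g h where "S = {} \<or> S = {g} \<or> S = {g, h} \<and> g \<noteq> h"
  proof -
    have "card S = 0 \<or> card S = 1 \<or> card S = 2" using card by auto
    then show ?thesis using that S(2) by (auto simp: card_1_singleton_iff card_2_iff)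
  qed
  then consider "S = {}" | "S = {g}" | "S = {g, h}" "g \<noteq> h" by blast
  then show ?thesis
  proof cases
    case 1
    then show ?thesis using a that[of "\<lambda>_. 0" "\<lambda>_. 0" "\<lambda>_. 0" "\<lambda>_. 0"] by simp
  next
    case 2
    then show ?thesis using a that[of "\<lambda>i. g $ i" "\<lambda>j. a j g" "\<lambda>_. 0" "\<lambda>_. 0"] by (simp add: mult.commute)
  next
    case 3
    then show ?thesis using a that[of "\<lambda>i. g $ i" "\<lambda>j. a j g" "\<lambda>i. h $ i" "\<lambda>j. a j h"] by (simp add: mult.commute)
  qed
qed

lemma (in alg_closed_field) sqrt_exists: "\<exists>y. y * y = x"
  using nth_root_exists[of 2 x] by (auto simp: power2_eq_square)

text \<open>
  For a bilinear form of rank at most 2 all \<open>3 \<times> 3\<close> Gram determinants vanish. If \<open>B p p \<noteq> 0\<close> and the Gram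
  determinant \<open>D\<close> of \<open>p, q\<close> is nonzero, the one of \<open>p, q, v\<close> exhibits \<open>D \<cdot> B p p \<cdot> B v v\<close> as the
  sum of two squares \<open>(B p p \<cdot> B q v - B p q \<cdot> B p v)\<^sup>2 + D \<cdot> (B p v)\<^sup>2\<close>.
\<close>

lemma quadratic_form_rank_le_2_factors:
  fixes Q :: "'k::alg_closed_field mpoly"
  assumes Q: "Q \<in> forms r 2" and two: "(2::'k) \<noteq> 0" and rank: "quad_rank r Q \<le> 2"
  obtains a b where "\<And>v. eval v Q = (\<Sum>i\<le>r. a i * v i) * (\<Sum>i\<le>r. b i * v i)"
proof -
  note factorsI = that
  define M where "M = quad_matrix r Q"
  have "M \<in> carrier_mat (Suc r) (Suc r)" by (simp add: M_def quad_matrix_def)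
  moreover have "vec_space.rank (Suc r) M \<le> 2" using rank by (simp add: quad_rank_def M_def)
  ultimately obtain g h \<alpha> \<beta> where M_eq: "\<And>i j. i < Suc r \<Longrightarrow> j < Suc r \<Longrightarrow> M $$ (i, j) = g i * \<alpha> j + h i * \<beta> j"
    using rank_le_2_entries by metis
  define B where "B x y = (\<Sum>i\<le>r. \<Sum>j\<le>r. M $$ (i, j) * x i * y j)" for x y :: "nat \<Rightarrow> 'k"
  have B_eval: "B v v = eval v Q" for v
    using eval_quadratic_form[OF Q two] by (simp add: B_def M_def)
  have M_sym: "M $$ (i, j) = M $$ (j, i)" if "i \<le> r" "j \<le> r" for i j
    using that by (auto simp: M_def quad_matrix_def Let_def add.commute)
  have B_sym: "B x y = B y x" for x y
  proof -
    have "M $$ (i, j) * x i * y j = M $$ (j, i) * y j * x i" if "i \<le> r" "j \<le> r" for i j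
      using M_sym[OF that] by (simp add: mult_ac)
    then have "B x y = (\<Sum>i\<le>r. \<Sum>j\<le>r. M $$ (j, i) * y j * x i)"
      unfolding B_def by (intro sum.cong refl) auto
    also have "\<dots> = B y x"
      unfolding B_def by (rule sum.swap)
    finally show ?thesis .
  qed
  define l where "l f x = (\<Sum>i\<le>r. f i * x i)" for f x :: "nat \<Rightarrow> 'k"
  have B_eq: "B x y = l g x * l \<alpha> y + l h x * l \<beta> y" for x y
    unfolding B_def l_def sum_product sum.distrib[symmetric]
    by (intro sum.cong refl) (simp add: M_eq algebra_simps)
  define row where "row p i = (\<Sum>j\<le>r. M $$ (j, i) * p j)" for p i
  have B_row: "B p v = l (row p) v" for p v
    unfolding B_def l_def row_def by (subst sum.swap) (simp only: sum_distrib_right)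
  show ?thesis
  proof (cases "\<forall>p. B p p = 0")
    case True
    then show ?thesis using that[of "\<lambda>_. 0" "\<lambda>_. 0"] by (simp add: B_eval)
  next
    case False
    then obtain p where c: "B p p \<noteq> 0" by blast
    let ?c = "B p p"
    have factor: ?thesis if eq: "\<And>v. B v v = (u * l f v + w * l f' v) * (u' * l f v + w' * l f' v)"
      for u w u' w' f f'
    proof (rule factorsI)
      fix v
      show "eval v Q = (\<Sum>i\<le>r. (u * f i + w * f' i) * v i) * (\<Sum>i\<le>r. (u' * f i + w' * f' i) * v i)"
        using eq[of v] unfolding B_eval l_def
        by (simp add: sum_distrib_left sum.distrib distrib_right mult.assoc)
    qed
    show ?thesis
    proof (cases "\<forall>q. ?c * B q q = B p q * B p q")
      case True
      \<comment> \<open>Here the form has rank 1: it is the square of \<open>B p v\<close> divided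
        by \<open>B p p\<close>.\<close>
      show ?thesis
        by (rule factor[of "1 / ?c" "row p" 0 "row p" 1 0])
           (use True c in \<open>simp add: field_simps flip: B_row\<close>)
    next
      case False
      then obtain q where "?c * B q q \<noteq> B p q * B p q" by blast
      define D where "D = ?c * B q q - B p q * B p q"
      have D: "D \<noteq> 0" using \<open>?c * B q q \<noteq> B p q * B p q\<close> by (simp add: D_def)
      \<comment> \<open>A square root of \<open>- D\<close> splits
        \<open>x * x + D * (y * y)\<close> into
        \<open>(x + \<delta> * y) * (x - \<delta> * y)\<close>; this is where algebraic closedness
        is used.\<close>
      obtain \<delta> where \<delta>: "\<delta> * \<delta> = - D" using sqrt_exists by blast
      have gram: "B v v * (?c * D) = (?c * B q v - B p q * B p v) * (?c * B q v - B p q * B p v) + D * (B p v * B p v)" for v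
      proof -
        let ?det = "B p p * (B q q * B v v - B q v * B v q) - B p q * (B q p * B v v - B q v * B v p)
            + B p v * (B q p * B v q - B q q * B v p)"
        have "?det = 0"
          unfolding B_eq by (simp add: algebra_simps)
        moreover have "B v v * (?c * D) -
            ((?c * B q v - B p q * B p v) * (?c * B q v - B p q * B p v) + D * (B p v * B p v)) = ?c * ?det"
          unfolding D_def B_sym[of v q] B_sym[of q p] B_sym[of v p] by (simp add: algebra_simps)
        ultimately show ?thesis by simp
      qed
      have Bvv: "B v v = ((\<delta> - B p q) / (?c * D) * B p v + ?c / (?c * D) * B q v) *
          ((- \<delta> - B p q) * B p v + ?c * B q v)" for v
      proof -
        have "(x + \<delta> * y) * (x - \<delta> * y) = x * x - (\<delta> * \<delta>) * (y * y)" for x y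
          by (simp add: algebra_simps)
        then have diff: "(x + \<delta> * y) * (x - \<delta> * y) = x * x + D * (y * y)" for x y
          by (simp add: \<delta>)
        have "(\<delta> - B p q) * B p v + ?c * B q v = ?c * B q v - B p q * B p v + \<delta> * B p v"
          "(- \<delta> - B p q) * B p v + ?c * B q v = ?c * B q v - B p q * B p v - \<delta> * B p v"
          by (simp_all add: algebra_simps)
        then have "((\<delta> - B p q) * B p v + ?c * B q v) * ((- \<delta> - B p q) * B p v + ?c * B q v) = B v v * (?c * D)"
          unfolding gram by (simp only: diff)
        then have "B v v = (((\<delta> - B p q) * B p v + ?c * B q v) * ((- \<delta> - B p q) * B p v + ?c * B q v)) / (?c * D)"
          using c D by simp
        then show ?thesis by (simp only: times_divide_eq_left flip: add_divide_distrib)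
      qed
      have "B v v = ((\<delta> - B p q) / (?c * D) * l (row p) v + ?c / (?c * D) * l (row q) v) *
          ((- \<delta> - B p q) * l (row p) v + ?c * l (row q) v)" for v
        unfolding B_row[symmetric] by (rule Bvv)
      then show ?thesis by (rule factor)
    qed
  qed
qed

section \<open>Regular functions\<close>

lemma openin_zariski: "openin zariski U \<longleftrightarrow> zariski_open U"
  unfolding zariski_def by (simp add: topology_inverse'[OF istopology_zariski])

lemma zariski_open_subset: "zariski_open U \<Longrightarrow> U \<subseteq> all_points"
  by (auto simp: zariski_open_def)

lemma all_points_nonempty: "P \<in> all_points \<Longrightarrow> \<exists>v. v \<in> P"
  by (auto simp: all_points_def pline_def)

lemma self_in_pline: "v \<in> pline v"
  unfolding pline_def by (force intro: exI[of _ 1])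

lemma pline_eq: "w \<in> pline v \<Longrightarrow> pline w = pline v"
proof -
  assume "w \<in> pline v"
  then obtain c where c: "w = (\<lambda>i. c * v i)" "c \<noteq> 0" by (auto simp: pline_def)
  have "x \<in> pline w \<longleftrightarrow> x \<in> pline v" for x
  proof
    assume "x \<in> pline w"
    then obtain b where "x = (\<lambda>i. b * w i)" "b \<noteq> 0" by (auto simp: pline_def)
    then show "x \<in> pline v" unfolding pline_def c
      by (intro CollectI exI[of _ "b * c"]) (auto simp: c mult.assoc)
  next
    assume "x \<in> pline v"
    then obtain b where "x = (\<lambda>i. b * v i)" "b \<noteq> 0" by (auto simp: pline_def)
    then show "x \<in> pline w" unfolding pline_def
      by (intro CollectI exI[of _ "b / c"]) (auto simp: c)
  qed
  then show ?thesis by blast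
qed

lemma all_points_eq_pline: "P \<in> all_points \<Longrightarrow> v \<in> P \<Longrightarrow> P = pline v"
  using pline_eq by (auto simp: all_points_def)

lemma pline_in_all_points: "v \<noteq> (\<lambda>_. 0) \<Longrightarrow> pline v \<in> all_points"
  by (auto simp: all_points_def)

lemma proj_space_subset: "proj_space N \<subseteq> all_points"
  by (auto simp: proj_space_def all_points_def)

lemma all_vectors_iff:
  assumes "homogeneous e F" "P \<in> all_points" "v \<in> P"
  shows "(\<forall>w\<in>P. eval w F \<noteq> 0) \<longleftrightarrow> eval v F \<noteq> 0"
  unfolding all_points_eq_pline[OF assms(2,3)]
proof
  assume "eval v F \<noteq> 0"
  then show "\<forall>w\<in>pline v. eval w F \<noteq> 0"
    by (auto simp: pline_def eval_homogeneous_scale[OF assms(1)])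
qed (use self_in_pline in blast)

lemma zariski_open_basic:
  assumes "homogeneous e F"
  shows "zariski_open {P \<in> all_points. \<forall>v\<in>P. eval v F \<noteq> 0}"
proof -
  have "{P \<in> all_points. \<forall>v\<in>P. eval v F \<noteq> 0} = all_points - zero_locus {F}"
    using all_vectors_iff[OF assms] all_points_nonempty
    by (fastforce simp: zero_locus_def vanishes_at_def)
  then show ?thesis
    unfolding zariski_open_def using assms by (intro exI[of _ "{F}"]) auto
qed

lemma zariski_open_contains_basic:
  assumes "zariski_open U" "P \<in> U"
  obtains e F where "homogeneous e F" "\<And>v. v \<in> P \<Longrightarrow> eval v F \<noteq> 0"
    "{P \<in> all_points. \<forall>v\<in>P. eval v F \<noteq> 0} \<subseteq> U"
proof -
  obtain T where T: "\<forall>F\<in>T. \<exists>e. homogeneous e F" "U = all_points - zero_locus T"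
    using assms(1) by (auto simp: zariski_open_def)
  then obtain F where F: "F \<in> T" "\<not> vanishes_at F P" and P: "P \<in> all_points"
    using assms(2) by (auto simp: zero_locus_def)
  obtain e where e: "homogeneous e F" using T(1) F(1) by blast
  show ?thesis
  proof (rule that[OF e])
    show "eval v F \<noteq> 0" if "v \<in> P" for v
      using F(2) vanishes_at_pline[OF e, of v] all_points_eq_pline[OF P that] by simp
    show "{P \<in> all_points. \<forall>v\<in>P. eval v F \<noteq> 0} \<subseteq> U"
      using F(1) all_points_nonempty by (fastforce simp: T(2) zero_locus_def vanishes_at_def)
  qed
qed

lemma openin_basic:
  assumes "homogeneous e F" "X \<subseteq> all_points"
  shows "openin (zariski_on X) {P \<in> X. \<forall>v\<in>P. eval v F \<noteq> 0}"
  unfolding openin_subtopology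
  by (rule exI[of _ "{P \<in> all_points. \<forall>v\<in>P. eval v F \<noteq> 0}"])
     (use zariski_open_basic[OF assms(1)] assms(2) in \<open>auto simp: openin_zariski\<close>)

lemma topspace_zariski: "topspace zariski = all_points"
proof -
  have "openin zariski {P \<in> all_points. \<forall>v\<in>P. eval v 1 \<noteq> (0::'a)}"
    unfolding openin_zariski
    by (rule zariski_open_basic[of 0]) (simp add: homogeneous_def flip: single_one)
  then have "openin zariski (all_points :: 'a point set)" by simp
  then show ?thesis
    using zariski_open_subset unfolding topspace_def openin_zariski by blast
qed

lemma topspace_zariski_on: "X \<subseteq> all_points \<Longrightarrow> topspace (zariski_on X) = X"
  by (auto simp: topspace_zariski)

lemma regular_on_cong:
  assumes "\<And>P. P \<in> U \<Longrightarrow> f P = g P"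
  shows "regular_on X U f \<longleftrightarrow> regular_on X U g"
proof -
  have *: "regular_on X U g" if "regular_on X U f" "\<And>P. P \<in> U \<Longrightarrow> f P = g P" for f g
    unfolding regular_on_def
  proof
    fix P assume "P \<in> U"
    with that(1) obtain V e F G where V: "openin (zariski_on X) V" "P \<in> V" "V \<subseteq> U" "homogeneous e F" "homogeneous e G"
      "\<forall>Q\<in>V. \<forall>v\<in>Q. eval v G \<noteq> 0 \<and> f Q = eval v F / eval v G" unfolding regular_on_def by metis
    then have "\<forall>Q\<in>V. \<forall>v\<in>Q. eval v G \<noteq> 0 \<and> g Q = eval v F / eval v G"
      using that(2) by (metis subsetD)
    with V show "\<exists>V e F G. openin (zariski_on X) V \<and> P \<in> V \<and> V \<subseteq> U \<and> homogeneous e F \<and> homogeneous e G \<and>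
      (\<forall>Q\<in>V. \<forall>v\<in>Q. eval v G \<noteq> 0 \<and> g Q = eval v F / eval v G)"
      by blast
  qed
  show ?thesis using *[of f g] *[of g f] assms by auto
qed

lemma homogeneous_add: "homogeneous e F \<Longrightarrow> homogeneous e G \<Longrightarrow> homogeneous e (F + G)"
  using Poly_Mapping.keys_add[of F G] by (auto simp: homogeneous_def)

lemma regular_on_quotient:
  assumes "openin (zariski_on X) U" "homogeneous e F" "homogeneous e G"
    and "\<And>P v. P \<in> U \<Longrightarrow> v \<in> P \<Longrightarrow> eval v G \<noteq> 0 \<and> f P = eval v F / eval v G"
  shows "regular_on X U f"
  unfolding regular_on_def using assms by blast

lemma regular_on_const:
  assumes "openin (zariski_on X) U"
  shows "regular_on X U (\<lambda>_. c)"
  by (rule regular_on_quotient[OF assms, of 0 "scalar c" "scalar 1"])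
     (auto simp: homogeneous_def simp del: single_one)

text \<open>Abstracting the binary operation \<open>k\<close> lets sums and products share the
  passage to a common neighbourhood; what is left is an identity of fractions.\<close>

lemma regular_on_combine:
  assumes f: "regular_on X U f" and g: "regular_on X U g"
    and "\<And>e F G e' F' G'. homogeneous e F \<Longrightarrow> homogeneous e G \<Longrightarrow> homogeneous e' F' \<Longrightarrow> homogeneous e' G' \<Longrightarrow>
      \<exists>e'' F'' G''. homogeneous e'' F'' \<and> homogeneous e'' G'' \<and> (\<forall>v. eval v G \<noteq> 0 \<longrightarrow> eval v G' \<noteq> 0 \<longrightarrow>
        eval v G'' \<noteq> 0 \<and> k (eval v F / eval v G) (eval v F' / eval v G') = eval v F'' / eval v G'')"
  shows "regular_on X U (\<lambda>P. k (f P) (g P))"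
  unfolding regular_on_def
proof
  fix P assume "P \<in> U"
  with f obtain V e F G where V: "openin (zariski_on X) V" "P \<in> V" "V \<subseteq> U" "homogeneous e F" "homogeneous e G"
    "\<forall>Q\<in>V. \<forall>v\<in>Q. eval v G \<noteq> 0 \<and> f Q = eval v F / eval v G" unfolding regular_on_def by metis
  from \<open>P \<in> U\<close> g obtain V' e' F' G' where V': "openin (zariski_on X) V'" "P \<in> V'" "V' \<subseteq> U" "homogeneous e' F'" "homogeneous e' G'"
    "\<forall>Q\<in>V'. \<forall>v\<in>Q. eval v G' \<noteq> 0 \<and> g Q = eval v F' / eval v G'" unfolding regular_on_def by metis
  obtain e'' F'' G'' where "homogeneous e'' F''" "homogeneous e'' G''" "\<forall>v. eval v G \<noteq> 0 \<longrightarrow> eval v G' \<noteq> 0 \<longrightarrow>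
        eval v G'' \<noteq> 0 \<and> k (eval v F / eval v G) (eval v F' / eval v G') = eval v F'' / eval v G''"
    using assms(3)[OF V(4,5) V'(4,5)] by blast
  then show "\<exists>V e F G. openin (zariski_on X) V \<and> P \<in> V \<and> V \<subseteq> U \<and> homogeneous e F \<and> homogeneous e G \<and>
      (\<forall>Q\<in>V. \<forall>v\<in>Q. eval v G \<noteq> 0 \<and> k (f Q) (g Q) = eval v F / eval v G)"
    using V V' by (intro exI[of _ "V \<inter> V'"] exI[of _ e''] exI[of _ F''] exI[of _ G'']) (auto simp: openin_Int)
qed

lemma regular_on_add:
  assumes "regular_on X U f" "regular_on X U g"
  shows "regular_on X U (\<lambda>P. f P + g P)"
proof (rule regular_on_combine[OF assms])
  fix e e' and F G F' G' :: "'a mpoly"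
  assume h: "homogeneous e F" "homogeneous e G" "homogeneous e' F'" "homogeneous e' G'"
  have "homogeneous (e + e') (F * G' + G * F')" "homogeneous (e + e') (G * G')"
    using h by (auto intro!: homogeneous_add homogeneous_mult)
  then show "\<exists>e'' F'' G''. homogeneous e'' F'' \<and> homogeneous e'' G'' \<and> (\<forall>v. eval v G \<noteq> 0 \<longrightarrow> eval v G' \<noteq> 0 \<longrightarrow>
        eval v G'' \<noteq> 0 \<and> eval v F / eval v G + eval v F' / eval v G' = eval v F'' / eval v G'')"
    by (intro exI[of _ "e + e'"] exI[of _ "F * G' + G * F'"] exI[of _ "G * G'"])
       (auto simp: eval_add eval_mult field_simps)
qed

lemma regular_on_mult:
  assumes "regular_on X U f" "regular_on X U g"
  shows "regular_on X U (\<lambda>P. f P * g P)"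
proof (rule regular_on_combine[OF assms])
  fix e e' and F G F' G' :: "'a mpoly"
  assume h: "homogeneous e F" "homogeneous e G" "homogeneous e' F'" "homogeneous e' G'"
  then have "homogeneous (e + e') (F * F')" "homogeneous (e + e') (G * G')"
    by (auto intro!: homogeneous_mult)
  then show "\<exists>e'' F'' G''. homogeneous e'' F'' \<and> homogeneous e'' G'' \<and> (\<forall>v. eval v G \<noteq> 0 \<longrightarrow> eval v G' \<noteq> 0 \<longrightarrow>
        eval v G'' \<noteq> 0 \<and> eval v F / eval v G * (eval v F' / eval v G') = eval v F'' / eval v G'')"
    by (intro exI[of _ "e + e'"] exI[of _ "F * F'"] exI[of _ "G * G'"])
       (auto simp: eval_mult field_simps)
qed

lemma regular_on_power:
  assumes "regular_on X U f" "openin (zariski_on X) U"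
  shows "regular_on X U (\<lambda>P. f P ^ n)"
  by (induction n) (auto intro: regular_on_const regular_on_mult assms)

lemma regular_on_eval:
  assumes F: "F \<in> carrier (poly_ring r)" and s: "\<And>a. a \<le> r \<Longrightarrow> regular_on X U (s a)"
    and U: "openin (zariski_on X) U"
  shows "regular_on X U (\<lambda>P. eval (\<lambda>a. s a P) F)"
  using F
proof (induction F rule: carrier_induct)
  case (single m c)
  have "regular_on X U (\<lambda>P. \<Prod>a\<in>A. s a P ^ Poly_Mapping.lookup m a)" if "finite A" "A \<subseteq> {..r}" for A
    using that
    by (induction A) (auto intro!: regular_on_const regular_on_mult regular_on_power s U)
  with single show ?case
    unfolding eval_single by (intro regular_on_mult regular_on_const U) auto
next
  case zero
  show ?case using regular_on_const[OF U, of 0] by simp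
next
  case (add F G)
  from regular_on_add[OF this] show ?case by (simp add: eval_add)
qed

text \<open>Near each point the function is a quotient of forms, and it is nonzero where the
  numerator is.\<close>

lemma openin_regular_nonzero:
  assumes f: "regular_on X U f" and X: "X \<subseteq> all_points"
  shows "openin (zariski_on X) {P \<in> U. f P \<noteq> 0}"
proof (subst openin_subopen, intro ballI)
  fix P assume "P \<in> {P \<in> U. f P \<noteq> 0}"
  then have P: "P \<in> U" "f P \<noteq> 0" by auto
  from f P(1) obtain V e F G where V: "openin (zariski_on X) V" "P \<in> V" "V \<subseteq> U" "homogeneous e F" "homogeneous e G"
    "\<forall>Q\<in>V. \<forall>v\<in>Q. eval v G \<noteq> 0 \<and> f Q = eval v F / eval v G" unfolding regular_on_def by metis
  have VX: "V \<subseteq> X" using V(1) openin_subset topspace_zariski_on[OF X] by blast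
  let ?W = "V \<inter> {P \<in> X. \<forall>v\<in>P. eval v F \<noteq> 0}"
  have "openin (zariski_on X) ?W" by (intro openin_Int V openin_basic[OF V(4) X])
  moreover have "P \<in> ?W"
    using P V VX by auto
  moreover have "?W \<subseteq> {P \<in> U. f P \<noteq> 0}"
  proof
    fix Q assume Q: "Q \<in> ?W"
    then have "Q \<in> all_points" using X by auto
    then obtain v where "v \<in> Q" using all_points_nonempty by blast
    with Q V(3,6) show "Q \<in> {P \<in> U. f P \<noteq> 0}" by auto
  qed
  ultimately show "\<exists>W. openin (zariski_on X) W \<and> P \<in> W \<and> W \<subseteq> {P \<in> U. f P \<noteq> 0}" by blast
qed

lemma tensor_power_simps [simp]:
  "charts (tensor_power L d) = charts L" "chart (tensor_power L d) = chart L"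
  "trans_fun (tensor_power L d) = (\<lambda>i j P. trans_fun L i j P ^ d)"
  by (simp_all add: tensor_power_def)

text \<open>The parameter set for \<open>vanishing_ideal\<close>. A chart fixes the vector of
  section values at a point; a point lying in several charts occurs several times, with proportional
  vectors.\<close>

definition chart_points :: "'k::field line_bundle \<Rightarrow> (nat \<times> 'k point) set" where
  "chart_points L = {(i, P). i < charts L \<and> P \<in> chart L i}"

lemma chart_points_tensor_power [simp]: "chart_points (tensor_power L d) = chart_points L"
  by (simp add: chart_points_def)

abbreviation coords :: "(nat \<Rightarrow> 'k sect) \<Rightarrow> nat \<times> 'k point \<Rightarrow> nat \<Rightarrow> 'k" where
  "coords s z \<equiv> \<lambda>a. s a (fst z) (snd z)"

text \<open>A form vanishes on a punctured line as soon as it vanishes at one vector of it, and a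
  form in \<open>poly_ring r\<close> ignores the coordinates beyond \<open>r\<close>.\<close>

lemma embedding_ideal_eq:
  assumes "(\<Union>i<charts L. chart L i) = X"
  shows "embedding_ideal X L r s = vanishing_ideal r (chart_points L) (coords s)"
proof -
  have "(\<forall>Q\<in>section_map L r s ` X. vanishes_at F Q) \<longleftrightarrow> (\<forall>z\<in>chart_points L. eval (coords s z) F = 0)"
    if F: "F \<in> forms r e" for F e
  proof -
    have "vanishes_at F (section_map L r s P) \<longleftrightarrow>
        (\<forall>i\<in>{i. i < charts L \<and> P \<in> chart L i}. vanishes_at F (pline (\<lambda>a. if a \<le> r then s a i P else 0)))" for P
      unfolding section_map_def vanishes_at_def by blast
    moreover have "vanishes_at F (pline (\<lambda>a. if a \<le> r then s a i P else 0)) \<longleftrightarrow> eval (\<lambda>a. s a i P) F = 0" for i P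
      unfolding vanishes_at_pline[OF forms_homogeneous[OF F]]
      by (subst eval_cong[OF forms_carrier[OF F], of _ "\<lambda>a. s a i P"]) auto
    ultimately show ?thesis
      using assms by (auto simp: chart_points_def)
  qed
  then have "{F. (\<exists>e. F \<in> forms r e) \<and> (\<forall>P\<in>section_map L r s ` X. vanishes_at F P)}
      = vanishing_forms r (chart_points L) (coords s)"
    unfolding vanishing_forms_def by blast
  then show ?thesis
    by (simp add: embedding_ideal_def homog_ideal_def vanishing_ideal_def)
qed

section \<open>Sections of line bundles\<close>

lemma sum_sections_apply: "(\<Sum>x\<in>A. f x) i P = (\<Sum>x\<in>A. f x i P)" for f :: "'c \<Rightarrow> 'a \<Rightarrow> 'b \<Rightarrow> 'k::comm_monoid_add"
  by (induction A rule: infinite_finite_induct) auto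

lemma independent_sections_coeff_zero:
  fixes t :: "nat \<Rightarrow> 'k::field sect"
  assumes "inj_on t {..R}" "sections.independent (t ` {..R})"
    and "\<And>i P. (\<Sum>a\<le>R. c a * t a i P) = 0" and "a \<le> R"
  shows "c a = 0"
proof -
  let ?u = "\<lambda>v. c (inv_into {..R} t v)"
  have "(\<Sum>v\<in>t ` {..R}. (\<lambda>i P. ?u v * v i P)) = (0 :: 'k sect)"
  proof (intro ext)
    fix i P
    have "(\<Sum>v\<in>t ` {..R}. (\<lambda>i P. ?u v * v i P)) i P = (\<Sum>v\<in>t ` {..R}. ?u v * v i P)"
      by (rule sum_sections_apply)
    also have "\<dots> = (\<Sum>a\<le>R. c a * t a i P)"
      using assms(1) by (subst sum.reindex) (auto intro!: sum.cong simp: inv_into_f_f)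
    finally show "(\<Sum>v\<in>t ` {..R}. (\<lambda>i P. ?u v * v i P)) i P = (0 :: 'k sect) i P"
      using assms(3) by simp
  qed
  from sections.independentD[OF assms(2) _ _ this, of "t a"] assms(1,4) show ?thesis
    by (simp add: inv_into_f_f)
qed

lemma span_sections_coeffs:
  fixes t :: "nat \<Rightarrow> 'k::field sect"
  assumes "inj_on t {..R}" "f \<in> sections.span (t ` {..R})"
  obtains c where "\<And>i P. f i P = (\<Sum>a\<le>R. c a * t a i P)"
proof -
  obtain u where "f = (\<Sum>v\<in>t ` {..R}. (\<lambda>i P. u v * v i P))"
    using assms(2) by (subst (asm) sections.span_finite) auto
  then have "f i P = (\<Sum>a\<le>R. u (t a) * t a i P)" for i P
    using assms(1) by (simp add: sum_sections_apply sum.reindex)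
  then show ?thesis using that[of "\<lambda>a. u (t a)"] by blast
qed

lemma H0_I:
  assumes "\<And>i. i < charts L \<Longrightarrow> regular_on X (chart L i) (s i)"
    and "\<And>i j P. i < charts L \<Longrightarrow> j < charts L \<Longrightarrow> P \<in> chart L i \<Longrightarrow> P \<in> chart L j \<Longrightarrow>
      s i P = trans_fun L i j P * s j P"
    and "\<And>i P. (i, P) \<notin> chart_points L \<Longrightarrow> s i P = 0"
  shows "s \<in> H0 X L"
  using assms unfolding H0_def chart_points_def by blast

lemma H0_regular: "s \<in> H0 X L \<Longrightarrow> i < charts L \<Longrightarrow> regular_on X (chart L i) (s i)"
  unfolding H0_def by blast

lemma H0_trans: "s \<in> H0 X L \<Longrightarrow> i < charts L \<Longrightarrow> j < charts L \<Longrightarrow> P \<in> chart L i \<Longrightarrow> P \<in> chart L j \<Longrightarrow>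
    s i P = trans_fun L i j P * s j P"
  unfolding H0_def by blast

lemma H0_outside: "s \<in> H0 X L \<Longrightarrow> (i, P) \<notin> chart_points L \<Longrightarrow> s i P = 0"
  unfolding H0_def chart_points_def by blast

locale variety_bundle =
  fixes X :: "'k::field point set" and L :: "'k line_bundle"
  assumes points: "X \<subseteq> all_points" and trivialised: "line_bundle_on X L"
begin

lemma chart_open: "i < charts L \<Longrightarrow> openin (zariski_on X) (chart L i)"
  and charts_cover: "(\<Union>i<charts L. chart L i) = X"
  using trivialised unfolding line_bundle_on_def by blast+

lemma trans_nonzero: "i < charts L \<Longrightarrow> j < charts L \<Longrightarrow> P \<in> chart L i \<Longrightarrow> P \<in> chart L j \<Longrightarrow> trans_fun L i j P \<noteq> 0"
  using trivialised unfolding line_bundle_on_def by blast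

lemma tensor_power_bundle: "variety_bundle X (tensor_power L d)"
proof
  have regular: "regular_on X (chart L i \<inter> chart L j) (\<lambda>P. trans_fun L i j P ^ d)" if "i < charts L" "j < charts L" for i j
    using trivialised that unfolding line_bundle_on_def
    by (intro regular_on_power openin_Int chart_open) blast+
  have cocycle: "trans_fun L i k P ^ d = trans_fun L i j P ^ d * trans_fun L j k P ^ d"
    if "i < charts L" "j < charts L" "k < charts L" "P \<in> chart L i \<inter> chart L j \<inter> chart L k" for i j k P
    using trivialised that unfolding line_bundle_on_def power_mult_distrib[symmetric] by metis
  show "line_bundle_on X (tensor_power L d)"
    unfolding line_bundle_on_def tensor_power_simps
    by (intro conjI allI impI ballI chart_open charts_cover regular cocycle power_not_zero trans_nonzero) auto
qed (rule points)

lemma subspace_H0: "sections.subspace (H0 X L)"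
proof (rule sections.subspaceI)
  show "0 \<in> H0 X L"
    by (rule H0_I) (simp_all add: zero_fun_def regular_on_const chart_open)
  show "x + y \<in> H0 X L" if x: "x \<in> H0 X L" and y: "y \<in> H0 X L" for x y
  proof (rule H0_I)
    show "(x + y) i P = trans_fun L i j P * (x + y) j P"
      if "i < charts L" "j < charts L" "P \<in> chart L i" "P \<in> chart L j" for i j P
      using H0_trans[OF x that] H0_trans[OF y that] by (simp add: distrib_left)
  qed (simp_all add: plus_fun_def regular_on_add H0_regular[OF x] H0_regular[OF y] H0_outside[OF x] H0_outside[OF y])
  show "(\<lambda>i P. c * x i P) \<in> H0 X L" if x: "x \<in> H0 X L" for c x
  proof (rule H0_I)
    show "c * x i P = trans_fun L i j P * (c * x j P)"
      if "i < charts L" "j < charts L" "P \<in> chart L i" "P \<in> chart L j" for i j P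
      using H0_trans[OF x that] by simp
  qed (simp_all add: regular_on_mult regular_on_const chart_open H0_regular[OF x] H0_outside[OF x])
qed

lemma sum_H0:
  assumes "\<And>a. a \<le> R \<Longrightarrow> t a \<in> H0 X L"
  shows "(\<lambda>i P. \<Sum>a\<le>R. c a * t a i P) \<in> H0 X L"
proof -
  have "(\<Sum>a\<le>R. (\<lambda>i P. c a * t a i P)) \<in> H0 X L"
    using assms by (intro sections.subspace_sum[OF subspace_H0] sections.subspace_scale[OF subspace_H0]) auto
  moreover have "(\<Sum>a\<le>R. (\<lambda>i P. c a * t a i P)) = (\<lambda>i P. \<Sum>a\<le>R. c a * t a i P)"
    by (intro ext) (rule sum_sections_apply)
  ultimately show ?thesis by (simp only:)
qed

text \<open>Homogeneity of degree \<open>e\<close> turns the transition function of \<open>L\<close>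
  into its \<open>e\<close>-th power.\<close>

lemma restrict_form_H0:
  assumes s: "\<And>a. a \<le> r \<Longrightarrow> s a \<in> H0 X L" and F: "F \<in> forms r e"
  shows "restrict_form L s F \<in> H0 X (tensor_power L e)"
proof -
  have regular: "regular_on X (chart L i) (restrict_form L s F i)" if i: "i < charts L" for i
  proof -
    have "regular_on X (chart L i) (\<lambda>P. eval (\<lambda>a. s a i P) F)"
      by (rule regular_on_eval[where s = "\<lambda>a. s a i", OF forms_carrier[OF F] H0_regular[OF s i] chart_open[OF i]])
    then show ?thesis
      by (rule regular_on_cong[THEN iffD1, rotated]) (simp add: restrict_form_def i)
  qed
  have trans: "eval (\<lambda>a. s a i P) F = trans_fun L i j P ^ e * eval (\<lambda>a. s a j P) F"
    if "i < charts L" "j < charts L" "P \<in> chart L i" "P \<in> chart L j" for i j P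
  proof -
    have "eval (\<lambda>a. s a i P) F = eval (\<lambda>a. trans_fun L i j P * s a j P) F"
      by (rule eval_cong[OF forms_carrier[OF F]]) (rule H0_trans[OF s that])
    then show ?thesis by (simp add: eval_homogeneous_scale[OF forms_homogeneous[OF F]])
  qed
  show ?thesis
  proof (rule H0_I)
    show "restrict_form L s F i P = trans_fun (tensor_power L e) i j P * restrict_form L s F j P"
      if "i < charts (tensor_power L e)" "j < charts (tensor_power L e)"
        "P \<in> chart (tensor_power L e) i" "P \<in> chart (tensor_power L e) j" for i j P
      using that trans[of i j P] by (simp add: restrict_form_def)
  qed (use regular in \<open>auto simp: restrict_form_def chart_points_def\<close>)
qed

text \<open>The zero loci of \<open>f\<close> and \<open>g\<close> are closed and cover
  \<open>X\<close>, so irreducibility makes one of them all of \<open>X\<close>. They are well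
  defined because transition functions have no effect on vanishing.\<close>

lemma H0_integral:
  assumes irr: "irreducible_set X" and f: "f \<in> H0 X L" and g: "g \<in> H0 X L"
    and fg: "\<And>i P. f i P * g i P = 0"
  shows "(\<forall>i P. f i P = 0) \<or> (\<forall>i P. g i P = 0)"
proof -
  define N where "N h = {P \<in> X. \<exists>i<charts L. P \<in> chart L i \<and> h i P = 0}" for h :: "'k sect"
  have chart_indep: "h j P = 0"
    if "h \<in> H0 X L" "i < charts L" "j < charts L" "P \<in> chart L i" "P \<in> chart L j" "h i P = 0" for h i j P
    using H0_trans[OF that(1,3,2,5,4)] that(6) by simp
  have closed: "closedin (zariski_on X) (N h)" if h: "h \<in> H0 X L" for h
  proof -
    have "X - N h = (\<Union>i<charts L. {P \<in> chart L i. h i P \<noteq> 0})"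
    proof (rule Set.set_eqI)
      fix P
      show "P \<in> X - N h \<longleftrightarrow> P \<in> (\<Union>i<charts L. {P \<in> chart L i. h i P \<noteq> 0})"
        using charts_cover chart_indep[OF h, of _ _ P] unfolding N_def by blast
    qed
    moreover have "openin (zariski_on X) (\<Union>i<charts L. {P \<in> chart L i. h i P \<noteq> 0})"
      by (intro openin_Union) (auto intro!: openin_regular_nonzero points H0_regular[OF h])
    ultimately show ?thesis
      unfolding closedin_def topspace_zariski_on[OF points] by (auto simp: N_def)
  qed
  have zero: "\<forall>i P. h i P = 0" if h: "h \<in> H0 X L" "X = N h" for h
  proof (intro allI)
    fix i P
    show "h i P = 0"
    proof (cases "i < charts L \<and> P \<in> chart L i")
      case True
      then have "P \<in> N h" using charts_cover h(2) by blast
      then show ?thesis using True chart_indep[OF h(1)] unfolding N_def by blast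
    qed (use H0_outside[OF h(1)] in \<open>auto simp: chart_points_def\<close>)
  qed
  have "X = N f \<union> N g"
    using charts_cover fg by (auto simp: N_def)
  then have "X = N f \<or> X = N g"
    using irr closed[OF f] closed[OF g] unfolding irreducible_set_def by blast
  then show ?thesis using zero f g by blast
qed

lemma basis_in_H0: "H0_basis X L R t \<Longrightarrow> a \<le> R \<Longrightarrow> t a \<in> H0 X L"
  using sections.span_superset[of "t ` {..R}"] by (auto simp: H0_basis_def)

lemma basis_coeff_zero:
  assumes t: "H0_basis X L R t"
    and zero: "\<And>z. z \<in> chart_points L \<Longrightarrow> (\<Sum>a\<le>R. c a * coords t z a) = 0" and "a \<le> R"
  shows "c a = 0"
proof -
  have "(\<Sum>a\<le>R. c a * t a i P) = 0" for i P
  proof (cases "(i, P) \<in> chart_points L")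
    case True
    then show ?thesis using zero[OF True] by simp
  next
    case False
    then show ?thesis using H0_outside[OF basis_in_H0[OF t]] by (intro sum.neutral) simp
  qed
  with t \<open>a \<le> R\<close> show ?thesis
    unfolding H0_basis_def using independent_sections_coeff_zero[of t R c a] by blast
qed

lemma basis_form_zero:
  assumes t: "H0_basis X L R t" and A: "A \<in> forms R 1"
    and zero: "\<And>z. z \<in> chart_points L \<Longrightarrow> eval (coords t z) A = 0"
  shows "A = 0"
proof -
  have "Poly_Mapping.lookup A (Poly_Mapping.single a 1) = 0" if "a \<le> R" for a
    using basis_coeff_zero[OF t _ that, of "\<lambda>a. Poly_Mapping.lookup A (Poly_Mapping.single a 1)"]
      zero[unfolded eval_linear_form[OF A]] by blast
  then show ?thesis by (subst linear_form_eq[OF A]) simp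
qed

lemma basis_form_ex:
  assumes t: "H0_basis X L R t" and h: "h \<in> H0 X L"
  shows "\<exists>A\<in>forms R 1. \<forall>z\<in>chart_points L. eval (coords t z) A = h (fst z) (snd z)"
proof -
  obtain c where c: "\<And>i P. h i P = (\<Sum>a\<le>R. c a * t a i P)"
    using span_sections_coeffs[of t R h] t h by (auto simp: H0_basis_def)
  show ?thesis
  proof (intro bexI ballI)
    show "(\<Sum>a\<le>R. scalar (c a) * var a) \<in> forms R 1"
      by (intro forms_sum forms_smult forms_var) auto
    show "eval (coords t z) (\<Sum>a\<le>R. scalar (c a) * var a) = h (fst z) (snd z)" for z
      by (simp add: eval_sum eval_mult c)
  qed
qed

text \<open>The nonzero \<open>h\<close> is required because bases are indexed by
  \<open>{..R}\<close> and so are never empty.\<close>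

lemma basis_exists:
  assumes S: "finite S" "sections.span S = H0 X L" and h: "h \<in> H0 X L" "h \<noteq> 0"
  obtains R t where "H0_basis X L R t"
proof -
  obtain B where B: "B \<subseteq> S" "sections.independent B" "S \<subseteq> sections.span B"
    using sections.maximal_independent_subset[of S] .
  have span: "sections.span B = H0 X L"
    using B S(2) sections.span_mono[of B S] sections.span_mono[of S "sections.span B"]
    by (simp add: sections.span_span)
  have "finite B" using B(1) S(1) finite_subset by blast
  moreover have "B \<noteq> {}" using span h by auto
  ultimately obtain R where R: "card B = Suc R" by (metis card_0_eq not0_implies_Suc)
  from ex_bij_betw_nat_finite[OF \<open>finite B\<close>] obtain t where "bij_betw t {0..<card B} B" by blast
  moreover have "{0..<card B} = {..R}" by (auto simp: R)
  ultimately have "bij_betw t {..R} B" by simp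
  then have "inj_on t {..R}" "t ` {..R} = B" by (auto simp: bij_betw_def)
  with B span that[of R t] show ?thesis by (simp add: H0_basis_def)
qed

end

lemma restrict_form_add: "restrict_form L s (F + G) = restrict_form L s F + restrict_form L s G"
  by (auto simp: restrict_form_def eval_add fun_eq_iff)

text \<open>
  If the ideal were generated by quadrics of rank at most 2, that is, by products of two linear forms,
  irreducibility and nondegeneracy would force it to vanish. But \<open>f\<^sup>d\<close>, \<open>f\<^sup>d\<^sup>-\<^sup>1 g\<close>, \<open>f\<^sup>d\<^sup>-\<^sup>2 g\<^sup>2\<close> satisfy a quadratic
  relation.
\<close>

lemma QR_tensor_power_ge_3:
  fixes X :: "'k::alg_closed_field point set"
  assumes L: "variety_bundle X L" and irr: "irreducible_set X"
    and f: "f \<in> H0 X L" and g: "g \<in> H0 X L"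
    and indep: "\<And>\<alpha> \<beta>. (\<And>i P. \<alpha> * f i P = \<beta> * g i P) \<Longrightarrow> \<alpha> = 0 \<and> \<beta> = 0"
    and two: "(2::'k) \<noteq> 0" and d: "2 \<le> d" and QR: "QR X (tensor_power L d) k"
  shows "k \<ge> 3"
proof (rule ccontr)
  assume "\<not> k \<ge> 3"
  then have k: "k \<le> 2" by simp
  interpret variety_bundle X L by (rule L)
  interpret T: variety_bundle X "tensor_power L d" by (rule tensor_power_bundle)
  obtain R t where t: "H0_basis X (tensor_power L d) R t" and
    gen: "embedding_ideal X (tensor_power L d) R t = genideal (poly_ring R)
      {Q \<in> embedding_ideal X (tensor_power L d) R t. Q \<in> forms R 2 \<and> quad_rank R Q \<le> k}"
    using QR unfolding QR_def by blast
  note ideal_eq = embedding_ideal_eq[OF T.charts_cover, of R t, unfolded chart_points_tensor_power]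
  \<comment> \<open>Such a quadric is a product of two linear forms, that is, of two sections whose
    product vanishes on \<open>X\<close>. One of them is zero, and independence of the basis makes
    its linear form zero, so \<open>Q\<close> vanishes at every vector and not only on
    \<open>X\<close>.\<close>
  have zero: "eval v Q = 0" if Q: "Q \<in> embedding_ideal X (tensor_power L d) R t" "Q \<in> forms R 2" "quad_rank R Q \<le> k" for Q v
  proof -
    have "quad_rank R Q \<le> 2" using Q k by simp
    then obtain a b where ab: "\<And>v. eval v Q = (\<Sum>i\<le>R. a i * v i) * (\<Sum>i\<le>R. b i * v i)"
      using quadratic_form_rank_le_2_factors[OF Q(2) two] by blast
    let ?s = "\<lambda>c i P. \<Sum>x\<le>R. c x * t x i P"
    have "?s a i P * ?s b i P = 0" for i P
    proof (cases "(i, P) \<in> chart_points L")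
      case True
      then show ?thesis
        using eval_vanishing_ideal[OF Q(1)[unfolded ideal_eq] True] by (simp add: ab)
    next
      case False
      then have "?s a i P = 0"
        using H0_outside[OF T.basis_in_H0[OF t]] by (intro sum.neutral) simp
      then show ?thesis by simp
    qed
    moreover have "?s c \<in> H0 X (tensor_power L d)" for c
      by (rule T.sum_H0) (rule T.basis_in_H0[OF t])
    ultimately have "(\<forall>i P. ?s a i P = 0) \<or> (\<forall>i P. ?s b i P = 0)"
      by (intro T.H0_integral[OF irr])
    then have "(\<forall>i\<le>R. a i = 0) \<or> (\<forall>i\<le>R. b i = 0)"
      using T.basis_coeff_zero[OF t] by metis
    then show ?thesis by (auto simp: ab)
  qed
  have zero_ideal: "eval v G = 0" if "G \<in> embedding_ideal X (tensor_power L d) R t" for v G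
  proof -
    let ?I = "{F \<in> carrier (poly_ring R). eval v F = 0}"
    have "ideal ?I (poly_ring R)"
      unfolding ideal_poly_ring_iff
      by (auto simp: eval_add eval_mult carrier_add carrier_mult forms_carrier[OF forms_zero])
    then have "embedding_ideal X (tensor_power L d) R t \<subseteq> ?I"
      by (subst gen) (rule genideal_subset, auto simp: zero forms_carrier)
    with that show ?thesis by blast
  qed
  \<comment> \<open>With this choice \<open>x_0\<close> stands for \<open>f\<close> and
    \<open>x_1\<close> for \<open>g\<close>, so the products \<open>f ^ p * g ^ q\<close> with
    \<open>p + q = d\<close> are restrictions of binary forms.\<close>
  define s where "s a = (if a = 0 then f else g)" for a :: nat
  have s: "s a \<in> H0 X L" if "a \<le> 1" for a using f g by (simp add: s_def)
  have var: "(var 0 :: 'k mpoly) \<in> forms 1 1" "(var 1 :: 'k mpoly) \<in> forms 1 1" by (intro forms_var; simp)+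
  have power: "(var 0 :: 'k mpoly) ^ n \<in> forms 1 n" for n
  proof (induction n)
    case (Suc n)
    then show ?case using forms_mult[OF var(1) Suc] by simp
  qed (simp add: forms_one)
  have monom: "\<exists>A\<in>forms R 1. \<forall>z\<in>chart_points L. eval (coords t z) A = f (fst z) (snd z) ^ p * g (fst z) (snd z) ^ q"
    if F: "F \<in> forms 1 d" "\<And>v. eval v F = v 0 ^ p * v 1 ^ q" for F :: "'k mpoly" and p q
  proof -
    have "restrict_form L s F \<in> H0 X (tensor_power L d)"
      by (rule restrict_form_H0[OF s F(1)])
    from T.basis_form_ex[OF t this] show ?thesis
      using F(2) by (auto simp: restrict_form_def chart_points_def s_def)
  qed
  have "1 + (d - 1) = d" "1 + (1 + (d - 2)) = d" using d by auto
  then have mon: "(var 1 :: 'k mpoly) * var 0 ^ (d - 1) \<in> forms 1 d" "(var 1 :: 'k mpoly) * (var 1 * var 0 ^ (d - 2)) \<in> forms 1 d"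
    using forms_mult[OF var(2) power[of "d - 1"]] forms_mult[OF var(2) forms_mult[OF var(2) power[of "d - 2"]]]
    by (simp_all only:)
  obtain A where A: "A \<in> forms R 1" "\<And>z. z \<in> chart_points L \<Longrightarrow> eval (coords t z) A = f (fst z) (snd z) ^ d * g (fst z) (snd z) ^ 0"
    using monom[OF power[of d], of d 0] by (auto simp: eval_power)
  obtain B where B: "B \<in> forms R 1" "\<And>z. z \<in> chart_points L \<Longrightarrow> eval (coords t z) B = f (fst z) (snd z) ^ (d - 1) * g (fst z) (snd z) ^ 1"
    using monom[OF mon(1), of "d - 1" 1] by (auto simp: eval_power eval_mult)
  obtain C where C: "C \<in> forms R 1" "\<And>z. z \<in> chart_points L \<Longrightarrow> eval (coords t z) C = f (fst z) (snd z) ^ (d - 2) * g (fst z) (snd z) ^ 2"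
    using monom[OF mon(2), of "d - 2" 2] by (auto simp: eval_power eval_mult power2_eq_square)
  have "A * C - B * B \<in> forms R 2"
    using forms_mult[OF A(1) C(1)] forms_mult[OF B(1) B(1)] by (intro forms_diff) (simp_all add: numeral_2_eq_2)
  moreover have "eval (coords t z) (A * C - B * B) = 0" if "z \<in> chart_points L" for z
  proof -
    have "x ^ d * (x ^ (d - 2) * y ^ 2) = (x ^ (d - 1) * y) * (x ^ (d - 1) * y)" for x y :: 'k
    proof -
      have "x ^ d * x ^ (d - 2) = x ^ (d - 1) * x ^ (d - 1)"
        using d by (simp add: numeral_2_eq_2 flip: power_add)
      then show ?thesis by (simp add: power2_eq_square mult_ac)
    qed
    then show ?thesis using that by (simp add: eval_diff eval_mult A B C)
  qed
  ultimately have "A * C - B * B \<in> embedding_ideal X (tensor_power L d) R t"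
    unfolding ideal_eq by (rule vanishing_forms_in_ideal)
  then have AC: "eval v A * eval v C = eval v B * eval v B" for v
    using zero_ideal[of _ v] by (force simp: eval_diff eval_mult)
  define a b where "a i = Poly_Mapping.lookup A (Poly_Mapping.single i 1)"
    and "b i = Poly_Mapping.lookup B (Poly_Mapping.single i 1)" for i
  have ev: "eval v A = (\<Sum>i\<le>R. a i * v i)" "eval v B = (\<Sum>i\<le>R. b i * v i)" for v
    by (simp_all add: eval_linear_form[OF A(1)] eval_linear_form[OF B(1)] a_def b_def)
  have proportional: "a p * b q = b p * a q" if pq: "p \<le> R" "q \<le> R" for p q
  proof -
    \<comment> \<open>\<open>A\<close> vanishes at this vector by construction, so
      \<open>A * C = B * B\<close> forces \<open>B\<close> to vanish there too. This is the
      vanishing of a 2 by 2 minor of the coefficients.\<close>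
    define v where "v i = (if i = q then a p else 0) - (if i = p then a q else 0)" for i
    have "(\<Sum>i\<le>R. c i * v i) = c q * a p - c p * a q" for c
      using pq by (simp add: v_def right_diff_distrib sum_subtractf if_distrib[of "(*) _"] cong: if_cong)
    with AC[of v] show ?thesis by (simp add: ev mult.commute)
  qed
  have integral: "(\<forall>i P. x i P = 0) \<or> (\<forall>i P. y i P = 0)"
    if "x \<in> H0 X L" "y \<in> H0 X L" "\<And>i P. x i P * y i P = 0" for x y
    using that by (rule H0_integral[OF irr])
  have f_nz: "\<exists>i P. f i P \<noteq> 0" using indep[of 1 0] by auto
  have "\<exists>p\<le>R. a p \<noteq> 0"
  proof (rule ccontr)
    assume "\<not> ?thesis"
    then have "f i P = 0" for i P
      using A(2)[of "(i, P)"] H0_outside[OF f, of i P] by (cases "(i, P) \<in> chart_points L") (auto simp: ev)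
    then show False using f_nz by blast
  qed
  then obtain p where p: "p \<le> R" "a p \<noteq> 0" by blast
  have "a p * eval v B = b p * eval v A" for v
    unfolding ev sum_distrib_left using proportional[OF p(1)] by (intro sum.cong) (auto simp flip: mult.assoc)
  \<comment> \<open>\<open>B\<close> is now a multiple of \<open>A\<close>. Restricted to
    \<open>X\<close> this reads \<open>f ^ (d - 1) * (a p * g - b p * f) = 0\<close>, and
    integrality makes \<open>f\<close> and \<open>g\<close> proportional.\<close>
  then have "a p * (f i P ^ (d - 1) * g i P) = b p * f i P ^ d" if "(i, P) \<in> chart_points L" for i P
    using A(2)[OF that] B(2)[OF that] by (metis fst_conv snd_conv mult.right_neutral power_0 power_one_right)
  then have "f i P ^ (d - 1) * (a p * g i P - b p * f i P) = 0" if "(i, P) \<in> chart_points L" for i P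
    using that d by (cases d) (auto simp: algebra_simps)
  then have "f i P * (a p * g i P - b p * f i P) = 0" for i P
    using H0_outside[OF f, of i P] by (cases "(i, P) \<in> chart_points L") auto
  moreover have "(\<lambda>i P. a p * g i P - b p * f i P) \<in> H0 X L"
  proof -
    have "(\<lambda>i P. a p * g i P) - (\<lambda>i P. b p * f i P) \<in> H0 X L"
      by (intro sections.subspace_diff[OF subspace_H0] sections.subspace_scale[OF subspace_H0] f g)
    then show ?thesis by (simp add: fun_diff_def)
  qed
  ultimately have "(\<forall>i P. f i P = 0) \<or> (\<forall>i P. a p * g i P - b p * f i P = 0)"
    using f by (intro integral)
  then have "b p * f i P = a p * g i P" for i P using f_nz by auto
  from indep[OF this] p(2) show False by blast
qed

text \<open>Normality makes restriction of forms of degree \<open>d\<close> onto \<open>H0\<close>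
  surjective. This yields finite dimension, hence a basis, and represents each basis section by a
  form; expanding sections in the basis gives the lifts in the other direction.\<close>

lemma QR_3_tensor_power:
  fixes X :: "'k::field point set"
  assumes L: "variety_bundle X L" and s: "\<And>a. a \<le> r \<Longrightarrow> s a \<in> H0 X L"
    and normal: "j_normal X L r s d"
    and gen: "generated_in_degree_le r (embedding_ideal X L r s) n"
    and "n \<le> d" "3 \<le> d" "(3::'k) = 0"
    and h: "h \<in> H0 X (tensor_power L d)" "h \<noteq> 0"
  shows "QR X (tensor_power L d) 3"
proof -
  interpret variety_bundle X L by (rule L)
  interpret T: variety_bundle X "tensor_power L d" by (rule tensor_power_bundle)
  have H0_eq: "H0 X (tensor_power L d) = restrict_form L s ` forms r d"
    using normal restrict_form_H0[OF s] by (auto simp: j_normal_def)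
  let ?S = "(\<lambda>m. restrict_form L s (Poly_Mapping.single m 1)) ` monomials r d"
  have "restrict_form L s F \<in> sections.span ?S" if "F \<in> forms r d" for F
    using that
  proof (induction F rule: forms_induct)
    case zero
    have "restrict_form L s 0 = 0" by (auto simp: restrict_form_def fun_eq_iff)
    then show ?case by (simp only: sections.span_zero)
  next
    case (single m c)
    have "restrict_form L s (Poly_Mapping.single m c) =
        (\<lambda>i P. c * restrict_form L s (Poly_Mapping.single m 1) i P)"
      by (auto simp: restrict_form_def eval_single fun_eq_iff)
    moreover have "(\<lambda>i P. c * restrict_form L s (Poly_Mapping.single m 1) i P) \<in> sections.span ?S"
      by (rule sections.span_scale, rule sections.span_base, rule imageI, rule single)
    ultimately show ?case by (simp only:)
  next
    case (add F G)
    then show ?case by (simp only: restrict_form_add sections.span_add)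
  qed
  then have "H0 X (tensor_power L d) \<subseteq> sections.span ?S" by (auto simp: H0_eq)
  moreover have "?S \<subseteq> H0 X (tensor_power L d)" by (auto simp: H0_eq forms_single)
  ultimately have "sections.span ?S = H0 X (tensor_power L d)"
    by (intro sections.span_subspace T.subspace_H0)
  with T.basis_exists[of ?S h] h obtain R t where t: "H0_basis X (tensor_power L d) R t"
    by (auto simp: finite_monomials)
  have coord: "\<exists>F\<in>forms r d. \<forall>z\<in>chart_points L. eval (coords s z) F = coords t z a" if a: "a \<le> R" for a
  proof -
    obtain F where "F \<in> forms r d" "t a = restrict_form L s F"
      using T.basis_in_H0[OF t a] by (auto simp: H0_eq)
    then show ?thesis by (intro bexI[of _ F]) (auto simp: restrict_form_def chart_points_def)
  qed
  interpret V: veronese_reembedding "chart_points L" "coords s" "coords t" r R d n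
  proof
    show "chart_points L \<noteq> {}"
    proof
      assume "chart_points L = {}"
      then have "h = 0" using H0_outside[OF h(1)] by (auto simp: fun_eq_iff)
      with h(2) show False ..
    qed
    show "A = 0" if "A \<in> forms R 1" "\<And>z. z \<in> chart_points L \<Longrightarrow> eval (coords t z) A = 0" for A
      using T.basis_form_zero[OF t that(1)] that(2) by simp
    show "\<exists>A\<in>forms R 1. \<forall>z\<in>chart_points L. eval (coords t z) A = eval (coords s z) F" if "F \<in> forms r d" for F
    proof -
      have "restrict_form L s F \<in> H0 X (tensor_power L d)" using that by (simp add: H0_eq)
      from T.basis_form_ex[OF t this] show ?thesis
        by (auto simp: restrict_form_def chart_points_def)
    qed
    show "vanishing_ideal r (chart_points L) (coords s) =
        genideal (poly_ring r) {F \<in> vanishing_ideal r (chart_points L) (coords s). \<exists>e\<le>n. F \<in> forms r e}"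
      using gen unfolding generated_in_degree_le_def embedding_ideal_eq[OF charts_cover] .
  qed (use assms coord in auto)
  have eq: "embedding_ideal X (tensor_power L d) R t = vanishing_ideal R (chart_points L) (coords t)"
    using embedding_ideal_eq[OF T.charts_cover] by simp
  have "embedding_ideal X (tensor_power L d) R t = genideal (poly_ring R)
      {Q \<in> embedding_ideal X (tensor_power L d) R t. Q \<in> forms R 2 \<and> quad_rank R Q \<le> 3}"
    unfolding eq by (rule V.vanishing_ideal_generated_by_quadrics_rank_le_3[unfolded V.quadrics_rank_le_3_def])
  with t show ?thesis unfolding QR_def by blast
qed

theorem rank_index_tensor_power:
  fixes X :: "'k::alg_closed_field point set"
  assumes L: "variety_bundle X L" and irr: "irreducible_set X" and s: "\<And>a. a \<le> r \<Longrightarrow> s a \<in> H0 X L"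
    and normal: "j_normal X L r s d"
    and gen: "generated_in_degree_le r (embedding_ideal X L r s) n"
    and d: "n \<le> d" "3 \<le> d" and three: "(3::'k) = 0"
    and f: "f \<in> H0 X L" and g: "g \<in> H0 X L"
    and indep: "\<And>\<alpha> \<beta>. (\<And>i P. \<alpha> * f i P = \<beta> * g i P) \<Longrightarrow> \<alpha> = 0 \<and> \<beta> = 0"
  shows "rank_index X (tensor_power L d) = 3"
proof -
  interpret variety_bundle X L by (rule L)
  have two: "(2::'k) \<noteq> 0" by (rule two_neq_zero_char3[OF three])
  have "(var 0 :: 'k mpoly) ^ d \<in> forms 0 d"
  proof (induction d)
    case (Suc d)
    then show ?case using forms_mult[OF forms_var[of 0 0] Suc] by simp
  qed (simp add: forms_one)
  \<comment> \<open>The nonzero section of the power is \<open>f ^ d\<close>, written as the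
    restriction of a form in one variable.\<close>
  then have "restrict_form L (\<lambda>_. f) (var 0 ^ d) \<in> H0 X (tensor_power L d)"
    using f by (intro restrict_form_H0[where r = 0]) auto
  moreover have "restrict_form L (\<lambda>_. f) (var 0 ^ d) \<noteq> 0"
  proof
    assume zero: "restrict_form L (\<lambda>_. f) (var 0 ^ d) = 0"
    have "f i P = 0" for i P
    proof (cases "(i, P) \<in> chart_points L")
      case True
      with fun_cong[OF fun_cong[OF zero, of i], of P] show ?thesis
        by (auto simp: restrict_form_def chart_points_def eval_power)
    qed (use H0_outside[OF f] in auto)
    then show False using indep[of 1 0] by auto
  qed
  ultimately have "QR X (tensor_power L d) 3"
    using QR_3_tensor_power[OF L _ normal gen d three] s by blast
  then have "rank_index X (tensor_power L d) \<le> enat 3"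
    unfolding rank_index_def by (intro INF_lower) auto
  moreover have "2 \<le> d" using d by simp
  then have "enat 3 \<le> rank_index X (tensor_power L d)"
    unfolding rank_index_def
    using QR_tensor_power_ge_3[OF L irr f g indep two] by (intro INF_greatest) auto
  ultimately show ?thesis by (simp add: numeral_eq_enat)
qed

section \<open>Locally rational functions\<close>

text \<open>Over a finite field the product of all \<open>x - a\<close>, increased by 1, would have
  no root.\<close>

lemma infinite_alg_closed: "infinite (UNIV :: 'k::alg_closed_field set)"
proof
  assume fin: "finite (UNIV :: 'k set)"
  define p where "p = (\<Prod>a\<in>(UNIV :: 'k set). [:- a, 1:]) + 1"
  have "degree (\<Prod>a\<in>(UNIV :: 'k set). [:- a, 1:]) = card (UNIV :: 'k set)"
    by (subst degree_prod_eq_sum_degree) auto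
  moreover have "card (UNIV :: 'k set) > 0" using fin by (simp add: card_gt_0_iff)
  ultimately have "degree p > 0"
    unfolding p_def by (subst degree_add_eq_left) auto
  then obtain x where "poly p x = 0" using alg_closed_imp_poly_has_root by blast
  moreover have "(\<Prod>a\<in>UNIV. poly [:- a, 1:] x) = 0"
    using fin by (intro prod_zero) (auto intro!: bexI[of _ x])
  then have "poly p x = 1" by (simp add: p_def poly_prod)
  ultimately show False by simp
qed

lemma poly_eqI_infinite:
  fixes p q :: "'k::{comm_ring_1,ring_no_zero_divisors} poly"
  assumes "infinite A" "\<And>x. x \<in> A \<Longrightarrow> poly p x = poly q x"
  shows "p = q"
proof (rule ccontr)
  assume "p \<noteq> q"
  then have "finite {x. poly (p - q) x = 0}" by (intro poly_roots_finite) simp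
  moreover have "A \<subseteq> {x. poly (p - q) x = 0}" using assms(2) by auto
  ultimately show False using assms(1) finite_subset by blast
qed

lemma infinite_nonzero: "infinite (UNIV - {0 :: 'k::alg_closed_field})"
  using infinite_alg_closed by simp

text \<open>
  The polynomials \<open>q\<close> such that \<open>g q\<close> is a polynomial form an ideal of \<open>K[t]\<close>; having no common zero, it
  contains a nonzero constant.
\<close>

lemma locally_rational_imp_poly:
  fixes g :: "'k::alg_closed_field \<Rightarrow> 'k"
  assumes local: "\<And>x. \<exists>p q. poly q x \<noteq> 0 \<and> (\<forall>t. poly q t \<noteq> 0 \<longrightarrow> g t = poly p t / poly q t)"
  obtains p where "\<And>t. g t = poly p t"
proof -
  define D where "D = {q. \<exists>p. \<forall>t. g t * poly q t = poly p t}"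
  have D_local: "\<exists>q\<in>D. poly q x \<noteq> 0" for x
  proof -
    obtain p q where q: "poly q x \<noteq> 0" and pq: "\<And>t. poly q t \<noteq> 0 \<Longrightarrow> g t = poly p t / poly q t"
      using local by blast
    have "g t * poly (q * q) t = poly (p * q) t" for t
      by (cases "poly q t = 0") (simp_all add: pq)
    then have "q * q \<in> D" unfolding D_def by blast
    then show ?thesis using q by (intro bexI[of _ "q * q"]) auto
  qed
  then have "\<exists>q. q \<in> D \<and> q \<noteq> 0" by (metis poly_0)
  then obtain q where q: "q \<in> D" "q \<noteq> 0" and min: "\<And>q'. q' \<in> D \<Longrightarrow> q' \<noteq> 0 \<Longrightarrow> degree q \<le> degree q'"
    using ex_has_least_nat[of "\<lambda>q. q \<in> D \<and> q \<noteq> 0" _ degree] by blast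
  obtain p where p: "\<And>t. g t * poly q t = poly p t" using q(1) by (auto simp: D_def)
  have "degree q = 0"
  proof (rule ccontr)
    assume "degree q \<noteq> 0"
    then obtain x where x: "poly q x = 0" using alg_closed_imp_poly_has_root by blast
    obtain q' where q': "q' \<in> D" "poly q' x \<noteq> 0" using D_local by blast
    then obtain p' where p': "\<And>t. g t * poly q' t = poly p' t" by (auto simp: D_def)
    \<comment> \<open>The remainder of \<open>q'\<close> stays in \<open>D\<close> and is nonzero,
      since \<open>q\<close> vanishes at \<open>x\<close> and \<open>q'\<close> does not. This
      contradicts minimality of the degree.\<close>
    have mod: "q' mod q = q' - (q' div q) * q" by (simp add: minus_div_mult_eq_mod)
    have "g t * poly (q' mod q) t = poly (p' - (q' div q) * p) t" for t
      unfolding mod by (simp add: right_diff_distrib p' mult.left_commute[of "g t"] p)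
    then have "q' mod q \<in> D" unfolding D_def by blast
    moreover have "q' mod q \<noteq> 0"
    proof
      assume "q' mod q = 0"
      then have "q' = (q' div q) * q" using mod by simp
      then have "poly q' x = 0" using x by (metis mult_zero_right poly_mult)
      with q'(2) show False ..
    qed
    moreover have "degree (q' mod q) < degree q"
      using degree_mod_less[OF q(2)] calculation(2) by blast
    ultimately show False using min by (metis leD)
  qed
  then obtain c where c: "q = [:c:]" by (metis degree_eq_zeroE)
  with q(2) have "c \<noteq> 0" by auto
  with p c have "g t = poly (Polynomial.smult (1 / c) p) t" for t by (simp add: field_simps flip: p)
  then show ?thesis by (rule that)
qed

section \<open>From one parameter to several variables\<close>

lemma eval_line_poly:
  fixes F :: "'k::comm_ring_1 mpoly"
  shows "\<exists>p. \<forall>t. poly p t = eval (\<lambda>i. u i + t * w i) F"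
proof (induction F rule: mpoly_induct)
  case (single m c)
  show ?case
    by (rule exI[of _ "Polynomial.smult c (\<Prod>i\<in>Poly_Mapping.keys m. [:u i, w i:] ^ Poly_Mapping.lookup m i)"])
       (simp add: eval_single poly_prod)
next
  case (add F G)
  then obtain p q where "\<forall>t. poly p t = eval (\<lambda>i. u i + t * w i) F" "\<forall>t. poly q t = eval (\<lambda>i. u i + t * w i) G"
    by blast
  then show ?case by (intro exI[of _ "p + q"]) (simp add: eval_add)
qed

lemma carrier_sum: "(\<And>i. i \<in> A \<Longrightarrow> f i \<in> carrier (poly_ring r)) \<Longrightarrow> sum f A \<in> carrier (poly_ring r)"
  by (induction A rule: infinite_finite_induct) (auto simp: carrier_add forms_carrier[OF forms_zero])

lemma carrier_prod: "(\<And>i. i \<in> A \<Longrightarrow> f i \<in> carrier (poly_ring r)) \<Longrightarrow> prod f A \<in> carrier (poly_ring r)"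
  by (induction A rule: infinite_finite_induct) (auto simp: carrier_mult forms_carrier[OF forms_one])

lemma lagrange_interpolation:
  fixes p :: "'k::field poly"
  assumes "inj_on a {..d}" "degree p \<le> d"
  shows "poly p t = (\<Sum>j\<le>d. poly p (a j) * (\<Prod>i\<in>{..d} - {j}. (t - a i) / (a j - a i)))"
proof -
  define l where "l j = Polynomial.smult (\<Prod>i\<in>{..d} - {j}. 1 / (a j - a i)) (\<Prod>i\<in>{..d} - {j}. [:- a i, 1:])" for j
  define q where "q = (\<Sum>j\<le>d. Polynomial.smult (poly p (a j)) (l j))"
  have l: "poly (l j) t = (\<Prod>i\<in>{..d} - {j}. (t - a i) / (a j - a i))" for j t
    by (simp add: l_def poly_prod prod_dividef)
  have l_node: "poly (l j) (a k) = (if k = j then 1 else 0)" if "j \<le> d" "k \<le> d" for j k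
  proof (cases "k = j")
    case True
    have "a j \<noteq> a i" if "i \<in> {..d} - {j}" for i
      using assms(1) \<open>j \<le> d\<close> that by (auto dest: inj_onD)
    then have "(a j - a i) / (a j - a i) = 1" if "i \<in> {..d} - {j}" for i using that by simp
    then show ?thesis using True by (simp add: l)
  next
    case False
    with that have "(\<Prod>i\<in>{..d} - {j}. (a k - a i) / (a j - a i)) = 0"
      by (intro prod_zero) (auto intro!: bexI[of _ k])
    then show ?thesis using False by (simp add: l)
  qed
  have "degree (l j) \<le> d" if "j \<le> d" for j
  proof -
    have "degree (\<Prod>i\<in>{..d} - {j}. [:- a i, 1:]) \<le> (\<Sum>i\<in>{..d} - {j}. degree [:- a i, 1:])"
      by (rule degree_prod_sum_le[unfolded o_def]) simp
    also have "\<dots> = d" using that by simp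
    finally show ?thesis unfolding l_def by (meson degree_smult_le order.trans)
  qed
  then have "degree q \<le> d"
    unfolding q_def by (intro degree_sum_le) (auto intro: order.trans[OF degree_smult_le])
  have "p = q"
  proof (rule poly_eqI_degree[where A = "a ` {..d}"])
    show "poly p x = poly q x" if x: "x \<in> a ` {..d}" for x
    proof -
      from x obtain k where k: "k \<le> d" "x = a k" by auto
      have "poly q x = (\<Sum>j\<le>d. if j = k then poly p (a j) else 0)"
        unfolding q_def poly_sum by (intro sum.cong) (auto simp: l_node k)
      then show ?thesis using k by simp
    qed
  qed (use assms \<open>degree q \<le> d\<close> in \<open>auto simp: card_image\<close>)
  then have "poly p t = poly q t" by simp
  then show ?thesis by (simp add: q_def poly_sum l)
qed

definition vectors :: "nat \<Rightarrow> (nat \<Rightarrow> 'k::zero) set" where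
  "vectors n = {v. \<forall>i>n. v i = 0}"

text \<open>The uniform bound \<open>d\<close> allows \<open>d + 1\<close> nodes to be fixed in
  advance. Interpolating at them frees one coordinate at a time, the remaining coordinates being
  frozen at those of \<open>u\<close>.\<close>

lemma separately_polynomial_imp_polynomial:
  fixes h :: "(nat \<Rightarrow> 'k::alg_closed_field) \<Rightarrow> 'k"
  assumes sep: "\<And>u k. u \<in> vectors n \<Longrightarrow> k \<le> n \<Longrightarrow> \<exists>p. degree p \<le> d \<and> (\<forall>t. h (u(k := t)) = poly p t)"
  obtains F where "F \<in> carrier (poly_ring n)" "\<And>v. v \<in> vectors n \<Longrightarrow> h v = eval v F"
proof -
  obtain A :: "'k set" where "finite A" "card A = Suc d"
    using infinite_arbitrarily_large[OF infinite_alg_closed] by blast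
  then obtain a where "bij_betw a {0..<Suc d} A" using ex_bij_betw_nat_finite by metis
  then have a: "inj_on a {..d}" by (simp add: bij_betw_def atLeast0LessThan lessThan_Suc_atMost)
  have "\<forall>u\<in>vectors n. \<exists>F. (\<forall>m\<in>Poly_Mapping.keys F. Poly_Mapping.keys m \<subseteq> {..<k}) \<and>
      (\<forall>v\<in>vectors n. (\<forall>i\<ge>k. v i = u i) \<longrightarrow> h v = eval v F)" if "k \<le> Suc n" for k
    using that
  proof (induction k)
    case 0
    show ?case
    proof
      fix u :: "nat \<Rightarrow> 'k"
      have const: "h v = h u" if "\<forall>i\<ge>0. v i = u i" for v
      proof -
        have "v = u" using that by auto
        then show ?thesis by simp
      qed
      show "\<exists>F. (\<forall>m\<in>Poly_Mapping.keys F. Poly_Mapping.keys m \<subseteq> {..<0}) \<and>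
          (\<forall>v\<in>vectors n. (\<forall>i\<ge>0. v i = u i) \<longrightarrow> h v = eval v F)"
      proof (intro exI conjI ballI impI)
        show "Poly_Mapping.keys m \<subseteq> {..<0}" if "m \<in> Poly_Mapping.keys (scalar (h u))" for m
          using that by (auto split: if_splits)
        show "h v = eval v (scalar (h u))" if "\<forall>i\<ge>0. v i = u i" for v
          unfolding eval_scalar using that by (rule const)
      qed
    qed
  next
    case (Suc k)
    then have k: "k \<le> n" by simp
    show ?case
    proof
      fix u :: "nat \<Rightarrow> 'k" assume u: "u \<in> vectors n"
      have "\<forall>j. \<exists>F. (\<forall>m\<in>Poly_Mapping.keys F. Poly_Mapping.keys m \<subseteq> {..<k}) \<and>
          (\<forall>v\<in>vectors n. (\<forall>i\<ge>k. v i = (u(k := a j)) i) \<longrightarrow> h v = eval v F)"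
      proof
        fix j
        have "u(k := a j) \<in> vectors n" using u k by (auto simp: vectors_def)
        then show "\<exists>F. (\<forall>m\<in>Poly_Mapping.keys F. Poly_Mapping.keys m \<subseteq> {..<k}) \<and>
          (\<forall>v\<in>vectors n. (\<forall>i\<ge>k. v i = (u(k := a j)) i) \<longrightarrow> h v = eval v F)"
          using Suc.IH[OF le_SucI[OF k]] by (rule bspec[rotated])
      qed
      from choice[OF this] obtain F where F: "\<And>j m. m \<in> Poly_Mapping.keys (F j) \<Longrightarrow> Poly_Mapping.keys m \<subseteq> {..<k}"
        "\<And>j v. v \<in> vectors n \<Longrightarrow> (\<forall>i\<ge>k. v i = (u(k := a j)) i) \<Longrightarrow> h v = eval v (F j)" by blast
      \<comment> \<open>The Lagrange basis polynomials for the nodes \<open>a j\<close>, in the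
        variable with index \<open>k\<close>.\<close>
      define N :: "nat \<Rightarrow> 'k mpoly" where
        "N j = (\<Prod>i\<in>{..d} - {j}. scalar (1 / (a j - a i)) * (var k - scalar (a i)))" for j
      have eval_N: "eval v (N j) = (\<Prod>i\<in>{..d} - {j}. (v k - a i) / (a j - a i))" for v j
        unfolding N_def eval_prod by (intro prod.cong refl) (simp add: eval_mult eval_diff)
      have N_carrier: "N j \<in> carrier (poly_ring k)" for j
        unfolding N_def diff_conv_add_uminus
        by (intro carrier_prod carrier_mult carrier_add carrier_uminus scalar_in_carrier
            forms_carrier[OF forms_var]) simp
      have F_carrier: "F j \<in> carrier (poly_ring k)" for j
        using F(1) by (fastforce simp: carrier_iff)
      let ?G = "\<Sum>j\<le>d. F j * N j"
      have "?G \<in> carrier (poly_ring k)"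
        by (intro carrier_sum carrier_mult F_carrier N_carrier)
      moreover have "h v = eval v ?G" if v: "v \<in> vectors n" "\<forall>i\<ge>Suc k. v i = u i" for v
      proof -
        obtain p where p: "degree p \<le> d" "\<And>t. h (v(k := t)) = poly p t"
          using sep[OF v(1) k] by blast
        have "h v = poly p (v k)" using p(2)[of "v k"] by simp
        also have "\<dots> = (\<Sum>j\<le>d. h (v(k := a j)) * eval v (N j))"
          unfolding eval_N p(2) by (rule lagrange_interpolation[OF a p(1)])
        also have "\<dots> = (\<Sum>j\<le>d. eval v (F j) * eval v (N j))"
        proof (intro sum.cong refl arg_cong2[where f = "(*)"])
          fix j
          have "h (v(k := a j)) = eval (v(k := a j)) (F j)"
            using v k by (intro F(2)) (auto simp: vectors_def)
          also have "\<dots> = eval v (F j)"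
            using F(1) by (intro eval_cong_keys) fastforce
          finally show "h (v(k := a j)) = eval v (F j)" .
        qed
        also have "\<dots> = eval v ?G" by (simp add: eval_sum eval_mult)
        finally show ?thesis .
      qed
      ultimately show "\<exists>F. (\<forall>m\<in>Poly_Mapping.keys F. Poly_Mapping.keys m \<subseteq> {..<Suc k}) \<and>
          (\<forall>v\<in>vectors n. (\<forall>i\<ge>Suc k. v i = u i) \<longrightarrow> h v = eval v F)"
        by (intro exI[of _ ?G]) (simp add: carrier_iff lessThan_Suc_atMost)
    qed
  qed
  from this[of "Suc n"] have all: "\<forall>u\<in>vectors n. \<exists>F. F \<in> carrier (poly_ring n) \<and>
      (\<forall>v\<in>vectors n. (\<forall>i\<ge>Suc n. v i = u i) \<longrightarrow> h v = eval v F)"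
    by (simp add: carrier_iff lessThan_Suc_atMost)
  have "(\<lambda>_. 0) \<in> vectors n" by (simp add: vectors_def)
  from bspec[OF all this] obtain F where F: "F \<in> carrier (poly_ring n)"
      "\<forall>v\<in>vectors n. (\<forall>i\<ge>Suc n. v i = 0) \<longrightarrow> h v = eval v F" by (elim exE conjE)
  have "h v = eval v F" if "v \<in> vectors n" for v
    using bspec[OF F(2) that] that by (simp add: vectors_def Suc_le_eq)
  with F(1) show ?thesis by (rule that)
qed

text \<open>For fixed \<open>v\<close>, both sides of the homogeneity equation are polynomials in
  \<open>c\<close>. Over an infinite field their coefficients at \<open>c ^ d\<close> agree, so the
  degree \<open>d\<close> part of \<open>F\<close> already represents \<open>h\<close>.\<close>

lemma homogeneous_component:
  fixes h :: "(nat \<Rightarrow> 'k::alg_closed_field) \<Rightarrow> 'k"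
  assumes F: "F \<in> carrier (poly_ring n)" "\<And>v. v \<in> vectors n \<Longrightarrow> h v = eval v F"
    and hom: "\<And>c v. v \<in> vectors n \<Longrightarrow> h (\<lambda>i. c * v i) = c ^ d * h v"
  obtains G where "G \<in> forms n d" "\<And>v. v \<in> vectors n \<Longrightarrow> h v = eval v G"
proof -
  define G where "G = (\<Sum>m\<in>{m \<in> Poly_Mapping.keys F. total_deg m = d}. Poly_Mapping.single m (Poly_Mapping.lookup F m))"
  have "G \<in> forms n d"
    unfolding G_def using F(1) by (intro forms_sum forms_single) (auto simp: carrier_iff monomials_def)
  moreover have "h v = eval v G" if v: "v \<in> vectors n" for v
  proof -
    define val where "val m = Poly_Mapping.lookup F m * (\<Prod>i\<in>Poly_Mapping.keys m. v i ^ Poly_Mapping.lookup m i)" for m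
    have "poly (\<Sum>m\<in>Poly_Mapping.keys F. monom (val m) (total_deg m)) c = poly (monom (h v) d) c" for c
    proof -
      have "eval (\<lambda>i. c * v i) (Poly_Mapping.single m (Poly_Mapping.lookup F m)) = val m * c ^ total_deg m" for m
        by (subst eval_homogeneous_scale[of "total_deg m"])
           (auto simp: homogeneous_def eval_single val_def)
      then have "poly (\<Sum>m\<in>Poly_Mapping.keys F. monom (val m) (total_deg m)) c
          = eval (\<lambda>i. c * v i) (\<Sum>m\<in>Poly_Mapping.keys F. Poly_Mapping.single m (Poly_Mapping.lookup F m))"
        by (simp add: eval_sum poly_sum poly_monom)
      also have "\<dots> = h (\<lambda>i. c * v i)"
        using v by (subst F(2)) (auto simp: vectors_def simp flip: poly_mapping_sum_singles)
      finally show ?thesis by (simp add: hom[OF v] poly_monom mult.commute)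
    qed
    then have "(\<Sum>m\<in>Poly_Mapping.keys F. monom (val m) (total_deg m)) = monom (h v) d"
      by (intro poly_eqI_infinite[OF infinite_alg_closed])
    then have "poly.coeff (\<Sum>m\<in>Poly_Mapping.keys F. monom (val m) (total_deg m)) d = h v" by simp
    then have "h v = (\<Sum>m\<in>Poly_Mapping.keys F. if total_deg m = d then val m else 0)"
      by (simp add: coeff_sum)
    also have "\<dots> = eval v G"
      by (simp add: G_def eval_sum eval_single val_def sum.inter_filter if_distrib[of "eval v"] cong: if_cong)
    finally show ?thesis .
  qed
  ultimately show ?thesis by (rule that)
qed

lemma digits_unique:
  fixes x y :: "nat \<Rightarrow> nat"
  assumes "\<And>i. i \<le> n \<Longrightarrow> x i < b" "\<And>i. i \<le> n \<Longrightarrow> y i < b" "(\<Sum>i\<le>n. x i * b ^ i) = (\<Sum>i\<le>n. y i * b ^ i)" "i \<le> n"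
  shows "x i = y i"
  using assms
proof (induction n arbitrary: x y i)
  case 0
  then show ?case by simp
next
  case (Suc n)
  have split: "(\<Sum>i\<le>Suc n. z i * b ^ i) = z 0 + b * (\<Sum>i\<le>n. z (Suc i) * b ^ i)" for z :: "nat \<Rightarrow> nat"
    by (simp only: sum.atMost_Suc_shift) (simp add: sum_distrib_left mult_ac)
  have b: "x 0 < b" "y 0 < b" using Suc.prems by auto
  have eq: "x 0 + b * (\<Sum>i\<le>n. x (Suc i) * b ^ i) = y 0 + b * (\<Sum>i\<le>n. y (Suc i) * b ^ i)"
    using Suc.prems(3) unfolding split .
  from arg_cong[OF eq, of "\<lambda>z. z mod b"] b have x0: "x 0 = y 0" by simp
  with eq b have "(\<Sum>i\<le>n. x (Suc i) * b ^ i) = (\<Sum>i\<le>n. y (Suc i) * b ^ i)" by simp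
  with Suc.IH[of "\<lambda>i. x (Suc i)" "\<lambda>i. y (Suc i)"] Suc.prems(1,2)
  have "x (Suc j) = y (Suc j)" if "j \<le> n" for j using that by simp
  with x0 Suc.prems(4) show ?case by (cases i) auto
qed

text \<open>Kronecker substitution \<open>x\<^sub>i \<mapsto> t^(b^i)\<close> with \<open>b\<close> larger than all exponents.\<close>

lemma eval_zero_imp_zero:
  fixes F :: "'k::alg_closed_field mpoly"
  assumes F: "F \<in> carrier (poly_ring n)" and zero: "\<And>v. v \<in> vectors n \<Longrightarrow> eval v F = 0"
  shows "F = 0"
proof -
  define E where "E = (\<Union>m\<in>Poly_Mapping.keys F. Poly_Mapping.lookup m ` {..n})"
  \<comment> \<open>Inserting 0 keeps the maximum defined when \<open>F\<close> has no
    monomials.\<close>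
  define b where "b = Suc (Max (insert 0 E))"
  have "finite E" by (simp add: E_def)
  then have b: "Poly_Mapping.lookup m i < b" if "m \<in> Poly_Mapping.keys F" "i \<le> n" for m i
    using that unfolding b_def less_Suc_eq_le by (intro Max_ge) (auto simp: E_def)
  define code where "code m = (\<Sum>i\<le>n. Poly_Mapping.lookup m i * b ^ i)" for m :: "nat \<Rightarrow>\<^sub>0 nat"
  have inj: "m = m'" if "m \<in> Poly_Mapping.keys F" "m' \<in> Poly_Mapping.keys F" "code m = code m'" for m m'
  proof (rule poly_mapping_eqI)
    fix i
    show "Poly_Mapping.lookup m i = Poly_Mapping.lookup m' i"
    proof (cases "i \<le> n")
      case True
      show ?thesis
        by (rule digits_unique[OF _ _ _ True, where b = b]) (use that b in \<open>auto simp: code_def\<close>)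
    next
      case False
      then have "i \<notin> Poly_Mapping.keys m" "i \<notin> Poly_Mapping.keys m'"
        using F that by (auto simp: carrier_iff)
      then show ?thesis by (simp add: in_keys_iff)
    qed
  qed
  let ?p = "\<Sum>m\<in>Poly_Mapping.keys F. monom (Poly_Mapping.lookup F m) (code m)"
  have "poly ?p t = poly 0 t" for t
  proof -
    define v where "v i = (if i \<le> n then t ^ (b ^ i) else 0)" for i
    have "(\<Prod>i\<in>Poly_Mapping.keys m. v i ^ Poly_Mapping.lookup m i) = t ^ code m" if "m \<in> Poly_Mapping.keys F" for m
    proof -
      have "Poly_Mapping.keys m \<subseteq> {..n}" using F that by (auto simp: carrier_iff)
      then have "(\<Prod>i\<in>Poly_Mapping.keys m. v i ^ Poly_Mapping.lookup m i) = (\<Prod>i\<le>n. v i ^ Poly_Mapping.lookup m i)"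
        by (intro prod.mono_neutral_left) (auto simp: in_keys_iff)
      also have "\<dots> = (\<Prod>i\<le>n. t ^ (Poly_Mapping.lookup m i * b ^ i))"
        by (intro prod.cong) (auto simp: v_def mult.commute simp flip: power_mult)
      finally show ?thesis by (simp add: code_def power_sum)
    qed
    then have "poly ?p t = eval v F"
      by (simp add: eval_def poly_sum poly_monom)
    also have "\<dots> = 0" by (rule zero) (simp add: v_def vectors_def)
    finally show ?thesis by simp
  qed
  then have p0: "?p = 0" by (intro poly_eqI_infinite[OF infinite_alg_closed])
  show ?thesis
  proof (rule poly_mapping_eqI, rule ccontr)
    fix m assume m: "Poly_Mapping.lookup F m \<noteq> Poly_Mapping.lookup 0 m"
    then have key: "m \<in> Poly_Mapping.keys F" by (simp add: in_keys_iff)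
    have "poly.coeff ?p (code m) = (\<Sum>m'\<in>Poly_Mapping.keys F. if m' = m then Poly_Mapping.lookup F m' else 0)"
      unfolding coeff_sum coeff_monom by (intro sum.cong) (use inj key in auto)
    also have "\<dots> = Poly_Mapping.lookup F m" using key by simp
    finally show False using m p0 by simp
  qed
qed

section \<open>Projective space\<close>

text \<open>On a line missing the origin \<open>h\<close> is locally rational in one parameter,
  hence a polynomial; homogeneity bounds its degree along coordinate directions. On a coordinate
  axis itself \<open>h\<close> is a monomial by homogeneity. Thus \<open>h\<close> is polynomial of
  bounded degree in each coordinate.\<close>

lemma locally_rational_homogeneous_imp_form:
  fixes h :: "(nat \<Rightarrow> 'k::alg_closed_field) \<Rightarrow> 'k"
  assumes hom: "\<And>c v. v \<in> vectors n \<Longrightarrow> h (\<lambda>i. c * v i) = c ^ d * h v"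
    and local: "\<And>v. v \<in> vectors n \<Longrightarrow> v \<noteq> (\<lambda>_. 0) \<Longrightarrow> \<exists>F G. eval v G \<noteq> 0 \<and>
      (\<forall>w\<in>vectors n. eval w G \<noteq> 0 \<longrightarrow> h w = eval w F / eval w G)"
  obtains G where "G \<in> forms n d" "\<And>v. v \<in> vectors n \<Longrightarrow> h v = eval v G"
proof -
  have line: "\<exists>p. \<forall>t. h (\<lambda>i. u i + t * w i) = poly p t"
    if uw: "u \<in> vectors n" "w \<in> vectors n" and nz: "\<And>t. (\<lambda>i. u i + t * w i) \<noteq> (\<lambda>_. 0)" for u w
  proof -
    have vec: "(\<lambda>i. u i + t * w i) \<in> vectors n" for t using uw by (simp add: vectors_def)
    have "\<exists>p q. poly q x \<noteq> 0 \<and> (\<forall>t. poly q t \<noteq> 0 \<longrightarrow> h (\<lambda>i. u i + t * w i) = poly p t / poly q t)" for x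
    proof -
      obtain F G where G: "eval (\<lambda>i. u i + x * w i) G \<noteq> 0"
        and FG: "\<And>w. w \<in> vectors n \<Longrightarrow> eval w G \<noteq> 0 \<Longrightarrow> h w = eval w F / eval w G"
        using local[OF vec[of x] nz] by blast
      obtain p where p: "\<forall>t. poly p t = eval (\<lambda>i. u i + t * w i) F"
        using eval_line_poly[of u w F] by blast
      obtain q where q: "\<forall>t. poly q t = eval (\<lambda>i. u i + t * w i) G"
        using eval_line_poly[of u w G] by blast
      show ?thesis
        by (intro exI[of _ p] exI[of _ q]) (use G FG[OF vec] p q in auto)
    qed
    from locally_rational_imp_poly[of "\<lambda>t. h (\<lambda>i. u i + t * w i)", OF this] show ?thesis by metis
  qed
  have "\<exists>p. degree p \<le> d \<and> (\<forall>t. h (u(k := t)) = poly p t)" if u: "u \<in> vectors n" and k: "k \<le> n" for u k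
  proof -
    define u0 where "u0 = u(k := 0)"
    define e where "e i = (if i = k then 1 else 0 :: 'k)" for i
    have vec: "u0 \<in> vectors n" "e \<in> vectors n" using u k by (auto simp: u0_def e_def vectors_def)
    have upd: "u(k := t) = (\<lambda>i. u0 i + t * e i)" for t by (auto simp: u0_def e_def fun_eq_iff)
    show ?thesis
    proof (cases "u0 = (\<lambda>_. 0)")
      case True
      then have "h (u(k := t)) = poly (monom (h e) d) t" for t
        using hom[OF vec(2), of t] by (simp add: upd poly_monom mult.commute)
      then show ?thesis using degree_monom_le by blast
    next
      case False
      then obtain j where j: "u0 j \<noteq> 0" "j \<noteq> k" by (metis fun_upd_same u0_def ext)
      have "(\<lambda>i. u0 i + t * e i) \<noteq> (\<lambda>_. 0)" for t
        using j by (auto simp: fun_eq_iff e_def)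
      then obtain p where p: "\<And>t. h (\<lambda>i. u0 i + t * e i) = poly p t" using line vec by metis
      have "(\<lambda>i. e i + t * u0 i) \<noteq> (\<lambda>_. 0)" for t
        by (auto simp: fun_eq_iff e_def u0_def intro!: exI[of _ k])
      then obtain q where q: "\<And>t. h (\<lambda>i. e i + t * u0 i) = poly q t" using line vec by metis
      \<comment> \<open>From \<open>u0 + t * e = t * (e + u0 / t)\<close> one gets
        \<open>p t = t ^ d * q (1 / t)\<close>. Clearing denominators replaces
        \<open>q (1 / t)\<close> by the reflected polynomial, and comparing degrees gives
        \<open>degree p \<le> d\<close>.\<close>
      have "poly (p * monom 1 (degree q)) t = poly (monom 1 d * reflect_poly q) t" if "t \<in> UNIV - {0}" for t
      proof -
        have t: "t \<noteq> 0" using that by simp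
        then have "(\<lambda>i. u0 i + t * e i) = (\<lambda>i. t * (e i + inverse t * u0 i))"
          by (auto simp: fun_eq_iff field_simps)
        moreover have "(\<lambda>i. e i + inverse t * u0 i) \<in> vectors n" using vec by (simp add: vectors_def)
        ultimately have "poly p t = t ^ d * poly q (inverse t)"
          using hom[of "\<lambda>i. e i + inverse t * u0 i" t] by (simp flip: p q)
        then show ?thesis using t by (simp add: poly_monom poly_reflect_poly_nz)
      qed
      then have eq: "p * monom 1 (degree q) = monom 1 d * reflect_poly q"
        by (rule poly_eqI_infinite[OF infinite_nonzero])
      have "degree p \<le> d"
      proof (cases "p = 0")
        case False
        then have "degree p + degree q = degree (p * monom 1 (degree q))"
          by (subst degree_mult_eq) (auto simp: degree_monom_eq)
        also have "\<dots> \<le> degree (monom 1 d :: 'k poly) + degree (reflect_poly q)"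
          unfolding eq by (rule degree_mult_le)
        also have "\<dots> \<le> d + degree q"
          by (intro add_mono degree_monom_le degree_reflect_poly_le)
        finally show ?thesis by simp
      qed simp
      then show ?thesis using p by (auto simp: upd)
    qed
  qed
  then obtain F where F: "F \<in> carrier (poly_ring n)" "\<And>v. v \<in> vectors n \<Longrightarrow> h v = eval v F"
    by (rule separately_polynomial_imp_polynomial) auto
  show ?thesis
    by (rule homogeneous_component[OF F hom]) (use that in auto)
qed

lemma proj_spaceD:
  assumes "P \<in> proj_space n" "v \<in> P"
  shows "v \<in> vectors n" "v \<noteq> (\<lambda>_. 0)" "P = pline v"
proof -
  obtain w where w: "P = pline w" "w \<noteq> (\<lambda>_. 0)" "\<forall>i>n. w i = 0" using assms(1) by (auto simp: proj_space_def)
  with assms(2) obtain c where "v = (\<lambda>i. c * w i)" "c \<noteq> 0" by (auto simp: pline_def)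
  with w show "v \<in> vectors n" "v \<noteq> (\<lambda>_. 0)" by (auto simp: vectors_def fun_eq_iff)
  show "P = pline v" using w(1) assms(2) pline_eq by blast
qed

lemma pline_in_proj_space: "v \<in> vectors n \<Longrightarrow> v \<noteq> (\<lambda>_. 0) \<Longrightarrow> pline v \<in> proj_space n"
  by (auto simp: proj_space_def vectors_def)

text \<open>A vector outside \<open>A\<close> and one outside \<open>B\<close> are joined by a line.
  The two forms that keep its points away from \<open>A\<close> and \<open>B\<close> restrict to
  nonzero polynomials, which have a common non-root over an infinite field.\<close>

lemma irreducible_proj_space: "irreducible_set (proj_space n :: 'k::alg_closed_field point set)"
  unfolding irreducible_set_def
proof (intro conjI allI impI)
  let ?X = "proj_space n :: 'k point set"
  have "(\<lambda>i. if i = 0 then 1 else 0 :: 'k) \<in> vectors n" by (simp add: vectors_def)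
  then have "pline (\<lambda>i. if i = 0 then 1 else 0 :: 'k) \<in> ?X"
    by (rule pline_in_proj_space) (auto simp: fun_eq_iff)
  then show "?X \<noteq> {}" by blast
  fix A B assume AB: "closedin (zariski_on ?X) A" "closedin (zariski_on ?X) B" "?X = A \<union> B"
  have basic: "\<exists>e F v. homogeneous e F \<and> v \<in> vectors n \<and> v \<noteq> (\<lambda>_. 0) \<and> eval v F \<noteq> 0 \<and>
      (\<forall>w\<in>vectors n. w \<noteq> (\<lambda>_. 0) \<longrightarrow> eval w F \<noteq> 0 \<longrightarrow> pline w \<notin> C)"
    if C: "closedin (zariski_on ?X) C" "?X \<noteq> C" for C
  proof -
    have "openin (zariski_on ?X) (?X - C)"
      using C(1) unfolding closedin_def topspace_zariski_on[OF proj_space_subset] by blast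
    then obtain U where U: "zariski_open U" "?X - C = U \<inter> ?X"
      unfolding openin_subtopology openin_zariski by blast
    have "C \<subseteq> ?X" using C(1) closedin_subset topspace_zariski_on[OF proj_space_subset] by blast
    with C(2) obtain P where P: "P \<in> ?X - C" by blast
    then have "P \<in> U" using U(2) by blast
    from zariski_open_contains_basic[OF U(1) this] obtain e F where
      F: "homogeneous e F" "\<And>v. v \<in> P \<Longrightarrow> eval v F \<noteq> 0" "{P \<in> all_points. \<forall>v\<in>P. eval v F \<noteq> 0} \<subseteq> U" by blast
    obtain v where v: "v \<in> P" using P proj_space_subset all_points_nonempty by blast
    have "pline w \<notin> C" if w: "w \<in> vectors n" "w \<noteq> (\<lambda>_. 0)" "eval w F \<noteq> 0" for w
    proof -
      have "\<forall>w'\<in>pline w. eval w' F \<noteq> 0"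
        using all_vectors_iff[OF F(1) pline_in_all_points[OF w(2)] self_in_pline] w(3) by blast
      then have "pline w \<in> U" using F(3) pline_in_all_points[OF w(2)] by blast
      then show ?thesis using U(2) pline_in_proj_space[OF w(1,2)] by blast
    qed
    then show ?thesis
      using F(1) F(2)[OF v] proj_spaceD[OF _ v] P by blast
  qed
  show "?X = A \<or> ?X = B"
  proof (rule ccontr)
    assume "\<not> ?thesis"
    with basic[OF AB(1)] basic[OF AB(2)] obtain F v G w where
      v: "v \<in> vectors n" "v \<noteq> (\<lambda>_. 0)" "eval v F \<noteq> 0" and w: "w \<in> vectors n" "eval w G \<noteq> 0"
      and FG: "\<And>x. x \<in> vectors n \<Longrightarrow> x \<noteq> (\<lambda>_. 0) \<Longrightarrow> eval x F \<noteq> 0 \<Longrightarrow> pline x \<notin> A"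
        "\<And>x. x \<in> vectors n \<Longrightarrow> x \<noteq> (\<lambda>_. 0) \<Longrightarrow> eval x G \<noteq> 0 \<Longrightarrow> pline x \<notin> B" by metis
    obtain k where k: "v k \<noteq> 0" using v(2) by (auto simp: fun_eq_iff)
    define x where "x t i = v i + t * (w i - v i)" for t i
    obtain p where p: "\<forall>t. poly p t = eval (\<lambda>i. v i + t * (w i - v i)) F"
      using eval_line_poly[of v "\<lambda>i. w i - v i" F] by blast
    obtain q where q: "\<forall>t. poly q t = eval (\<lambda>i. v i + t * (w i - v i)) G"
      using eval_line_poly[of v "\<lambda>i. w i - v i" G] by blast
    \<comment> \<open>The joining line may pass through the origin; avoiding the root of this
      coordinate keeps the chosen vector nonzero.\<close>
    define l where "l = [:v k, w k - v k:]"
    have "poly p 0 \<noteq> 0" "poly q 1 \<noteq> 0" "poly l 0 \<noteq> 0"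
      using p q v(3) w(2) k by (simp_all add: l_def)
    then have "p \<noteq> 0" "q \<noteq> 0" "l \<noteq> 0" by auto
    then have "p * q * l \<noteq> 0" by simp
    then obtain t where "poly (p * q * l) t \<noteq> 0"
      using poly_eqI_infinite[OF infinite_alg_closed, of "p * q * l" 0] by auto
    then have "poly p t \<noteq> 0" "poly q t \<noteq> 0" "poly l t \<noteq> 0" by simp_all
    then have "eval (x t) F \<noteq> 0" "eval (x t) G \<noteq> 0" "x t k \<noteq> 0"
      using p q by (simp_all add: x_def[abs_def] l_def)
    moreover from this have "x t \<noteq> (\<lambda>_. 0)" by auto
    moreover have "x t \<in> vectors n" using v(1) w(1) by (simp add: x_def vectors_def)
    ultimately have "pline (x t) \<notin> A \<union> B" "pline (x t) \<in> ?X"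
      using FG pline_in_proj_space by auto
    then show False using AB(3) by blast
  qed
qed

section \<open>The bundle O(1) and its sections\<close>

lemma charts_hyperplane [simp]: "charts (hyperplane_bundle n) = Suc n"
  by (simp add: hyperplane_bundle_def)

lemma homogeneous_var: "homogeneous 1 (var i :: 'k::comm_ring_1 mpoly)"
  by (rule forms_homogeneous[OF forms_var[OF order_refl]])

lemma chart_hyperplane:
  "chart (hyperplane_bundle n) i = {P \<in> proj_space n. \<forall>v\<in>P. eval v (var i) \<noteq> 0}"
  by (simp add: hyperplane_bundle_def)

lemma chart_hyperplane_iff:
  assumes "P \<in> proj_space n" "v \<in> P"
  shows "P \<in> chart (hyperplane_bundle n) i \<longleftrightarrow> v i \<noteq> 0"
  using all_vectors_iff[OF homogeneous_var, of P v i] assms proj_space_subset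
  by (auto simp: chart_hyperplane)

lemma trans_hyperplane:
  assumes "P \<in> proj_space n" "v \<in> P"
  shows "trans_fun (hyperplane_bundle n) i j P = v j / v i"
proof -
  let ?w = "SOME v. v \<in> P"
  have "?w \<in> P" using someI[of "\<lambda>v. v \<in> P" v] assms(2) by simp
  then have "?w \<in> pline v" using proj_spaceD(3)[OF assms] by simp
  then obtain c where "?w = (\<lambda>i. c * v i)" "c \<noteq> 0" by (auto simp: pline_def)
  then show ?thesis by (simp add: hyperplane_bundle_def Let_def)
qed

lemma proj_space_point:
  assumes "P \<in> proj_space n"
  obtains v where "v \<in> P" "v \<in> vectors n" "v \<noteq> (\<lambda>_. 0)" "P = pline v"
proof -
  have "P \<in> all_points" using assms proj_space_subset by blast
  then obtain v where "v \<in> P" using all_points_nonempty by blast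
  then show ?thesis using that[of v] proj_spaceD[OF assms, of v] by blast
qed

lemma openin_chart_hyperplane: "openin (zariski_on (proj_space n)) (chart (hyperplane_bundle n) i)"
  unfolding chart_hyperplane by (rule openin_basic[OF homogeneous_var proj_space_subset])

lemma chart_hyperplane_subset: "chart (hyperplane_bundle n) i \<subseteq> proj_space n"
  by (auto simp: chart_hyperplane)

lemma regular_trans_hyperplane:
  assumes "openin (zariski_on (proj_space n)) U" "U \<subseteq> chart (hyperplane_bundle n) i"
  shows "regular_on (proj_space n) U (trans_fun (hyperplane_bundle n) i j)"
proof (rule regular_on_quotient[OF assms(1) homogeneous_var homogeneous_var])
  fix P v assume "P \<in> U" "v \<in> P"
  moreover from this have "P \<in> proj_space n" using assms(2) chart_hyperplane_subset by blast
  ultimately show "eval v (var i) \<noteq> 0 \<and> trans_fun (hyperplane_bundle n) i j P = eval v (var j) / eval v (var i)"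
    using assms(2) chart_hyperplane_iff trans_hyperplane by (metis eval_var subsetD)
qed

lemma variety_bundle_hyperplane: "variety_bundle (proj_space n) (hyperplane_bundle n :: 'k::field line_bundle)"
proof
  let ?L = "hyperplane_bundle n :: 'k line_bundle"
  have cover: "(\<Union>i<charts ?L. chart ?L i) = proj_space n"
  proof
    show "proj_space n \<subseteq> (\<Union>i<charts ?L. chart ?L i)"
    proof
      fix P :: "'k point" assume P: "P \<in> proj_space n"
      obtain v where v: "v \<in> P" "v \<in> vectors n" "v \<noteq> (\<lambda>_. 0)" using proj_space_point[OF P] .
      then obtain i where "v i \<noteq> 0" by (auto simp: fun_eq_iff)
      moreover from this v(2) have "i \<le> n" by (auto simp: vectors_def not_less[symmetric])
      ultimately show "P \<in> (\<Union>i<charts ?L. chart ?L i)"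
        using chart_hyperplane_iff[OF P v(1)] by auto
    qed
  qed (use chart_hyperplane_subset in blast)
  have nz: "trans_fun ?L i j P \<noteq> 0" if "P \<in> chart ?L i \<inter> chart ?L j" for i j P
  proof -
    have P: "P \<in> proj_space n" using that chart_hyperplane_subset by blast
    obtain v where v: "v \<in> P" using proj_space_point[OF P] .
    show ?thesis using that chart_hyperplane_iff[OF P v] by (simp add: trans_hyperplane[OF P v])
  qed
  have cocycle: "trans_fun ?L i k P = trans_fun ?L i j P * trans_fun ?L j k P"
    if "P \<in> chart ?L i \<inter> chart ?L j \<inter> chart ?L k" for i j k P
  proof -
    have P: "P \<in> proj_space n" using that chart_hyperplane_subset by blast
    obtain v where v: "v \<in> P" using proj_space_point[OF P] .
    show ?thesis using that chart_hyperplane_iff[OF P v] by (simp add: trans_hyperplane[OF P v])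
  qed
  show "line_bundle_on (proj_space n) ?L"
    unfolding line_bundle_on_def
    by (intro conjI allI impI ballI cover nz cocycle openin_chart_hyperplane
        regular_trans_hyperplane openin_Int Int_lower1)
qed (rule proj_space_subset)

text \<open>The linear form \<open>x_a\<close> as a section of O(1): on chart \<open>i\<close> it is
  \<open>x_a / x_i\<close>, the transition function from \<open>a\<close> to
  \<open>i\<close>.\<close>

definition coordinate_section :: "nat \<Rightarrow> nat \<Rightarrow> 'k::field sect" where
  "coordinate_section n a i P =
     (if (i, P) \<in> chart_points (hyperplane_bundle n) then trans_fun (hyperplane_bundle n) i a P else 0)"

lemma coordinate_section_eq:
  assumes "P \<in> proj_space n" "v \<in> P" "i \<le> n" "v i \<noteq> 0"
  shows "coordinate_section n a i P = v a / v i"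
  using assms chart_hyperplane_iff[OF assms(1,2)] trans_hyperplane[OF assms(1,2)]
  by (simp add: coordinate_section_def chart_points_def)

lemma coordinate_section_H0: "coordinate_section n a \<in> H0 (proj_space n) (hyperplane_bundle n)"
proof (rule H0_I)
  fix i assume "i < charts (hyperplane_bundle n :: 'a line_bundle)"
  then show "regular_on (proj_space n) (chart (hyperplane_bundle n) i) (coordinate_section n a i)"
    by (intro regular_on_cong[THEN iffD1, OF _ regular_trans_hyperplane[of _ _ _ a]] openin_chart_hyperplane)
       (auto simp: coordinate_section_def chart_points_def)
next
  fix i j :: nat and P :: "'a point"
  assume *: "i < charts (hyperplane_bundle n :: 'a line_bundle)" "j < charts (hyperplane_bundle n :: 'a line_bundle)"
    "P \<in> chart (hyperplane_bundle n) i" "P \<in> chart (hyperplane_bundle n) j"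
  then have P: "P \<in> proj_space n" using chart_hyperplane_subset by blast
  obtain v where v: "v \<in> P" using proj_space_point[OF P] .
  show "coordinate_section n a i P = trans_fun (hyperplane_bundle n) i j P * coordinate_section n a j P"
    using * chart_hyperplane_iff[OF P v]
    by (simp add: coordinate_section_eq[OF P v] trans_hyperplane[OF P v])
qed (simp add: coordinate_section_def)

text \<open>A section \<sigma> of O(d) is turned into the function
  \<open>\<sigma> i (pline v) * v i ^ d\<close> on the affine cone. The transition rule makes it
  independent of \<open>i\<close>, and it is homogeneous and locally rational, hence a form.\<close>

lemma j_normal_proj_space:
  assumes "0 < d"
  shows "j_normal (proj_space n) (hyperplane_bundle n :: 'k::alg_closed_field line_bundle) n (coordinate_section n) d"
  unfolding j_normal_def
proof
  let ?L = "hyperplane_bundle n :: 'k line_bundle"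
  interpret variety_bundle "proj_space n" ?L by (rule variety_bundle_hyperplane)
  fix \<sigma> assume \<sigma>: "\<sigma> \<in> H0 (proj_space n) (tensor_power ?L d)"
  \<comment> \<open>The value 0 at the origin is consistent with homogeneity for
    \<open>c = 0\<close> because \<open>d > 0\<close>.\<close>
  define h where "h v = (if v = (\<lambda>_. 0) then 0 else \<sigma> (SOME i. i \<le> n \<and> v i \<noteq> 0) (pline v) * v (SOME i. i \<le> n \<and> v i \<noteq> 0) ^ d)" for v
  have chart: "pline v \<in> chart ?L i" if "v \<in> vectors n" "v i \<noteq> 0" for v i
  proof -
    have "v \<noteq> (\<lambda>_. 0)" using that(2) by auto
    from chart_hyperplane_iff[OF pline_in_proj_space[OF that(1) this] self_in_pline] that(2)
    show ?thesis by blast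
  qed
  have h_eq: "h v = \<sigma> i (pline v) * v i ^ d" if v: "v \<in> vectors n" "i \<le> n" "v i \<noteq> 0" for v i
  proof -
    let ?j = "SOME i. i \<le> n \<and> v i \<noteq> 0"
    have j: "?j \<le> n \<and> v ?j \<noteq> 0" by (rule someI[of _ i]) (use v in simp)
    have nz: "v \<noteq> (\<lambda>_. 0)" using v(3) by auto
    have "\<sigma> ?j (pline v) = trans_fun (tensor_power ?L d) ?j i (pline v) * \<sigma> i (pline v)"
      using j v chart by (intro H0_trans[OF \<sigma>]) auto
    also have "trans_fun (tensor_power ?L d) ?j i (pline v) = (v i / v ?j) ^ d"
      by (simp add: trans_hyperplane[OF pline_in_proj_space[OF v(1) nz] self_in_pline])
    finally show ?thesis using j nz by (simp add: h_def power_divide)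
  qed
  have "\<exists>F\<in>forms n d. \<forall>v\<in>vectors n. h v = eval v F"
  proof (rule locally_rational_homogeneous_imp_form[of n h d])
    fix c :: 'k and v :: "nat \<Rightarrow> 'k" assume v: "v \<in> vectors n"
    show "h (\<lambda>i. c * v i) = c ^ d * h v"
    proof (cases "c = 0 \<or> v = (\<lambda>_. 0)")
      case True
      then show ?thesis using assms by (auto simp: h_def)
    next
      case False
      then obtain i where i: "v i \<noteq> 0" by (auto simp: fun_eq_iff)
      with v have "i \<le> n" by (auto simp: vectors_def not_less[symmetric])
      have "(\<lambda>i. c * v i) \<in> pline v" using False by (auto simp: pline_def)
      then have pl: "pline (\<lambda>i. c * v i) = pline v" by (rule pline_eq)
      have "(\<lambda>i. c * v i) \<in> vectors n" using v by (simp add: vectors_def)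
      from h_eq[OF this \<open>i \<le> n\<close>] h_eq[OF v \<open>i \<le> n\<close> i] False i show ?thesis
        by (simp add: pl power_mult_distrib)
    qed
  next
    fix v :: "nat \<Rightarrow> 'k" assume v: "v \<in> vectors n" "v \<noteq> (\<lambda>_. 0)"
    then obtain i where i: "v i \<noteq> 0" by (auto simp: fun_eq_iff)
    with v have "i \<le> n" by (auto simp: vectors_def not_less[symmetric])
    then have "regular_on (proj_space n) (chart ?L i) (\<sigma> i)"
      using H0_regular[OF \<sigma>, of i] by simp
    with chart[OF v(1) i] obtain V e F G where V: "openin (zariski_on (proj_space n)) V" "pline v \<in> V"
      "\<forall>Q\<in>V. \<forall>v\<in>Q. eval v G \<noteq> 0 \<and> \<sigma> i Q = eval v F / eval v G" unfolding regular_on_def by metis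
    obtain U where U: "zariski_open U" "V = U \<inter> proj_space n"
      using V(1) unfolding openin_subtopology openin_zariski by blast
    have "pline v \<in> U" using V(2) U(2) by blast
    from zariski_open_contains_basic[OF U(1) this] obtain e' B where
      B: "homogeneous e' B" "\<And>w. w \<in> pline v \<Longrightarrow> eval w B \<noteq> 0" "{P \<in> all_points. \<forall>v\<in>P. eval v B \<noteq> 0} \<subseteq> U" by blast
    show "\<exists>F G. eval v G \<noteq> 0 \<and> (\<forall>w\<in>vectors n. eval w G \<noteq> 0 \<longrightarrow> h w = eval w F / eval w G)"
    proof (intro exI conjI ballI impI)
      show "eval v (G * B * var i) \<noteq> 0"
        using V(2,3) B(2) i self_in_pline by (auto simp: eval_mult)
      fix w assume w: "w \<in> vectors n" "eval w (G * B * var i) \<noteq> 0"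
      then have w_nz: "eval w G \<noteq> 0" "eval w B \<noteq> 0" "w i \<noteq> 0" by (auto simp: eval_mult)
      then have nz: "w \<noteq> (\<lambda>_. 0)" by auto
      have "\<forall>w'\<in>pline w. eval w' B \<noteq> 0"
        using all_vectors_iff[OF B(1) pline_in_all_points[OF nz] self_in_pline] w_nz(2) by blast
      then have "pline w \<in> V"
        using B(3) U(2) pline_in_all_points[OF nz] pline_in_proj_space[OF w(1) nz] by blast
      then have "\<sigma> i (pline w) = eval w F / eval w G"
        using V(3) self_in_pline by blast
      \<comment> \<open>The factors \<open>B\<close> and \<open>var i\<close> in the denominator
        confine \<open>w\<close> to the neighbourhood \<open>V\<close> and to the chart. They are
        compensated in the numerator, whence the exponent \<open>Suc d\<close>.\<close>
      then show "h w = eval w (F * B * var i ^ Suc d) / eval w (G * B * var i)"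
        using w_nz by (simp add: h_eq[OF w(1) \<open>i \<le> n\<close> w_nz(3)] eval_mult eval_power)
    qed
  qed blast
  then obtain F where F: "F \<in> forms n d" "\<And>v. v \<in> vectors n \<Longrightarrow> h v = eval v F" by blast
  have "\<sigma> i P = restrict_form ?L (coordinate_section n) F i P" for i P
  proof (cases "(i, P) \<in> chart_points ?L")
    case True
    then have i: "i \<le> n" "P \<in> chart ?L i" by (auto simp: chart_points_def)
    then have P: "P \<in> proj_space n" using chart_hyperplane_subset by blast
    obtain v where v: "v \<in> P" "v \<in> vectors n" "v \<noteq> (\<lambda>_. 0)" "P = pline v" using proj_space_point[OF P] .
    have vi: "v i \<noteq> 0" using chart_hyperplane_iff[OF P v(1)] i(2) by blast
    have "restrict_form ?L (coordinate_section n) F i P = eval (\<lambda>a. inverse (v i) * v a) F"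
      using i by (simp add: restrict_form_def coordinate_section_eq[OF P v(1) i(1) vi] divide_inverse mult.commute)
    also have "\<dots> = inverse (v i) ^ d * h v"
      by (simp add: eval_homogeneous_scale[OF forms_homogeneous[OF F(1)]] F(2)[OF v(2)])
    also have "\<dots> = \<sigma> i P"
      using vi by (simp add: h_eq[OF v(2) i(1) vi] v(4) power_inverse field_simps)
    finally show ?thesis by simp
  next
    case False
    then show ?thesis
      using H0_outside[OF \<sigma>, of i P] by (auto simp: restrict_form_def chart_points_def)
  qed
  then have "\<sigma> = restrict_form ?L (coordinate_section n) F" by (simp add: fun_eq_iff)
  then show "\<sigma> \<in> restrict_form ?L (coordinate_section n) ` forms n d" using F(1) by blast
qed

lemma embedding_ideal_proj_space:
  "embedding_ideal (proj_space n) (hyperplane_bundle n :: 'k::alg_closed_field line_bundle) n (coordinate_section n) = {0}"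
proof -
  let ?L = "hyperplane_bundle n :: 'k line_bundle"
  interpret variety_bundle "proj_space n" ?L by (rule variety_bundle_hyperplane)
  have "F = 0" if F: "F \<in> forms n e" and zero: "\<And>z. z \<in> chart_points ?L \<Longrightarrow> eval (coords (coordinate_section n) z) F = 0" for F e
  proof (rule eval_zero_imp_zero[OF forms_carrier[OF F]])
    have nonzero: "eval v F = 0" if v: "v \<in> vectors n" "v \<noteq> (\<lambda>_. 0)" for v
    proof -
      obtain i where i: "v i \<noteq> 0" using v(2) by (auto simp: fun_eq_iff)
      with v(1) have "i \<le> n" by (auto simp: vectors_def not_less[symmetric])
      note P = pline_in_proj_space[OF v]
      have "(i, pline v) \<in> chart_points ?L"
        using chart_hyperplane_iff[OF P self_in_pline] i \<open>i \<le> n\<close> by (simp add: chart_points_def)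
      from zero[OF this] have "eval (\<lambda>a. inverse (v i) * v a) F = 0"
        by (simp add: coordinate_section_eq[OF P self_in_pline \<open>i \<le> n\<close> i] divide_inverse mult.commute)
      then show ?thesis using i by (simp add: eval_homogeneous_scale[OF forms_homogeneous[OF F]])
    qed
    fix v :: "nat \<Rightarrow> 'k" assume "v \<in> vectors n"
    show "eval v F = 0"
    proof (cases "v = (\<lambda>_. 0)")
      \<comment> \<open>The zero vector is no point, but the value there is \<open>0 ^ e\<close>
        times the value at a coordinate vector, which also covers constants.\<close>
      case True
      let ?e = "\<lambda>i. if i = 0 then 1 else 0 :: 'k"
      have "eval ?e F = 0" by (rule nonzero) (auto simp: vectors_def fun_eq_iff)
      moreover have "eval v F = 0 ^ e * eval ?e F"
        using eval_homogeneous_scale[OF forms_homogeneous[OF F], of 0 ?e] by (simp add: True)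
      ultimately show ?thesis by simp
    qed (use nonzero \<open>v \<in> vectors n\<close> in blast)
  qed
  then have "vanishing_forms n (chart_points ?L) (coords (coordinate_section n)) \<subseteq> {0}"
    unfolding vanishing_forms_def by blast
  moreover have "ideal {0 :: 'k mpoly} (poly_ring n)"
    unfolding ideal_poly_ring_iff by (auto simp: forms_carrier[OF forms_zero])
  ultimately have "embedding_ideal (proj_space n) ?L n (coordinate_section n) \<subseteq> {0}"
    unfolding embedding_ideal_eq[OF charts_cover] vanishing_ideal_def by (intro genideal_subset)
  moreover have "0 \<in> embedding_ideal (proj_space n) ?L n (coordinate_section n)"
    unfolding embedding_ideal_eq[OF charts_cover] using ideal_vanishing_ideal ideal_poly_ring_iff by blast
  ultimately show ?thesis by blast
qed

text \<open>The ideal of projective space in its own coordinates is zero, hence generated in degree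
  at most 3. The first two coordinates serve as the independent sections.\<close>

lemma rank_index_veronese:
  assumes "(3::'k::alg_closed_field) = 0" "1 \<le> n" "3 \<le> d"
  shows "rank_index (proj_space n :: 'k point set) (twisting_bundle n d) = 3"
  unfolding twisting_bundle_def
proof (rule rank_index_tensor_power)
  show "variety_bundle (proj_space n :: 'k point set) (hyperplane_bundle n)" by (rule variety_bundle_hyperplane)
  show "irreducible_set (proj_space n :: 'k point set)" by (rule irreducible_proj_space)
  show "coordinate_section n a \<in> H0 (proj_space n) (hyperplane_bundle n :: 'k line_bundle)" for a
    by (rule coordinate_section_H0)
  show "j_normal (proj_space n) (hyperplane_bundle n :: 'k line_bundle) n (coordinate_section n) d"
    by (rule j_normal_proj_space) (use assms in simp)
  have "genideal (poly_ring n) {0 :: 'k mpoly} = {0}"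
  proof
    show "genideal (poly_ring n) {0 :: 'k mpoly} \<subseteq> {0}"
      by (rule genideal_subset) (auto simp: ideal_poly_ring_iff forms_carrier[OF forms_zero])
  qed (rule subset_genideal)
  moreover have "{F \<in> {0 :: 'k mpoly}. \<exists>e\<le>3. F \<in> forms n e} = {0}" by auto
  ultimately show "generated_in_degree_le n
      (embedding_ideal (proj_space n) (hyperplane_bundle n :: 'k line_bundle) n (coordinate_section n)) 3"
    unfolding generated_in_degree_le_def embedding_ideal_proj_space by simp
  show "coordinate_section n 0 \<in> H0 (proj_space n) (hyperplane_bundle n :: 'k line_bundle)"
    "coordinate_section n 1 \<in> H0 (proj_space n) (hyperplane_bundle n :: 'k line_bundle)"
    by (rule coordinate_section_H0)+
  fix \<alpha> \<beta> :: 'k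
  assume eq: "\<And>i P. \<alpha> * coordinate_section n 0 i P = \<beta> * coordinate_section n 1 i P"
  define e where "e k i = (if i = k then 1 else 0 :: 'k)" for k i :: nat
  have "coordinate_section n a k (pline (e k)) = e k a" if "k \<le> 1" for a k
  proof -
    have "e k \<in> vectors n" "e k \<noteq> (\<lambda>_. 0)" using that assms(2) by (auto simp: e_def vectors_def fun_eq_iff)
    from coordinate_section_eq[OF pline_in_proj_space[OF this] self_in_pline, of k a] that assms(2)
    show ?thesis by (simp add: e_def)
  qed
  then show "\<alpha> = 0 \<and> \<beta> = 0"
    using eq[of 0 "pline (e 0)"] eq[of 1 "pline (e 1)"] by (simp add: e_def)
qed (use assms in auto)

section \<open>The rank index\<close>

text \<open>If \<open>H\<^sup>0(X, L)\<close> is one-dimensional, every \<open>section_map\<close> into projective space is constant.\<close>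

lemma very_ample_imp_two_sections:
  assumes L: "variety_bundle X L" and basis: "H0_basis X L r s" and va: "very_ample X L"
    and X: "\<not> is_singleton X" "X \<noteq> {}"
  shows "1 \<le> r"
proof (rule ccontr)
  interpret variety_bundle X L by (rule L)
  assume "\<not> 1 \<le> r"
  then have r: "r = 0" by simp
  obtain r' s' where s': "s' ` {..r'} \<subseteq> H0 X L" and emb: "closed_embedding X r' (section_map L r' s')"
    using va unfolding very_ample_def by blast
  let ?\<phi> = "section_map L r' s'"
  have "\<exists>c. \<forall>i P. s' a i P = c * s 0 i P" if "a \<le> r'" for a
  proof -
    have "s' a \<in> sections.span (s ` {..r})" "inj_on s {..r}"
      using s' that basis by (auto simp: H0_basis_def)
    from span_sections_coeffs[OF this(2,1)] obtain c where "\<And>i P. s' a i P = (\<Sum>a\<le>r. c a * s a i P)" by blast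
    then show ?thesis unfolding r by auto
  qed
  then obtain c where c: "\<And>a i P. a \<le> r' \<Longrightarrow> s' a i P = c a * s 0 i P" by metis
  define c' where "c' a = (if a \<le> r' then c a else 0)" for a
  have const: "?\<phi> P = pline c'" if P: "P \<in> X" for P
  proof -
    have \<phi>: "?\<phi> P \<in> proj_space r'" using emb P unfolding closed_embedding_def by blast
    obtain i where i: "i < charts L" "P \<in> chart L i" using P charts_cover by blast
    have pl: "(\<lambda>a. if a \<le> r' then s' a i P else 0) = (\<lambda>a. s 0 i P * c' a)" for i
      by (auto simp: fun_eq_iff c c'_def)
    then have mem: "(\<lambda>a. s 0 i P * c' a) \<in> ?\<phi> P"
      unfolding section_map_def using i self_in_pline by fastforce
    \<comment> \<open>Since the image is a point of projective space, the common factor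
      \<open>s 0 i P\<close> is nonzero, and scaling by it leaves the line of \<open>c'\<close>
      unchanged.\<close>
    have "(\<lambda>a. s 0 i P * c' a) \<noteq> (\<lambda>_. 0)"
      by (rule proj_spaceD(2)[OF \<phi> mem])
    then have "s 0 i P \<noteq> 0" by auto
    then have "(\<lambda>a. s 0 i P * c' a) \<in> pline c'" by (auto simp: pline_def)
    then have "pline (\<lambda>a. s 0 i P * c' a) = pline c'" by (rule pline_eq)
    then show ?thesis using proj_spaceD(3)[OF \<phi> mem] by simp
  qed
  have "inj_on ?\<phi> X"
    using emb unfolding closed_embedding_def homeomorphic_map_def topspace_zariski_on[OF points] by blast
  then have eq: "x = y" if "x \<in> X" "y \<in> X" for x y
    using const that by (metis inj_onD)
  obtain x where "x \<in> X" using X(2) by blast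
  with eq have "X = {x}" by blast
  then show False using X(1) by (simp add: is_singleton_def)
qed

text \<open>A single point is excluded in the second part: it is re-embedded as the whole of a
  zero-dimensional projective space, where the ideal is zero and the rank index is 0.\<close>

theorem theorem1p2:
  assumes "CHAR('k::alg_closed_field) = 3"
  shows
    "(\<forall>n\<ge>2. \<forall>d\<ge>3. rank_index (proj_space n :: 'k point set) (twisting_bundle n d) = 3) \<and>
     (\<forall>(X :: 'k point set) L r s m.
        projective_variety X \<longrightarrow> \<not> is_singleton X \<longrightarrow>
        line_bundle_on X L \<longrightarrow> very_ample X L \<longrightarrow> H0_basis X L r s \<longrightarrow>
        m \<ge> 3 \<longrightarrow> (\<forall>j\<ge>m. j_normal X L r s j) \<longrightarrow>
        generated_in_degree_le r (embedding_ideal X L r s) m \<longrightarrow>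
        (\<forall>d\<ge>m. rank_index X (tensor_power L d) = 3))"
proof (intro conjI allI impI)
  have three: "(3::'k) = 0"
    using of_nat_CHAR[where 'a = 'k] assms by simp
  show "rank_index (proj_space n :: 'k point set) (twisting_bundle n d) = 3" if "2 \<le> n" "3 \<le> d" for n d
    using that by (intro rank_index_veronese three) auto
  fix X :: "'k point set" and L r s m d
  assume X: "projective_variety X" "\<not> is_singleton X" and "line_bundle_on X L" and va: "very_ample X L"
    and basis: "H0_basis X L r s" and m: "3 \<le> m" "m \<le> d" and normal: "\<forall>j\<ge>m. j_normal X L r s j"
    and gen: "generated_in_degree_le r (embedding_ideal X L r s) m"
  have "X \<subseteq> all_points" "irreducible_set X" "X \<noteq> {}"
    using X(1) proj_space_subset unfolding projective_variety_def irreducible_set_def by blast+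
  then have L: "variety_bundle X L" using \<open>line_bundle_on X L\<close> by (intro variety_bundle.intro)
  interpret variety_bundle X L by (rule L)
  have r: "1 \<le> r"
    by (rule very_ample_imp_two_sections[OF L basis va X(2) \<open>X \<noteq> {}\<close>])
  show "rank_index X (tensor_power L d) = 3"
  proof (rule rank_index_tensor_power[OF L \<open>irreducible_set X\<close> _ _ gen m(2) _ three])
    show "s a \<in> H0 X L" if "a \<le> r" for a using basis_in_H0[OF basis that] .
    show "s 0 \<in> H0 X L" "s 1 \<in> H0 X L" using basis_in_H0[OF basis] r by auto
    show "j_normal X L r s d" "3 \<le> d" using normal m by auto
    fix \<alpha> \<beta> assume eq: "\<And>i P. \<alpha> * s 0 i P = \<beta> * s 1 i P"
    \<comment> \<open>Proportionality of the first two basis sections is read as a linear relation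
      among all of them, with zero coefficients beyond index 1.\<close>
    define c where "c a = (if a = 0 then \<alpha> else if a = 1 then - \<beta> else 0)" for a :: nat
    have "(\<Sum>a\<le>r. c a * coords s z a) = 0" for z
    proof -
      have "(\<Sum>a\<le>r. c a * coords s z a) = (\<Sum>a\<in>{0, 1}. c a * coords s z a)"
        using r by (intro sum.mono_neutral_right) (auto simp: c_def)
      then show ?thesis using eq by (simp add: c_def)
    qed
    then have "c a = 0" if "a \<le> r" for a using basis_coeff_zero[OF basis _ that] by blast
    from this[of 0] this[of 1] r show "\<alpha> = 0 \<and> \<beta> = 0" by (simp add: c_def)
  qed
qed

end
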